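(* Let $V_h(\hat K)\subset H(\mathrm{div};\hat K)$ and $\bar Q_h(\hat F)$ be finite-dimensional polynomial spaces on the reference cell and the reference facet such that $$\bar Q_h(\hat F)\supseteq\{\hat v_h|_{\hat F}\cdot\hat n:\hat v_h\in V_h(\hat K)\}.$$ Let $V_h(K)=\{\psi_K^{-1}(\hat v):\hat v\in V_h(\hat K)\}$ with $\psi_K$ the contravariant Piola transform $\psi_K(v)=\det(J_K)J_K^{-1}(v\circ T_K)$, and let $\bar Q_h(F)$ be generated from $\bar Q_h(\hat F)$ in the same way using the composition $\psi_F(\bar q_h)=\bar q_h\circ T_K|_{\hat F}$. Then discretely divergence-free functions have continuous normal components across facets, i.e. $X_h\subset H(\mathrm{div};\Omega_h)$.
   Context: $\Omega_h\subset\mathbb R^d$, $d\in\{2,3\}$, is partitioned by a conforming mesh $\mathcal T_h$ of triangular/quadrilateral ($d=2$) or tetrahedral/hexahedral ($d=3$), possibly curved, cells $K=T_K(\hat K)$, where $\hat K$ is a reference cell and $T_K$ is a $C^1$-diffeomorphism (from a Lagrange geometric reference element) with Jacobian matrix $J_K$. $\hat F$ denotes a facet of $\hat K$, $F=T_K(\hat F)$ a facet of the mesh, $\hat n$ and $n$ the outward unit normals to $\partial\hat K$ and $\partial K$. $\mathcal F_h$ is the set of all facets, $\Gamma_h=\bigcup_{F\in\mathcal F_h}F$. The condition on $\bar Q_h(\hat F)$ is understood for every facet of $\hat K$, and the space $\bar Q_h(F)$ of an interior facet does not depend on which of the two adjacent cells is used to generate it. Given also a finite-dimensional local space $Q_h(K)$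 on each cell, set $V_h=\{v_h\in[L^2(\Omega_h)]^d: v_h|_K\in V_h(K)\ \forall K\}$, $Q_h=\{q_h\in L^2(\Omega_h): q_h|_K\in Q_h(K)\ \forall K\}$, $\bar Q_h=\{\bar q_h\in L^2(\Gamma_h):\bar q_h|_F\in\bar Q_h(F)\ \forall F\in\mathcal F_h\}$, $\boldsymbol Q_h=Q_h\times\bar Q_h$, $b_h(v_h,(q_h,\bar q_h))=-\sum_K\int_Kq_h\nabla\cdot v_h\,dx+\sum_K\int_{\partial K}v_h\cdot n\,\bar q_h\,ds$, and $X_h=\{v_h\in V_h:b_h(v_h,\boldsymbol q_h)=0\ \forall\boldsymbol q_h\in\boldsymbol Q_h\}$ (the discretely divergence-free functions). *)

theory Defs
  imports "HOL-Analysis.Analysis"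
begin

definition fin_dim_space :: "('a \<Rightarrow> 'b::real_vector) set \<Rightarrow> bool" where
  "fin_dim_space W \<longleftrightarrow>
     (\<exists>B. finite B \<and> W = {w. \<exists>c :: ('a \<Rightarrow> 'b) \<Rightarrow> real. w = (\<lambda>x. \<Sum>b\<in>B. c b *\<^sub>R b x)})"

definition square_integrable :: "'a measure \<Rightarrow> ('a \<Rightarrow> 'b::euclidean_space) \<Rightarrow> bool" where
  "square_integrable M f \<longleftrightarrow> f \<in> borel_measurable M \<and> integrable M (\<lambda>x. (norm (f x))\<^sup>2)"

text \<open>A smooth function: \<^term>\<open>D is\<close> is the iterated partial derivative with respect to the
  coordinates in the list \<^term>\<open>is\<close>; all of them exist and are differentiable everywhere.\<close>

definition smooth :: "(real^'d \<Rightarrow> real) \<Rightarrow> bool" where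
  "smooth \<phi> \<longleftrightarrow>
     (\<exists>D :: 'd list \<Rightarrow> real^'d \<Rightarrow> real. D [] = \<phi> \<and>
        (\<forall>is x. (D is has_derivative (\<lambda>h. \<Sum>i\<in>UNIV. h $ i * D (i # is) x)) (at x)))"

definition test_function :: "(real^'d) set \<Rightarrow> (real^'d \<Rightarrow> real) \<Rightarrow> bool" where
  "test_function \<Omega> \<phi> \<longleftrightarrow>
     smooth \<phi> \<and> (\<exists>C. compact C \<and> C \<subseteq> \<Omega> \<and> (\<forall>x. x \<notin> C \<longrightarrow> \<phi> x = 0))"

definition grad :: "(real^'d \<Rightarrow> real) \<Rightarrow> real^'d \<Rightarrow> real^'d" where
  "grad \<phi> x = (\<chi> i. frechet_derivative \<phi> (at x) (axis i 1))"

definition divergence :: "(real^'d \<Rightarrow> real^'d) \<Rightarrow> real^'d \<Rightarrow> real" where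
  "divergence v x = trace (jacobian v (at x))"

text \<open>\<open>H(div; \<Omega>)\<close>: square integrable fields whose distributional divergence \<^term>\<open>g\<close> is
  square integrable.\<close>

definition Hdiv :: "(real^'d) set \<Rightarrow> (real^'d \<Rightarrow> real^'d) set" where
  "Hdiv \<Omega> = {v. square_integrable (lebesgue_on \<Omega>) v \<and>
     (\<exists>g :: real^'d \<Rightarrow> real. square_integrable (lebesgue_on \<Omega>) g \<and>
        (\<forall>\<phi>. test_function \<Omega> \<phi> \<longrightarrow>
           (LINT x|lebesgue_on \<Omega>. v x \<bullet> grad \<phi> x) = - (LINT x|lebesgue_on \<Omega>. g x * \<phi> x)))}"

text \<open>Polynomial maps with exponents in a given set; \<open>Pk\<close> bounds the total degree and
  \<open>Qk\<close> the degree in each variable.  These are the maps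
  \<open>x \<mapsto> \<Sum>i. \<theta>\<^sub>i x *\<^sub>R a\<^sub>i\<close> with \<open>\<theta>\<^sub>i\<close> the nodal basis of the Lagrange element of degree
  \<open>k\<close> on a simplex, respectively a box, and nodes \<open>a\<^sub>i\<close>.\<close>

definition poly_maps :: "('d \<Rightarrow> nat) set \<Rightarrow> (real^'d \<Rightarrow> real^'d) set" where
  "poly_maps I = {f. \<exists>c. f = (\<lambda>x. \<Sum>\<alpha>\<in>I. (\<Prod>i\<in>UNIV. (x $ i) ^ \<alpha> i) *\<^sub>R c \<alpha>)}"

definition Pk :: "nat \<Rightarrow> (real^'d \<Rightarrow> real^'d) set" where
  "Pk k = poly_maps {\<alpha>. (\<Sum>i\<in>UNIV. \<alpha> i) \<le> k}"

definition Qk :: "nat \<Rightarrow> (real^'d \<Rightarrow> real^'d) set" where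
  "Qk k = poly_maps {\<alpha>. \<forall>i. \<alpha> i \<le> k}"

text \<open>On the closed reference cell; by the inverse function theorem the inverse is
  automatically \<open>C\<^sup>1\<close>.\<close>

definition C1_diffeo_on :: "(real^'d \<Rightarrow> real^'d) \<Rightarrow> (real^'d) set \<Rightarrow> bool" where
  "C1_diffeo_on f S \<longleftrightarrow>
     inj_on f S \<and> (\<forall>x\<in>S. f differentiable (at x)) \<and>
     continuous_on S (\<lambda>x. jacobian f (at x)) \<and> (\<forall>x\<in>S. det (jacobian f (at x)) \<noteq> 0)"

text \<open>\<open>'d\<close> indexes the coordinates of the ambient space and \<open>'f\<close> those of a facet, so that
  \<open>CARD('d) = CARD('f) + 1\<close>.  The field \<^term>\<open>chart\<close> supplies, for every facet of the reference
  cell, an affine parametrization of its hyperplane; it is used only to define surface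
  measures, which do not depend on its choice.\<close>

record ('d, 'f) mesh =
  domain :: "(real^'d) set"
  ref_cell :: "(real^'d) set"
  cells :: "(real^'d) set set"
  geo :: "(real^'d) set \<Rightarrow> real^'d \<Rightarrow> real^'d"
  chart :: "(real^'d) set \<Rightarrow> real^'f \<Rightarrow> real^'d"

definition simplicial :: "('d::finite, 'f::finite) mesh \<Rightarrow> bool" where
  "simplicial M \<longleftrightarrow> int CARD('d) simplex ref_cell M"

definition box_shaped :: "('d::finite, 'f::finite) mesh \<Rightarrow> bool" where
  "box_shaped M \<longleftrightarrow> (\<exists>a b. box a b \<noteq> {} \<and> ref_cell M = cbox a b)"

text \<open>The last condition says that two distinct cells meet in a common face (possibly empty),
  and that both geometric maps parametrize this face in the same way up to an affine
  identification \<^term>\<open>\<tau>\<close> of the two reference faces: in a Lagrange mesh the adjacent cells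
  share the nodes on a common face, which determine the map on that face.\<close>

definition conforming_mesh :: "('d::finite, 'f::finite) mesh \<Rightarrow> bool" where
  "conforming_mesh M \<longleftrightarrow>
     CARD('d) = CARD('f) + 1 \<and>
     (\<forall>F. F facet_of ref_cell M \<longrightarrow>
        (\<exists>L b. linear L \<and> inj L \<and> chart M F = (\<lambda>s. b + L s) \<and> F \<subseteq> range (chart M F))) \<and>
     open (domain M) \<and> finite (cells M) \<and> \<Union>(cells M) = closure (domain M) \<and>
     (\<forall>K\<in>cells M. interior K \<subseteq> domain M) \<and>
     (\<exists>k\<ge>1. simplicial M \<and> (\<forall>K\<in>cells M. geo M K \<in> Pk k) \<or>
             box_shaped M \<and> (\<forall>K\<in>cells M. geo M K \<in> Qk k)) \<and>
     (\<forall>K\<in>cells M. C1_diffeo_on (geo M K) (ref_cell M) \<and> geo M K ` ref_cell M = K) \<and>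
     (\<forall>K\<in>cells M. \<forall>K'\<in>cells M. K \<noteq> K' \<longrightarrow>
        (\<exists>E L b. E face_of ref_cell M \<and> linear L \<and>
           (let \<tau> = (\<lambda>x. b + L x) in
              \<tau> ` E face_of ref_cell M \<and>
              K \<inter> K' = geo M K ` E \<and> (\<forall>x\<in>E. geo M K x = geo M K' (\<tau> x)))))"

text \<open>In what follows a facet of the mesh is given by a cell \<^term>\<open>K\<close> and a facet \<^term>\<open>F\<close> of
  the reference cell.\<close>

definition facet :: "('d::finite, 'f::finite) mesh \<Rightarrow> (real^'d) set \<Rightarrow> (real^'d) set \<Rightarrow> (real^'d) set" where
  "facet M K F = geo M K ` F"

definition ref_normal :: "('d::finite, 'f::finite) mesh \<Rightarrow> (real^'d) set \<Rightarrow> real^'d" where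
  "ref_normal M F = (THE n. norm n = 1 \<and>
     (\<exists>c. ref_cell M \<subseteq> {x. n \<bullet> x \<le> c} \<and> F \<subseteq> {x. n \<bullet> x = c}))"

text \<open>The outward unit normal to \<^term>\<open>K\<close> at a point \<^term>\<open>x\<close> of a facet: orthogonal to the
  tangent directions of the facet, and forming obtuse angles with the directions entering
  \<^term>\<open>K\<close>.\<close>

definition normal ::
  "('d::finite, 'f::finite) mesh \<Rightarrow> (real^'d) set \<Rightarrow> (real^'d) set \<Rightarrow> real^'d \<Rightarrow> real^'d" where
  "normal M K F x =
     (let y = inv_into F (geo M K) x; J = jacobian (geo M K) (at y) in
      THE n. norm n = 1 \<and>
        (\<forall>z\<in>F. n \<bullet> (J *v (z - y)) = 0) \<and> (\<forall>z\<in>ref_cell M. n \<bullet> (J *v (z - y)) \<le> 0))"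

text \<open>Surface measure on \<open>\<gamma> ` S\<close> for a parametrization \<open>\<gamma>\<close>, with the Gram determinant of
  the derivative as density.\<close>

definition surface_measure ::
  "(real^'f \<Rightarrow> real^'d) \<Rightarrow> (real^'f) set \<Rightarrow> (real^'d) measure" where
  "surface_measure \<gamma> S =
     distr
       (density (restrict_space lborel S)
          (\<lambda>s. ennreal (sqrt (det (transpose (jacobian \<gamma> (at s)) ** jacobian \<gamma> (at s))))))
       (restrict_space borel (\<gamma> ` S)) \<gamma>"

definition facet_measure ::
  "('d::finite, 'f::finite) mesh \<Rightarrow> (real^'d) set \<Rightarrow> (real^'d) set \<Rightarrow> (real^'d) measure" where
  "facet_measure M K F = surface_measure (geo M K \<circ> chart M F) (chart M F -` F)"

text \<open>Elements of the global spaces are functions considered up to equality almost everywhere: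
  in particular functions in \<open>Qbar_glob\<close> may jump where facets meet.
  Functions in the local spaces are extended by zero.\<close>

definition piola :: "(real^'d \<Rightarrow> real^'d) \<Rightarrow> (real^'d \<Rightarrow> real^'d) \<Rightarrow> real^'d \<Rightarrow> real^'d" where
  "piola T v y = det (jacobian T (at y)) *\<^sub>R (matrix_inv (jacobian T (at y)) *v v (T y))"

definition V_loc ::
  "('d::finite, 'f::finite) mesh \<Rightarrow> (real^'d \<Rightarrow> real^'d) set \<Rightarrow> (real^'d) set \<Rightarrow> (real^'d \<Rightarrow> real^'d) set" where
  "V_loc M Vhat K =
     {v. (\<forall>x. x \<notin> K \<longrightarrow> v x = 0) \<and>
         (\<exists>vhat\<in>Vhat. \<forall>y\<in>ref_cell M. piola (geo M K) v y = vhat y)}"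

definition Qbar_loc ::
  "('d::finite, 'f::finite) mesh \<Rightarrow> ((real^'d) set \<Rightarrow> (real^'d \<Rightarrow> real) set) \<Rightarrow>
   (real^'d) set \<Rightarrow> (real^'d) set \<Rightarrow> (real^'d \<Rightarrow> real) set" where
  "Qbar_loc M Qbhat K F =
     {q. (\<forall>x. x \<notin> facet M K F \<longrightarrow> q x = 0) \<and>
         (\<exists>qhat\<in>Qbhat F. \<forall>y\<in>F. q (geo M K y) = qhat y)}"

definition V_glob ::
  "('d::finite, 'f::finite) mesh \<Rightarrow> (real^'d \<Rightarrow> real^'d) set \<Rightarrow> (real^'d \<Rightarrow> real^'d) set" where
  "V_glob M Vhat =
     {v. square_integrable (lebesgue_on (domain M)) v \<and>
         (\<forall>K\<in>cells M. \<exists>w\<in>V_loc M Vhat K. AE x in lebesgue_on K. v x = w x)}"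

definition Q_glob ::
  "('d::finite, 'f::finite) mesh \<Rightarrow> ((real^'d) set \<Rightarrow> (real^'d \<Rightarrow> real) set) \<Rightarrow> (real^'d \<Rightarrow> real) set" where
  "Q_glob M Qloc =
     {q. square_integrable (lebesgue_on (domain M)) q \<and>
         (\<forall>K\<in>cells M. \<exists>w\<in>Qloc K. AE x in lebesgue_on K. q x = w x)}"

definition Qbar_glob ::
  "('d::finite, 'f::finite) mesh \<Rightarrow> ((real^'d) set \<Rightarrow> (real^'d \<Rightarrow> real) set) \<Rightarrow> (real^'d \<Rightarrow> real) set" where
  "Qbar_glob M Qbhat =
     {q. \<forall>K\<in>cells M. \<forall>F. F facet_of ref_cell M \<longrightarrow>
           square_integrable (facet_measure M K F) q \<and>
           (\<exists>p\<in>Qbar_loc M Qbhat K F. AE x in facet_measure M K F. q x = p x)}"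

text \<open>The continuous representative of \<open>v\<close> on the closed cell \<^term>\<open>K\<close>, unique on \<^term>\<open>K\<close>;
  its values on the boundary are the traces from \<^term>\<open>K\<close>.\<close>

definition cell_rep :: "(real^'d) set \<Rightarrow> (real^'d \<Rightarrow> real^'d) \<Rightarrow> real^'d \<Rightarrow> real^'d" where
  "cell_rep K v = (SOME w. continuous_on K w \<and> (AE x in lebesgue_on K. v x = w x))"

definition b_form ::
  "('d::finite, 'f::finite) mesh \<Rightarrow> (real^'d \<Rightarrow> real^'d) \<Rightarrow> (real^'d \<Rightarrow> real) \<times> (real^'d \<Rightarrow> real) \<Rightarrow> real" where
  "b_form M v = (\<lambda>(q, qbar).
     - (\<Sum>K\<in>cells M. LINT x|lebesgue_on K. q x * divergence (cell_rep K v) x)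
     + (\<Sum>K\<in>cells M. \<Sum>F | F facet_of ref_cell M.
          LINT x|facet_measure M K F. (cell_rep K v x \<bullet> normal M K F x) * qbar x))"

definition X_glob ::
  "('d::finite, 'f::finite) mesh \<Rightarrow> (real^'d \<Rightarrow> real^'d) set \<Rightarrow>
   ((real^'d) set \<Rightarrow> (real^'d \<Rightarrow> real) set) \<Rightarrow> ((real^'d) set \<Rightarrow> (real^'d \<Rightarrow> real) set) \<Rightarrow>
   (real^'d \<Rightarrow> real^'d) set" where
  "X_glob M Vhat Qloc Qbhat =
     {v \<in> V_glob M Vhat. \<forall>q \<in> Q_glob M Qloc \<times> Qbar_glob M Qbhat. b_form M v q = 0}"

definition normal_continuous ::
  "('d::finite, 'f::finite) mesh \<Rightarrow> (real^'d \<Rightarrow> real^'d) \<Rightarrow> bool" where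
  "normal_continuous M v \<longleftrightarrow>
     (\<forall>K\<in>cells M. \<forall>K'\<in>cells M. \<forall>F F'.
        K \<noteq> K' \<longrightarrow> F facet_of ref_cell M \<longrightarrow> F' facet_of ref_cell M \<longrightarrow> facet M K F = facet M K' F' \<longrightarrow>
        (\<forall>x\<in>facet M K F. cell_rep K v x \<bullet> normal M K F x = cell_rep K' v x \<bullet> normal M K F x))"

end

theory Submission
  imports Defs
begin

text \<open>
  The normal trace of the Piola transform of \<open>u\<close> times the surface element of a curved facet is, up
  to the sign of the Jacobian determinant, the normal trace of \<open>u\<close> on the flat reference facet.
  Hence \<open>b_form v (0, q)\<close> is a sum of integrals over flat facets, weighted by functions that are
  themselves admissible for the facet space.  Pulling the contributions of all cells sharing a facet
  back to one reference facet, the total weight (the jump) is admissible too; testing with the jump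
  on that facet and with zero on the others shows that the jump vanishes.

  At a point in the relative interior of a facet at most two cells meet, with opposite normals, so
  the vanishing jump is continuity of the normal component, first there and then on the closed
  facet.  For \<open>H(div)\<close>, integration by parts on the reference cell reduces the distributional
  divergence to the cellwise one plus the sum of the jumps tested with \<open>\<phi>\<close>, which is zero.

  The divergence theorem on the reference polytope follows from writing its indicator function, up
  to a null set, as a signed sum of the indicators of the half-infinite cylinders over its facets in
  a fixed direction, and the fundamental theorem of calculus on each cylinder.
\<close>

section \<open>Continuously differentiable functions\<close>

text \<open>The obstacle is the curvature of the cells: surface element and unit normal vary along a
  facet and in general belong to no polynomial space. By Nanson's formula these variable factors
  cancel against the factor 1/det J of the Piola transform. What remains is the sign of det J,
  constant because the reference cell is connected, and the Gram factor of a flat facet.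
  Neighbouring cells parametrise a common facet up to an affine map, whose determinant is constant
  as well. So the jump is a combination, with constant coefficients, of normal traces of reference
  fields. The inclusion of the normal traces puts each of them into the facet space of its own cell,
  and since that space does not depend on the generating cell, all of them can be added up in one
  space. The extension of the jump by zero is legitimate because facet functions may jump where
  facets meet. Outward normals have opposite signs on the two sides, so the jump appears as a sum of
  fluxes.\<close>

definition C1_fun :: "('a::euclidean_space \<Rightarrow> 'b::euclidean_space) \<Rightarrow> bool" where
  "C1_fun f \<longleftrightarrow> (\<exists>f'. (\<forall>x. (f has_derivative f' x) (at x)) \<and> (\<forall>h. continuous_on UNIV (\<lambda>x. f' x h)))"

lemma C1_funI:
  assumes "\<And>x. (f has_derivative f' x) (at x)" "\<And>h. continuous_on UNIV (\<lambda>x. f' x h)"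
  shows "C1_fun f"
  using assms unfolding C1_fun_def by blast

lemma C1_fun_derivative:
  assumes "C1_fun f"
  shows "(f has_derivative frechet_derivative f (at x)) (at x)"
    and "continuous_on S (\<lambda>x. frechet_derivative f (at x) h)"
proof -
  obtain f' where f': "\<And>x. (f has_derivative f' x) (at x)" "\<And>h. continuous_on UNIV (\<lambda>x. f' x h)"
    using assms unfolding C1_fun_def by blast
  have eq: "frechet_derivative f (at x) = f' x" for x
    using f'(1) frechet_derivative_at by metis
  show "(f has_derivative frechet_derivative f (at x)) (at x)"
    using f'(1) by (simp add: eq)
  show "continuous_on S (\<lambda>x. frechet_derivative f (at x) h)"
    using continuous_on_subset[OF f'(2)] by (simp add: eq)
qed

lemma C1_fun_differentiable: "C1_fun f \<Longrightarrow> f differentiable (at x)"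
  using C1_fun_derivative(1) differentiable_def by blast

lemma C1_fun_continuous: "C1_fun f \<Longrightarrow> continuous_on S f"
  by (meson C1_fun_differentiable continuous_at_imp_continuous_on differentiable_imp_continuous_within)

lemma C1_fun_jacobian:
  fixes f :: "real^'m \<Rightarrow> real^'n"
  assumes "C1_fun f"
  shows "(f has_derivative (\<lambda>h. jacobian f (at x) *v h)) (at x)"
    and "frechet_derivative f (at x) h = jacobian f (at x) *v h"
    and "continuous_on S (\<lambda>x. jacobian f (at x))"
proof -
  show "(f has_derivative (\<lambda>h. jacobian f (at x) *v h)) (at x)"
    using C1_fun_differentiable[OF assms] jacobian_works by blast
  then show "frechet_derivative f (at x) h = jacobian f (at x) *v h"
    by (metis frechet_derivative_at)
  show "continuous_on S (\<lambda>x. jacobian f (at x))"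
    unfolding continuous_on_componentwise[where f="\<lambda>x. jacobian f (at x)"] jacobian_def matrix_def
    using C1_fun_derivative(2)[OF assms]
    by (auto simp: Basis_vec_def inner_axis intro!: continuous_intros)
qed

lemma C1_fun_bounded_linear: "bounded_linear f \<Longrightarrow> C1_fun f"
  by (rule C1_funI[where f'="\<lambda>x. f"]) (auto intro: bounded_linear_imp_has_derivative)

lemma C1_fun_const [simp]: "C1_fun (\<lambda>x. c)"
  by (rule C1_funI[where f'="\<lambda>x h. 0"]) auto

lemma C1_fun_add: 
  assumes "C1_fun f" "C1_fun g" shows "C1_fun (\<lambda>x. f x + g x)"
  by (rule C1_funI[where f'="\<lambda>x h. frechet_derivative f (at x) h + frechet_derivative g (at x) h"])
    (auto intro!: derivative_intros continuous_intros C1_fun_derivative assms)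

lemma C1_fun_scaleR: 
  assumes "C1_fun f" "C1_fun g" shows "C1_fun (\<lambda>x. f x *\<^sub>R g x)"
  by (rule C1_funI[where f'="\<lambda>x h. f x *\<^sub>R frechet_derivative g (at x) h + frechet_derivative f (at x) h *\<^sub>R g x"])
    (intro derivative_intros continuous_intros C1_fun_derivative C1_fun_continuous[of f]
      C1_fun_continuous[of g] assms)+

lemma C1_fun_mult: 
  fixes f g :: "'a::euclidean_space \<Rightarrow> real"
  assumes "C1_fun f" "C1_fun g" shows "C1_fun (\<lambda>x. f x * g x)"
  using C1_fun_scaleR[OF assms] by simp

lemma C1_fun_sum: "(\<And>i. i \<in> I \<Longrightarrow> C1_fun (f i)) \<Longrightarrow> C1_fun (\<lambda>x. \<Sum>i\<in>I. f i x)"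
  by (induction I rule: infinite_finite_induct) (auto intro: C1_fun_add)

lemma linear_sum_Basis:
  fixes g :: "'a::euclidean_space \<Rightarrow> 'b::real_vector"
  assumes "linear g" shows "g h = (\<Sum>b\<in>Basis. (h \<bullet> b) *\<^sub>R g b)"
  by (metis (no_types, lifting) assms euclidean_representation linear_scale linear_sum sum.cong)

lemma C1_fun_compose:
  assumes f: "C1_fun f" and g: "C1_fun g" shows "C1_fun (\<lambda>x. g (f x))"
proof (rule C1_funI)
  show "((\<lambda>x. g (f x)) has_derivative (\<lambda>h. frechet_derivative g (at (f x)) (frechet_derivative f (at x) h))) (at x)" for x
    using diff_chain_at[OF C1_fun_derivative(1)[OF f] C1_fun_derivative(1)[OF g]] by (simp add: o_def)
  fix h
  \<comment> \<open>Continuity of the derivative of \<open>g\<close> is known for a fixed direction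
    only, whereas here the direction moves with the point; expanding it in the basis leaves fixed
    directions.\<close>
  have eq: "frechet_derivative g (at (f x)) (frechet_derivative f (at x) h)
      = (\<Sum>b\<in>Basis. (frechet_derivative f (at x) h \<bullet> b) *\<^sub>R frechet_derivative g (at (f x)) b)" for x
    by (rule linear_sum_Basis)
      (meson C1_fun_derivative(1) g has_derivative_bounded_linear bounded_linear.linear)
  have "continuous_on UNIV (\<lambda>x. frechet_derivative g (at (f x)) b)" for b
    using continuous_on_compose2[OF C1_fun_derivative(2)[OF g, of UNIV b] C1_fun_continuous[OF f, of UNIV]] by simp
  then show "continuous_on UNIV (\<lambda>x. frechet_derivative g (at (f x)) (frechet_derivative f (at x) h))"
    unfolding eq by (intro continuous_intros C1_fun_derivative(2) f)
qed

text \<open>Geometric maps and reference fields are polynomials, hence C1 on the whole space.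
  Boundary points of the reference cell therefore need no one-sided derivatives.\<close>

lemma C1_fun_polynomial:
  assumes "polynomial_function f" shows "C1_fun f"
proof -
  have real: "C1_fun p" if "real_polynomial_function p" for p :: "'a::euclidean_space \<Rightarrow> real"
    using that
    by induction (auto intro: C1_fun_bounded_linear C1_fun_add C1_fun_mult)
  have "C1_fun (\<lambda>x. f x \<bullet> b)" for b
    using assms by (intro real) (simp add: real_polynomial_function_eq polynomial_function_inner)
  then have "C1_fun (\<lambda>x. \<Sum>b\<in>Basis. (f x \<bullet> b) *\<^sub>R b)"
    by (intro C1_fun_sum C1_fun_scaleR) auto
  then show ?thesis by (simp add: euclidean_representation)
qed

text \<open>The first partial derivatives are continuous because they are differentiable in
  turn.\<close>

lemma smooth_C1_fun:
  fixes \<phi> :: "real^'d \<Rightarrow> real"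
  assumes "smooth \<phi>" shows "C1_fun \<phi>"
proof -
  obtain D where D: "D [] = \<phi>"
    "\<And>is x. (D is has_derivative (\<lambda>h. \<Sum>i\<in>UNIV. h $ i * D (i # is) x)) (at x)"
    using assms unfolding smooth_def by blast
  have "continuous_on UNIV (D is)" for "is"
    using D(2) by (meson continuous_at_imp_continuous_on has_derivative_continuous)
  then show ?thesis
    using D(2)[of "[]"] by (intro C1_funI[where f'="\<lambda>x h. \<Sum>i\<in>UNIV. h $ i * D [i] x"])
      (auto simp: D(1) intro!: continuous_intros)
qed

lemma frechet_derivative_grad:
  fixes \<phi> :: "real^'d \<Rightarrow> real"
  assumes "C1_fun \<phi>"
  shows "frechet_derivative \<phi> (at x) h = grad \<phi> x \<bullet> h"
    and "continuous_on S (grad \<phi>)"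
proof -
  have "linear (frechet_derivative \<phi> (at x))"
    using C1_fun_derivative(1)[OF assms] has_derivative_linear by blast
  then have "frechet_derivative \<phi> (at x) h = (\<Sum>b\<in>Basis. (h \<bullet> b) *\<^sub>R frechet_derivative \<phi> (at x) b)"
    by (rule linear_sum_Basis)
  also have "\<dots> = (\<Sum>i\<in>UNIV. h $ i * frechet_derivative \<phi> (at x) (axis i 1))"
    by (subst sum.reindex_bij_betw[symmetric, where h="\<lambda>i. axis i 1" and S=UNIV])
       (auto simp: inner_axis bij_betw_def inj_on_def axis_eq_axis Basis_vec_def)
  also have "\<dots> = grad \<phi> x \<bullet> h"
    by (simp add: grad_def inner_vec_def mult.commute)
  finally show "frechet_derivative \<phi> (at x) h = grad \<phi> x \<bullet> h" .
  show "continuous_on S (grad \<phi>)"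
    unfolding grad_def using C1_fun_derivative(2)[OF assms] by (intro continuous_intros)
qed

lemma poly_maps_polynomial_function:
  fixes f :: "real^'d \<Rightarrow> real^'d"
  assumes "f \<in> poly_maps I" shows "polynomial_function f"
proof -
  obtain c where f: "f = (\<lambda>x. \<Sum>\<alpha>\<in>I. (\<Prod>i\<in>UNIV. (x $ i) ^ \<alpha> i) *\<^sub>R c \<alpha>)"
    using assms unfolding poly_maps_def by blast
  have "polynomial_function (\<lambda>x::real^'d. (\<Prod>i\<in>UNIV. (x $ i) ^ \<alpha> i) *\<^sub>R c \<alpha>)" for \<alpha>
  proof -
    have "real_polynomial_function (\<lambda>x::real^'d. \<Prod>i\<in>UNIV. (x $ i) ^ \<alpha> i)"
      by (intro real_polynomial_function_prod real_polynomial_function_power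
        real_polynomial_function.intros(1) bounded_linear_vec_nth) auto
    then show ?thesis
      by (intro polynomial_function_mult polynomial_function_const) (simp add: real_polynomial_function_eq)
  qed
  \<comment> \<open>A sum over an infinite index set is zero by convention, which is a polynomial
    too.\<close>
  then show ?thesis unfolding f
    by (cases "finite I") (auto intro: polynomial_function_sum)
qed

section \<open>Measures\<close>

text \<open>Bridge between two integrals: surface measures and Fubini use \<open>lborel\<close>,
  change of variables and the fundamental theorem use the gauge integral.\<close>

lemma integral_compact_lborel:
  fixes f :: "'a::euclidean_space \<Rightarrow> real"
  assumes "compact S" "continuous_on S f"
  shows "set_integrable lborel S f" "integral S f = (LINT x:S|lborel. f x)" "f absolutely_integrable_on S"
    "f integrable_on S"
proof -
  show 1: "set_integrable lborel S f"
    unfolding set_integrable_def real_scaleR_def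
    using borel_integrable_compact[OF assms] by (simp add: mult.commute)
  show "integral S f = (LINT x:S|lborel. f x)"
    using set_borel_integral_eq_integral(2)[OF 1] by simp
  show "f integrable_on S" by (rule set_borel_integral_eq_integral(1)[OF 1])
  show "f absolutely_integrable_on S"
    using 1 unfolding set_integrable_def by (rule integrable_completion[THEN iffD2, rotated]) 
     (use 1 in \<open>auto simp: set_integrable_def\<close>)
qed

lemma emeasure_lborel_box_cart:
  fixes l u :: "real^'n"
  assumes "\<And>i. l $ i \<le> u $ i"
  shows "emeasure lborel (box l u) = (\<Prod>i\<in>UNIV. ennreal (u $ i - l $ i))"
    and "(\<Prod>i\<in>UNIV. ennreal (u $ i - l $ i)) = (\<Prod>b\<in>Basis. (u - l) \<bullet> b)"
proof -
  have "(\<Prod>b\<in>Basis. (u - l) \<bullet> b) = (\<Prod>i\<in>UNIV. u $ i - l $ i)"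
    by (subst prod.reindex_bij_betw[symmetric, where h="\<lambda>i. axis i 1" and S=UNIV])
      (auto simp: inner_axis bij_betw_def inj_on_def axis_eq_axis Basis_vec_def)
  then show eq: "(\<Prod>i\<in>UNIV. ennreal (u $ i - l $ i)) = (\<Prod>b\<in>Basis. (u - l) \<bullet> b)"
    by (simp add: prod_ennreal assms)
  have "emeasure lborel (box l u) = (\<Prod>b\<in>Basis. (u - l) \<bullet> b)"
    by (rule emeasure_lborel_box) (auto simp: inner_axis Basis_vec_def assms)
  then show "emeasure lborel (box l u) = (\<Prod>i\<in>UNIV. ennreal (u $ i - l $ i))"
    by (simp only: eq)
qed

text \<open>Lebesgue measure is determined by its values on boxes, and renaming the coordinates only
  permutes the sides of a box.\<close>

lemma distr_lborel_coords:
  fixes p :: "'n::finite \<Rightarrow> 'm::finite"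
  assumes "bij p"
  shows "distr lborel borel (\<lambda>x::real^'m. \<chi> i. x $ p i) = (lborel :: (real^'n) measure)"
proof (rule lborel_eqI[symmetric])
  have meas: "(\<lambda>x::real^'m. \<chi> i. x $ p i) \<in> borel_measurable borel"
    by (intro borel_measurable_continuous_onI continuous_intros)
  fix l u :: "real^'n"
  assume le: "\<And>b. b \<in> Basis \<Longrightarrow> l \<bullet> b \<le> u \<bullet> b"
  let ?l = "\<chi> j. l $ inv p j" and ?u = "\<chi> j. u $ inv p j"
  have ip: "inv p (p i) = i" "p (inv p j) = j" for i j
    using assms by (auto simp: bij_is_inj bij_is_surj surj_f_inv_f)
  have pre: "(\<lambda>x::real^'m. \<chi> i. x $ p i) -` box l u = box ?l ?u"
  proof -
    have all: "(\<forall>j. P j) \<longleftrightarrow> (\<forall>i. P (p i))" for P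
      using ip(2) by metis
    show ?thesis by (auto simp: mem_box_cart all ip)
  qed
  have le': "l $ i \<le> u $ i" for i
    using le[of "axis i 1"] by (auto simp: inner_axis Basis_vec_def)
  have "emeasure (distr lborel borel (\<lambda>x::real^'m. \<chi> i. x $ p i)) (box l u) = emeasure lborel (box ?l ?u)"
    using meas by (subst emeasure_distr) (auto simp: pre)
  also have "\<dots> = (\<Prod>j\<in>UNIV. ennreal (u $ inv p j - l $ inv p j))"
    by (subst emeasure_lborel_box_cart) (auto simp: le')
  also have "\<dots> = (\<Prod>i\<in>UNIV. ennreal (u $ i - l $ i))"
    by (rule prod.reindex_bij_betw[where g="\<lambda>i. ennreal (u $ i - l $ i)"]) (simp add: assms bij_imp_bij_inv)
  also have "\<dots> = (\<Prod>b\<in>Basis. (u - l) \<bullet> b)"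
    by (rule emeasure_lborel_box_cart(2)[OF le'])
  finally show "emeasure (distr lborel borel (\<lambda>x::real^'m. \<chi> i. x $ p i)) (box l u) = (\<Prod>b\<in>Basis. (u - l) \<bullet> b)" .
qed auto

text \<open>Identifies R^(d-1) x R with R^d. The element \<open>None\<close> marks the extra
  coordinate, which later runs along a direction transversal to a facet.\<close>

definition join_coords :: "('f::finite option \<Rightarrow> 'd::finite) \<Rightarrow> (real^'f) \<times> real \<Rightarrow> real^'d" where
  "join_coords p = (\<lambda>(s,t). \<chi> i. case inv p i of None \<Rightarrow> t | Some k \<Rightarrow> s $ k)"

lemma join_coords_linear: "linear (join_coords p)"
  by (rule linearI) (auto simp: join_coords_def vec_eq_iff split: option.splits)

text \<open>Makes Fubini available in R^d: in joined coordinates Lebesgue measure is the product of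
  the Lebesgue measures in \<open>s\<close> and \<open>t\<close>.\<close>

lemma distr_lborel_join_coords:
  fixes p :: "'f::finite option \<Rightarrow> 'd::finite"
  assumes "bij p"
  shows "distr lborel borel (join_coords p) = lborel"
proof (rule lborel_eqI[symmetric])
  have meas: "join_coords p \<in> borel_measurable borel"
    by (intro borel_measurable_continuous_onI linear_continuous_on linear_conv_bounded_linear[THEN iffD1] join_coords_linear)
  fix l u :: "real^'d"
  assume le: "\<And>b. b \<in> Basis \<Longrightarrow> l \<bullet> b \<le> u \<bullet> b"
  let ?l = "\<chi> k. l $ p (Some k)" and ?u = "\<chi> k. u $ p (Some k)"
  have ip: "inv p (p i) = i" "p (inv p j) = j" for i j
    using assms by (auto simp: bij_is_inj bij_is_surj surj_f_inv_f)
  have le': "l $ i \<le> u $ i" for i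
    using le[of "axis i 1"] by (auto simp: inner_axis Basis_vec_def)
  have pre: "join_coords p -` box l u = box ?l ?u \<times> box (l $ p None) (u $ p None)"
  proof -
    have "(\<forall>i. P i) \<longleftrightarrow> (\<forall>k. P (p k))" for P
      using ip(2) by metis
    then have all: "(\<forall>i. P i) \<longleftrightarrow> P (p None) \<and> (\<forall>k. P (p (Some k)))" for P
      using option.exhaust_sel by metis
    show ?thesis
    proof (intro set_eqI, clarify)
      fix s :: "real^'f" and t :: real
      show "(s, t) \<in> join_coords p -` box l u \<longleftrightarrow> (s, t) \<in> box ?l ?u \<times> box (l $ p None) (u $ p None)"
        unfolding vimage_eq mem_box_cart
        by (subst all) (auto simp: mem_box_cart box_real join_coords_def ip)
    qed
  qed
  have "emeasure (distr lborel borel (join_coords p)) (box l u) 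
      = emeasure (lborel \<Otimes>\<^sub>M lborel) (box ?l ?u \<times> box (l $ p None) (u $ p None))"
    using meas by (subst emeasure_distr) (auto simp: pre lborel_prod)
  also have "\<dots> = emeasure lborel (box ?l ?u) * emeasure lborel (box (l $ p None) (u $ p None))"
    by (rule lborel.emeasure_pair_measure_Times) auto
  also have "\<dots> = (\<Prod>k\<in>UNIV. ennreal (u $ p (Some k) - l $ p (Some k))) * ennreal (u $ p None - l $ p None)"
    by (subst emeasure_lborel_box_cart) (auto simp: le' box_real)
  also have "\<dots> = (\<Prod>k\<in>UNIV. ennreal (u $ p k - l $ p k))"
    by (simp add: UNIV_option_conv prod.reindex mult.commute)
  also have "\<dots> = (\<Prod>i\<in>UNIV. ennreal (u $ i - l $ i))"
    by (rule prod.reindex_bij_betw[where g="\<lambda>i. ennreal (u $ i - l $ i)"]) (simp add: assms)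
  also have "\<dots> = (\<Prod>b\<in>Basis. (u - l) \<bullet> b)"
    by (rule emeasure_lborel_box_cart(2)[OF le'])
  finally show "emeasure (distr lborel borel (join_coords p)) (box l u) = (\<Prod>b\<in>Basis. (u - l) \<bullet> b)" .
qed auto

text \<open>A permutation that moves an index outside the range of \<open>f\<close> picks an
  off-diagonal zero of a unit row, so only permutations of the range contribute. For bijective
  \<open>f\<close> this is invariance under relabelling; otherwise it expands the determinant along
  the unit rows.\<close>

lemma det_restrict:
  fixes f :: "'f::finite \<Rightarrow> 'd::finite" and A :: "'a::comm_ring_1^'d^'d"
  assumes f: "inj f" and A: "\<And>i j. i \<notin> range f \<Longrightarrow> A $ i $ j = (if i = j then 1 else 0)"
  shows "det A = det (\<chi> k l. A $ f k $ f l)"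
proof -
  let ?t = "\<lambda>\<pi>. of_int (sign \<pi>) * (\<Prod>i\<in>UNIV. A $ i $ \<pi> i)"
  let ?m = "map_permutation UNIV f"
  have bij: "bij_betw ?m {\<rho>. \<rho> permutes (UNIV :: 'f set)} {\<pi>. \<pi> permutes range f}"
  proof -
    have "(\<lambda>\<pi> x. if x \<in> range f then f (\<pi> (inv_into UNIV f x)) else x) = ?m"
      by (auto simp: map_permutation_def restrict_id_def fun_eq_iff)
    then show ?thesis
      using bij_betw_permutations[of f UNIV "range f"] f by (simp add: bij_betw_def)
  qed
  have "det A = (\<Sum>\<pi> | \<pi> permutes range f. ?t \<pi>)"
    unfolding det_def
  proof (rule sum.mono_neutral_right)
    show "{\<pi>. \<pi> permutes range f} \<subseteq> {\<pi>. \<pi> permutes (UNIV::'d set)}"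
      using permutes_subset by blast
    show "\<forall>\<pi>\<in>{\<pi>. \<pi> permutes UNIV} - {\<pi>. \<pi> permutes range f}. ?t \<pi> = 0"
    proof
      fix \<pi> :: "'d \<Rightarrow> 'd" assume \<pi>: "\<pi> \<in> {\<pi>. \<pi> permutes UNIV} - {\<pi>. \<pi> permutes range f}"
      then obtain i where "i \<notin> range f" "\<pi> i \<noteq> i"
        using permutes_superset[of \<pi> UNIV "range f"] by blast
      then have "A $ i $ \<pi> i = 0" using A by auto
      then have "(\<Prod>i\<in>UNIV. A $ i $ \<pi> i) = 0"
        by (intro prod_zero) auto
      then show "?t \<pi> = 0" by simp
    qed
  qed (simp add: finite_permutations)
  also have "\<dots> = (\<Sum>\<rho> | \<rho> permutes UNIV. ?t (?m \<rho>))"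
    using sum.reindex_bij_betw[OF bij, of ?t] by simp
  also have "\<dots> = (\<Sum>\<rho> | \<rho> permutes UNIV. of_int (sign \<rho>) * (\<Prod>k\<in>UNIV. A $ f k $ f (\<rho> k)))"
  proof (rule sum.cong[OF refl])
    fix \<rho> :: "'f \<Rightarrow> 'f" assume "\<rho> \<in> {\<rho>. \<rho> permutes UNIV}"
    then have \<rho>: "\<rho> permutes UNIV" by simp
    have out: "?m \<rho> i = i" if "i \<notin> range f" for i
      using that by (simp add: map_permutation_def restrict_id_def)
    have "(\<Prod>i\<in>UNIV. A $ i $ (?m \<rho>) i) = (\<Prod>i\<in>range f. A $ i $ (?m \<rho>) i)"
      by (rule prod.mono_neutral_right) (auto simp: out A)
    also have "\<dots> = (\<Prod>k\<in>UNIV. A $ f k $ f (\<rho> k))"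
      using f by (simp add: prod.reindex map_permutation_apply)
    finally show "?t (?m \<rho>) = of_int (sign \<rho>) * (\<Prod>k\<in>UNIV. A $ f k $ f (\<rho> k))"
      using sign_map_permutation[OF f \<rho>] by simp
  qed
  also have "\<dots> = det (\<chi> k l. A $ f k $ f l)"
    by (simp add: det_def)
  finally show ?thesis .
qed

lemma sum_UNIV_option: "(\<Sum>q\<in>UNIV. g q) = g None + (\<Sum>k\<in>UNIV. g (Some (k::'f::finite)))"
  by (simp add: UNIV_option_conv sum.reindex)

section \<open>Gram determinants\<close>

text \<open>\<open>B\<close> with one more column \<open>e\<close>, placed at the index
  \<open>p None\<close>. Up to sign its determinant is the volume spanned by the columns of
  \<open>B\<close> and \<open>e\<close>.\<close>

definition bordered :: "('f::finite option \<Rightarrow> 'd::finite) \<Rightarrow> real^'f^'d \<Rightarrow> real^'d \<Rightarrow> real^'d^'d" where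
  "bordered p B e = (\<chi> i j. case inv p j of None \<Rightarrow> e $ i | Some k \<Rightarrow> B $ i $ k)"

lemma bordered_join_coords:
  assumes "bij p"
  shows "bordered p B e *v join_coords p (s, t) = B *v s + t *\<^sub>R e"
proof -
  have "(\<Sum>j\<in>UNIV. bordered p B e $ i $ j * join_coords p (s, t) $ j)
      = (\<Sum>k\<in>UNIV. B $ i $ k * s $ k) + t * e $ i" for i
    by (subst sum.reindex_bij_betw[OF assms, symmetric])
      (simp add: sum_UNIV_option bordered_def join_coords_def assms bij_is_inj inv_f_f)
  then show ?thesis
    by (simp add: vec_eq_iff matrix_vector_mult_def)
qed

text \<open>The unit vector \<open>m\<close> is orthogonal to the columns of \<open>B\<close>, so
  the Gram matrix splits into that of \<open>B\<close> and a diagonal entry 1.\<close>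

lemma det_transpose_bordered:
  fixes B :: "real^'f^'d" and m :: "real^'d"
  assumes p: "bij p" and m: "transpose B *v m = 0" "norm m = 1"
  shows "det (transpose (bordered p B m) ** bordered p B m) = det (transpose B ** B)"
proof -
  let ?G = "transpose (bordered p B m) ** bordered p B m"
  have ip: "inv p (p i) = i" for i
    using p by (simp add: bij_is_inj)
  have mm: "(\<Sum>i\<in>UNIV. m $ i * m $ i) = 1"
    using m(2) by (simp add: norm_eq_1 inner_vec_def)
  have Bm: "(\<Sum>i\<in>UNIV. B $ i $ k * m $ i) = 0" "(\<Sum>i\<in>UNIV. m $ i * B $ i $ k) = 0" for k
    using m(1) by (auto simp: vec_eq_iff matrix_vector_mult_def transpose_def mult.commute)
  have inj: "inj (\<lambda>k. p (Some k))"
    using p by (auto simp: inj_def bij_def)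
  have "det ?G = det (\<chi> k l. ?G $ p (Some k) $ p (Some l))"
  proof (rule det_restrict[OF inj])
    fix i j assume "i \<notin> range (\<lambda>k. p (Some k))"
    then have i: "i = p None"
      using surjD[OF bij_is_surj[OF p], of i] by (metis not_Some_eq rangeI)
    obtain q where j: "j = p q" using surjD[OF bij_is_surj[OF p]] by blast
    have "(i = j) = (q = None)" using i j bij_is_inj[OF p] by (auto dest: injD)
    then show "?G $ i $ j = (if i = j then 1 else 0)"
      unfolding i j by (cases q) (auto simp: matrix_matrix_mult_def transpose_def bordered_def ip mm Bm)
  qed
  also have "(\<chi> k l. ?G $ p (Some k) $ p (Some l)) = transpose B ** B"
    by (simp add: vec_eq_iff matrix_matrix_mult_def transpose_def bordered_def ip)
  finally show ?thesis .
qed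

text \<open>Volume is base times height, here with height one.\<close>

lemma abs_det_bordered_unit:
  fixes B :: "real^'f^'d" and m :: "real^'d"
  assumes p: "bij p" and m: "transpose B *v m = 0" "norm m = 1"
  shows "\<bar>det (bordered p B m)\<bar> = sqrt (det (transpose B ** B))"
  using det_transpose_bordered[OF assms] by (metis det_mul det_transpose power2_eq_square real_sqrt_abs)

text \<open>A column operation: \<open>B *v s\<close> is a combination of the other columns and does
  not change the determinant.\<close>

lemma det_bordered_add:
  fixes B :: "real^'f^'d"
  assumes p: "bij p" 
  shows "det (bordered p B (B *v s + r *\<^sub>R m)) = r * det (bordered p B m)"
proof -
  have ip: "inv p (p i) = i" for i
    using p by (simp add: bij_is_inj)
  \<comment> \<open>The identity except for the column at \<open>p None\<close>, which holds
    \<open>s\<close> and \<open>r\<close>; multiplication by it from the right performs the column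
    operation.\<close>
  let ?E = "bordered p (\<chi> i k. if i = p (Some k) then 1 else 0) (join_coords p (s, r))"
  have out: "j = p None" if "j \<notin> range (\<lambda>k. p (Some k))" for j
    using that surjD[OF bij_is_surj[OF p], of j] by (metis not_Some_eq rangeI)
  have "bordered p B (B *v s + r *\<^sub>R m) = bordered p B m ** ?E"
  proof -
    have "(bordered p B m ** ?E) $ i $ j = bordered p B (B *v s + r *\<^sub>R m) $ i $ j" for i j
    proof -
      have "(bordered p B m ** ?E) $ i $ j = (\<Sum>q\<in>UNIV. bordered p B m $ i $ p q * ?E $ p q $ j)"
        unfolding matrix_matrix_mult_def by (simp add: sum.reindex_bij_betw[OF p, of "\<lambda>q. bordered p B m $ i $ q * ?E $ q $ j"])
      also have "\<dots> = bordered p B (B *v s + r *\<^sub>R m) $ i $ j"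
      proof (cases "inv p j")
        case None
        then show ?thesis
          by (simp add: sum_UNIV_option bordered_def join_coords_def ip matrix_vector_mult_def mult.commute)
      next
        case (Some k)
        have "p None \<noteq> p (Some k)" "\<And>l. p (Some l) = p (Some k) \<longleftrightarrow> l = k"
          using ip by (metis option.distinct(1), metis option.inject)
        then show ?thesis
          using Some by (simp add: sum_UNIV_option bordered_def ip if_distrib cong: if_cong)
      qed
      finally show ?thesis .
    qed
    then show ?thesis by (simp add: vec_eq_iff)
  qed
  moreover have "det ?E = r"
  proof -
    \<comment> \<open>After transposition only the row at \<open>p None\<close> is not a unit row,
      so the determinant is that of a single entry.\<close>
    let ?f = "\<lambda>_::unit. p None"
    have "det (transpose ?E) = det (\<chi> k l. transpose ?E $ ?f k $ ?f l)"
    proof (rule det_restrict)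
      show "inj ?f" by (simp add: inj_def)
      fix i j assume i: "i \<notin> range ?f"
      then obtain k where k: "i = p (Some k)" using out by blast
      then show "transpose ?E $ i $ j = (if i = j then 1 else 0)"
        by (auto simp: transpose_def bordered_def ip)
    qed
    also have "\<dots> = r"
    proof -
      have "{\<pi>. \<pi> permutes (UNIV::unit set)} = {id}" by (auto simp: fun_eq_iff permutes_id)
      then show ?thesis
        unfolding det_def by (simp add: transpose_def bordered_def join_coords_def ip)
    qed
    finally show ?thesis by simp
  qed
  ultimately show ?thesis by (simp add: det_mul)
qed

lemma matrix_mul_bordered: "A ** bordered p B e = bordered p (A ** B) (A *v e)"
  by (auto simp: vec_eq_iff matrix_matrix_mult_def matrix_vector_mult_def bordered_def split: option.splits)


section \<open>Change of variables\<close>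

definition coords :: "('n::finite \<Rightarrow> 'm::finite) \<Rightarrow> real^'m \<Rightarrow> real^'n" where
  "coords p x = (\<chi> i. x $ p i)"

lemma linear_coords: "linear (coords p)"
  by (rule linearI) (auto simp: coords_def vec_eq_iff)

lemma coords_inverse:
  assumes "bij p"
  shows "coords (inv p) (coords p x) = x" "coords p (coords (inv p) y) = y"
  using assms by (auto simp: coords_def vec_eq_iff bij_is_inj bij_is_surj surj_f_inv_f)

lemma continuous_on_coords: "continuous_on S (coords p)"
  unfolding coords_def by (intro continuous_intros)

lemma integral_coords:
  fixes p :: "'n::finite \<Rightarrow> 'm::finite" and h :: "real^'m \<Rightarrow> real"
  assumes p: "bij p" and T: "compact T" "continuous_on T h"
  shows "integral T h = integral (coords p ` T) (\<lambda>y. h (coords (inv p) y))"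
proof -
  let ?T = "coords p ` T" and ?h = "\<lambda>y. h (coords (inv p) y)"
  have cT: "compact ?T"
    by (intro compact_continuous_image continuous_on_coords T)
  have ch: "continuous_on ?T ?h"
    by (rule continuous_on_compose2[OF T(2) continuous_on_coords]) (auto simp: coords_inverse p)
  have meas: "coords p \<in> borel_measurable lborel"
    using borel_measurable_continuous_onI[OF continuous_on_coords] by simp
  have F: "(\<lambda>y. indicator ?T y *\<^sub>R ?h y) \<in> borel_measurable borel"
    using borel_measurable_integrable[OF integral_compact_lborel(1)[OF cT ch, unfolded set_integrable_def]] by simp
  have "integral ?T ?h = (\<integral>y. indicator ?T y *\<^sub>R ?h y \<partial>lborel)"
    using integral_compact_lborel(2)[OF cT ch] by (simp add: set_lebesgue_integral_def)
  also have "\<dots> = (\<integral>y. indicator ?T y *\<^sub>R ?h y \<partial>distr lborel borel (coords p))"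
    using distr_lborel_coords[OF p] by (simp add: coords_def[abs_def])
  also have "\<dots> = (\<integral>x. indicator ?T (coords p x) *\<^sub>R ?h (coords p x) \<partial>lborel)"
    using meas F by (subst integral_distr) auto
  also have "\<dots> = (\<integral>x. indicator T x *\<^sub>R h x \<partial>lborel)"
  proof (rule Bochner_Integration.integral_cong[OF refl])
    fix x
    have "coords p x \<in> ?T \<longleftrightarrow> x \<in> T"
      using inj_image_mem_iff[OF inj_on_inverseI[where g="coords (inv p)"]] coords_inverse(1)[OF p] by blast
    then show "indicator ?T (coords p x) *\<^sub>R ?h (coords p x) = indicator T x *\<^sub>R h x"
      by (simp add: coords_inverse p indicator_def)
  qed
  also have "\<dots> = integral T h"
    using integral_compact_lborel(2)[OF T] by (simp add: set_lebesgue_integral_def)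
  finally show ?thesis by simp
qed

text \<open>The map is conjugated with a renaming of the coordinates. This permutes the rows and
  columns of its Jacobian matrix simultaneously and so preserves the determinant.\<close>

lemma integral_change_of_variables_bij:
  fixes g :: "real^'d \<Rightarrow> real^'d" and f :: "real^'d \<Rightarrow> real" and p :: "'n::{finite,wellorder} \<Rightarrow> 'd::finite"
  assumes p: "bij p" and S: "compact S"
    and g: "\<And>x. x \<in> S \<Longrightarrow> (g has_derivative g' x) (at x within S)" "inj_on g S"
    and c: "continuous_on S (\<lambda>x. det (matrix (g' x)))" and f: "continuous_on (g ` S) f"
  shows "integral (g ` S) f = integral S (\<lambda>x. \<bar>det (matrix (g' x))\<bar> * f (g x))"
proof -
  let ?C = "coords p" and ?D = "coords (inv p)"
  let ?g = "\<lambda>y. ?C (g (?D y))" and ?S = "?C ` S"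
  let ?g' = "\<lambda>y h. ?C (g' (?D y) (?D h))" and ?f = "\<lambda>y. f (?D y)"
  note CD = coords_inverse[OF p]
  have blin: "bounded_linear (coords q)" for q :: "'x::finite \<Rightarrow> 'y::finite"
    using linear_coords linear_conv_bounded_linear by blast
  have cg: "continuous_on S g"
    unfolding continuous_on_eq_continuous_within using g(1) has_derivative_continuous by blast
  have gS: "?C ` g ` S = ?g ` ?S" by (auto simp: CD image_image)
  have cS: "compact ?S" "compact (g ` S)"
    by (intro compact_continuous_image continuous_on_coords S cg)+
  have DS: "?D ` ?S = S" by (auto simp: CD image_image)
  have der: "(?g has_derivative ?g' y) (at y within ?S)" if "y \<in> ?S" for y
  proof -
    have 1: "(?D has_derivative ?D) (at y within ?S)"
      by (rule bounded_linear_imp_has_derivative[OF blin])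
    have "?D y \<in> S" using that by (auto simp: CD)
    then have "(g has_derivative g' (?D y)) (at (?D y) within ?D ` ?S)"
      using g(1) DS by simp
    from diff_chain_within[OF 1 this] have "(g \<circ> ?D has_derivative g' (?D y) \<circ> ?D) (at y within ?S)" .
    from bounded_linear.has_derivative[OF blin this, of p] show ?thesis by (simp add: o_def)
  qed
  have inj: "inj_on ?g ?S"
    using g(2) CD by (auto simp: inj_on_def) metis
  have detg: "det (matrix (?g' y)) = det (matrix (g' (?D y)))" for y
  proof -
    have "matrix (?g' y) = (\<chi> i j. matrix (g' (?D y)) $ p i $ p j)"
    proof -
      have "?D (axis j 1) = axis (p j) (1::real)" for j
        using bij_is_inj[OF p] bij_is_surj[OF p] by (auto simp: coords_def axis_def vec_eq_iff inv_f_f surj_f_inv_f)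
      then show ?thesis by (simp add: matrix_def vec_eq_iff coords_def)
    qed
    moreover have "det (matrix (g' (?D y))) = det (\<chi> i j. matrix (g' (?D y)) $ p i $ p j)"
      by (rule det_restrict) (use p in \<open>auto simp: bij_is_inj bij_is_surj\<close>)
    ultimately show ?thesis by simp
  qed
  have cf: "continuous_on S (\<lambda>x. \<bar>det (matrix (g' x))\<bar> * f (g x))"
    by (intro continuous_intros c continuous_on_compose2[OF f cg]) auto
  have cf': "continuous_on (?g ` ?S) ?f"
    unfolding gS[symmetric]
    by (rule continuous_on_compose2[OF f continuous_on_coords]) (auto simp: CD)
  have "integral (g ` S) f = integral (?g ` ?S) ?f"
    using integral_coords[OF p cS(2) f] gS by simp
  also have "\<dots> = integral ?S (\<lambda>y. \<bar>det (matrix (?g' y))\<bar> *\<^sub>R ?f (?g y))"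
  proof -
    \<comment> \<open>The real integrand is wrapped into a vector with one component, the form in
      which the vector-valued theorem applies.\<close>
    let ?v = "\<lambda>y. vec (?f y) :: real^1"
    have ai: "?f absolutely_integrable_on (?g ` ?S)"
      using integral_compact_lborel(3)[OF _ cf'] cS continuous_on_coords gS by (metis compact_continuous_image)
    have "(\<lambda>y. \<bar>det (matrix (?g' y))\<bar> *\<^sub>R ?v (?g y)) absolutely_integrable_on ?S \<and>
        integral ?S (\<lambda>y. \<bar>det (matrix (?g' y))\<bar> *\<^sub>R ?v (?g y)) = vec (integral (?g ` ?S) ?f)"
      using ai has_absolute_integral_change_of_variables_compact[OF cS(1) der inj, of ?v "vec (integral (?g ` ?S) ?f)"]
      by (simp add: absolutely_integrable_on_1_iff integral_on_1_eq vec_eq_iff)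
    then show ?thesis
      by (simp add: absolutely_integrable_on_1_iff integral_on_1_eq vec_eq_iff)
  qed
  also have "\<dots> = integral S (\<lambda>x. \<bar>det (matrix (g' x))\<bar> * f (g x))"
    using integral_coords[OF p S cf] by (simp add: detg CD)
  finally show ?thesis .
qed

text \<open>The library proves the change of variables only for well-ordered index types; numeral types
  of the same cardinality reduce the general low-dimensional case to it.\<close>

lemma integral_change_of_variables_compact:
  fixes g :: "real^'d \<Rightarrow> real^'d" and f :: "real^'d \<Rightarrow> real"
  assumes card: "CARD('d) \<le> 3" and S: "compact S"
    and g: "\<And>x. x \<in> S \<Longrightarrow> (g has_derivative g' x) (at x within S)" "inj_on g S"
    and c: "continuous_on S (\<lambda>x. det (matrix (g' x)))" and f: "continuous_on (g ` S) f"
  shows "integral (g ` S) f = integral S (\<lambda>x. \<bar>det (matrix (g' x))\<bar> * f (g x))"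
proof -
  have "CARD('d) > 0" by simp
  then consider "CARD('d) = CARD(1)" | "CARD('d) = CARD(2)" | "CARD('d) = CARD(3)"
  proof -
    have "CARD('d) = 1 \<or> CARD('d) = 2 \<or> CARD('d) = 3" using card \<open>CARD('d) > 0\<close> by linarith
    then show ?thesis using that by auto
  qed
  then show ?thesis
  proof cases
    case 1
    then obtain p :: "1 \<Rightarrow> 'd" where "bij p"
      by (metis finite_same_card_bij finite)
    then show ?thesis by (rule integral_change_of_variables_bij[OF _ S g c f])
  next
    case 2
    then obtain p :: "2 \<Rightarrow> 'd" where "bij p"
      by (metis finite_same_card_bij finite)
    then show ?thesis by (rule integral_change_of_variables_bij[OF _ S g c f])
  next
    case 3
    then obtain p :: "3 \<Rightarrow> 'd" where "bij p"
      by (metis finite_same_card_bij finite)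
    then show ?thesis by (rule integral_change_of_variables_bij[OF _ S g c f])
  qed
qed

text \<open>On a skew cylinder the coordinates \<open>s\<close> and \<open>t\<close> are an affine
  change of variables with constant volume factor; Fubini then separates base and height.\<close>

lemma integral_cylinder:
  fixes B :: "real^'f^'d" and f :: "real^'d \<Rightarrow> real"
  assumes card: "CARD('d) \<le> 3" and p: "bij p"
    and det: "det (bordered p B e) \<noteq> 0" and S: "compact S"
    and f: "continuous_on UNIV f"
  shows "integral ((\<lambda>(s, t). b + B *v s + t *\<^sub>R e) ` (S \<times> {0..R})) f
    = \<bar>det (bordered p B e)\<bar> * integral S (\<lambda>s. integral {0..R} (\<lambda>t. f (b + B *v s + t *\<^sub>R e)))"
proof -
  let ?j = "join_coords p" and ?M = "bordered p B e"
  let ?g = "\<lambda>x. b + ?M *v x"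
  let ?T = "?j ` (S \<times> {0..R})"
  let ?h = "\<lambda>x. f (?g x)"
  have cj: "continuous_on X ?j" for X
    by (intro linear_continuous_on linear_conv_bounded_linear[THEN iffD1] join_coords_linear)
  have gj: "?g (?j (s, t)) = b + B *v s + t *\<^sub>R e" for s t
    by (simp add: bordered_join_coords[OF p] add.assoc)
  have cT: "compact ?T"
    by (intro compact_continuous_image cj compact_Times S compact_Icc)
  have injj: "inj ?j"
  proof (rule injI)
    fix u v assume "?j u = ?j v"
    then have *: "?j u $ p q = ?j v $ p q" for q by simp
    have "inv p (p q) = q" for q using p by (simp add: bij_is_inj)
    then show "u = v"
      using *[of None] *[of "Some _"] 
      by (cases u, cases v) (auto simp: join_coords_def vec_eq_iff)
  qed
  have cg: "continuous_on X ?g" for X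
    by (intro continuous_intros matrix_vector_mult_linear_continuous_on)
  have ch: "continuous_on X ?h" for X
    by (rule continuous_on_compose2[OF f cg]) auto
  have "integral (?g ` ?T) f = integral ?T (\<lambda>x. \<bar>det (matrix ((*v) ?M))\<bar> * f (?g x))"
  proof (rule integral_change_of_variables_compact[OF card cT])
    show "(?g has_derivative (*v) ?M) (at x within ?T)" for x
      by (auto intro!: derivative_eq_intros bounded_linear_imp_has_derivative)
    have "invertible ?M" using det invertible_det_nz by blast
    then have "inj ((*v) ?M)" by (rule inj_matrix_vector_mult)
    then show "inj_on ?g ?T" by (auto simp: inj_on_def)
    show "continuous_on ?T (\<lambda>x. det (matrix ((*v) ?M)))" by (intro continuous_intros)
    show "continuous_on (?g ` ?T) f" using f continuous_on_subset by blast
  qed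
  also have "\<dots> = \<bar>det ?M\<bar> * integral ?T ?h"
    by (simp add: matrix_of_matrix_vector_mul)
  also have "integral ?T ?h = (\<integral>x. indicator ?T x *\<^sub>R ?h x \<partial>lborel)"
    using integral_compact_lborel(2)[OF cT ch] by (simp add: set_lebesgue_integral_def)
  also have "\<dots> = (\<integral>x. indicator ?T x *\<^sub>R ?h x \<partial>distr lborel borel ?j)"
    using distr_lborel_join_coords[OF p] by simp
  also have "\<dots> = (\<integral>u. indicator ?T (?j u) *\<^sub>R ?h (?j u) \<partial>lborel)"
  proof (rule integral_distr)
    show "?j \<in> lborel \<rightarrow>\<^sub>M borel"
      using borel_measurable_continuous_onI[OF cj] by simp
    show "(\<lambda>x. indicator ?T x *\<^sub>R ?h x) \<in> borel_measurable borel"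
      using integral_compact_lborel(1)[OF cT ch] unfolding set_integrable_def by auto
  qed
  also have "\<dots> = (\<integral>u. indicator (S \<times> {0..R}) u *\<^sub>R ?h (?j u) \<partial>(lborel \<Otimes>\<^sub>M lborel))"
    by (auto simp: lborel_prod indicator_def inj_image_mem_iff[OF injj] intro!: Bochner_Integration.integral_cong)
  also have "\<dots> = (\<integral>s. (\<integral>t. indicator (S \<times> {0..R}) (s, t) *\<^sub>R ?h (?j (s, t)) \<partial>lborel) \<partial>lborel)"
  proof (rule lborel_pair.integral_fst'[symmetric])
    have "continuous_on (S \<times> {0..R}) (\<lambda>u. ?h (?j u))"
      by (rule continuous_on_compose2[OF ch cj]) auto
    then show "integrable (lborel \<Otimes>\<^sub>M lborel) (\<lambda>u. indicator (S \<times> {0..R}) u *\<^sub>R ?h (?j u))"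
      using integral_compact_lborel(1)[OF compact_Times[OF S compact_Icc], of 0 R "\<lambda>u. ?h (?j u)"]
      by (simp add: set_integrable_def lborel_prod)
  qed
  also have "\<dots> = (\<integral>s. indicator S s *\<^sub>R integral {0..R} (\<lambda>t. f (b + B *v s + t *\<^sub>R e)) \<partial>lborel)"
  proof (rule Bochner_Integration.integral_cong[OF refl])
    fix s
    have "continuous_on {0..R} (\<lambda>t. f (b + B *v s + t *\<^sub>R e))"
      by (rule continuous_on_compose2[OF f]) (auto intro!: continuous_intros)
    from integral_compact_lborel(2)[OF compact_Icc this]
    show "(\<integral>t. indicator (S \<times> {0..R}) (s, t) *\<^sub>R ?h (?j (s, t)) \<partial>lborel)
      = indicator S s *\<^sub>R integral {0..R} (\<lambda>t. f (b + B *v s + t *\<^sub>R e))"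
      by (simp add: gj set_lebesgue_integral_def indicator_times mult.assoc)
  qed
  also have "\<dots> = integral S (\<lambda>s. integral {0..R} (\<lambda>t. f (b + B *v s + t *\<^sub>R e)))"
  proof -
    have "continuous_on S (\<lambda>s. integral (cbox 0 R) (\<lambda>t. f (b + B *v s + t *\<^sub>R e)))"
    proof (rule integral_continuous_on_param)
      show "continuous_on (S \<times> cbox 0 R) (\<lambda>(s, t). f (b + B *v s + t *\<^sub>R e))"
        unfolding case_prod_beta
        by (rule continuous_on_compose2[OF f])
          (auto intro!: continuous_intros continuous_on_compose2[OF matrix_vector_mult_linear_continuous_on])
    qed
    then show ?thesis
      using integral_compact_lborel(2)[OF S] by (simp add: set_lebesgue_integral_def)
  qed
  finally show ?thesis
    by (simp add: image_image case_prod_beta gj[symmetric])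
qed

section \<open>Polytopes and charts of their facets\<close>

text \<open>The flat geometry of one reference cell with parametrised facets, kept apart from the
  mesh.\<close>

locale charted_polytope =
  fixes P :: "(real^'d) set" and \<gamma> :: "(real^'d) set \<Rightarrow> real^'f \<Rightarrow> real^'d"
  assumes polytope: "polytope P" and interior_nonempty: "interior P \<noteq> {}"
    and card: "CARD('d) = CARD('f) + 1"
    and chart: "\<And>F. F facet_of P \<Longrightarrow>
      \<exists>L b. linear L \<and> inj L \<and> \<gamma> F = (\<lambda>s. b + L s) \<and> F \<subseteq> range (\<gamma> F)"
begin

text \<open>The linear part of the affine chart; being the derivative of an affine map, it is the
  same at every point.\<close>

definition B :: "(real^'d) set \<Rightarrow> real^'f^'d" where
  "B F = jacobian (\<gamma> F) (at 0)"

definition S :: "(real^'d) set \<Rightarrow> (real^'f) set" where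
  "S F = \<gamma> F -` F"

text \<open>Worded like \<open>ref_normal\<close>, so that the two coincide by unfolding once
  \<open>P\<close> is the reference cell.\<close>

definition nrm :: "(real^'d) set \<Rightarrow> real^'d" where
  "nrm F = (THE n. norm n = 1 \<and> (\<exists>c. P \<subseteq> {x. n \<bullet> x \<le> c} \<and> F \<subseteq> {x. n \<bullet> x = c}))"

definition off :: "(real^'d) set \<Rightarrow> real" where
  "off F = nrm F \<bullet> \<gamma> F 0"

text \<open>Density of the surface measure of the flat facet in its chart, a constant because the
  chart is affine.\<close>

definition gram :: "(real^'d) set \<Rightarrow> real" where
  "gram F = sqrt (det (transpose (B F) ** B F))"

lemma P_props: "compact P" "convex P" "closed P" "polyhedron P" "aff_dim P = int CARD('d)"
  using polytope polytope_imp_compact polytope_imp_convex polytope_imp_polyhedron compact_imp_closed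
    aff_dim_nonempty_interior[OF interior_nonempty] by auto

lemma finite_facets: "finite {F. F facet_of P}"
  by (rule finite_polytope_facets[OF polytope])

lemma chart_affine:
  assumes "F facet_of P"
  shows "\<gamma> F s = \<gamma> F 0 + B F *v s" "inj ((*v) (B F))" "F \<subseteq> range (\<gamma> F)"
proof -
  obtain L b where L: "linear L" "inj L" "\<gamma> F = (\<lambda>s. b + L s)" "F \<subseteq> range (\<gamma> F)"
    using chart[OF assms] by blast
  have "(\<gamma> F has_derivative L) (at 0)"
    unfolding L(3) using L(1) by (auto intro!: derivative_eq_intros linear_imp_has_derivative)
  then have "B F = matrix L"
    unfolding B_def jacobian_def by (simp add: frechet_derivative_at[symmetric])
  then have BL: "B F *v s = L s" for s
    using L(1) by simp
  then show "\<gamma> F s = \<gamma> F 0 + B F *v s" "inj ((*v) (B F))" "F \<subseteq> range (\<gamma> F)"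
    using L linear_0[OF L(1)] by (auto simp: inj_def)
qed

lemma chart_eq: "F facet_of P \<Longrightarrow> \<gamma> F = (\<lambda>s. \<gamma> F 0 + B F *v s)"
  using chart_affine(1) by blast

lemma chart_inj: "F facet_of P \<Longrightarrow> inj (\<gamma> F)"
  using chart_affine(2) by (subst chart_eq) (auto simp: inj_def)

lemma chart_continuous: "F facet_of P \<Longrightarrow> continuous_on X (\<gamma> F)"
  by (subst chart_eq) (auto intro!: continuous_intros matrix_vector_mult_linear_continuous_on)

lemma chart_image: "F facet_of P \<Longrightarrow> \<gamma> F ` S F = F"
  using chart_affine(3) unfolding S_def by blast

text \<open>All of this is carried over from the facet by the affine injection. A facet has
  codimension one, so the parameter set has full dimension and its interior corresponds to the
  relative interior of the facet.\<close>

lemma S_props: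
  assumes F: "F facet_of P"
  shows "compact (S F)" "convex (S F)" "interior (S F) \<noteq> {}" "closure (interior (S F)) = S F"
    "negligible (frontier (S F))" "rel_interior F = \<gamma> F ` interior (S F)"
proof -
  obtain L b where L: "linear L" "inj L" "\<gamma> F = (\<lambda>s. b + L s)" "F \<subseteq> range (\<gamma> F)"
    using chart[OF F] by blast
  obtain L' where L': "linear L'" "L' \<circ> L = id"
    using linear_injective_left_inverse[OF L(1,2)] by blast
  have L'L: "L' (L s) = s" for s
    using L'(2) by (metis comp_apply id_apply)
  have eq: "S F = L' ` ((\<lambda>x. x - b) ` F)"
  proof -
    have "s \<in> L' ` ((\<lambda>x. x - b) ` F)" if "s \<in> S F" for s
      using that by (intro image_eqI[of _ _ "L s"] image_eqI[of _ _ "\<gamma> F s"]) (auto simp: L'L L(3) S_def)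
    moreover have "L' (x - b) \<in> S F" if "x \<in> F" for x
    proof -
      obtain s where "x = b + L s" using subsetD[OF L(4) \<open>x \<in> F\<close>] unfolding L(3) by (auto simp: image_iff)
      then show ?thesis using that by (simp add: S_def L'L L(3))
    qed
    ultimately show ?thesis by blast
  qed
  have F': "compact F" "convex F" "F \<noteq> {}"
    using F P_props unfolding facet_of_def by (auto intro: face_of_imp_compact face_of_imp_convex)
  show c: "compact (S F)"
    unfolding eq by (intro compact_continuous_image linear_continuous_on
        linear_conv_bounded_linear[THEN iffD1] L'(1) continuous_intros F')
  show cv: "convex (S F)"
    unfolding eq by (rule convex_linear_image[OF L'(1) convex_translation_subtract[OF F'(2)]])
  have img: "F = (+) b ` L ` S F"
    using chart_image[OF F] L(3) by (auto simp: image_image)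
  have "aff_dim F = aff_dim (S F)"
    by (subst img) (simp only: aff_dim_translation_eq aff_dim_injective_linear_image[OF L(1,2)])
  moreover have "aff_dim F = int CARD('f)"
    using F P_props(5) card unfolding facet_of_def by simp
  ultimately have "aff_dim (S F) = int (DIM(real^'f))" by simp
  then have ri: "rel_interior (S F) = interior (S F)"
    by (rule interior_rel_interior)
  have "S F \<noteq> {}" using F'(3) img by auto
  then show "interior (S F) \<noteq> {}"
    using cv ri rel_interior_eq_empty by metis
  then show "closure (interior (S F)) = S F"
    using convex_closure_interior[OF cv] c by (simp add: closure_closed compact_imp_closed)
  show "negligible (frontier (S F))"
    by (rule negligible_convex_frontier[OF cv])
  have "rel_interior F = (+) b ` L ` rel_interior (S F)"
    by (subst img) (simp only: rel_interior_translation rel_interior_injective_linear_image[OF linear_conv_bounded_linear[THEN iffD1, OF L(1)] L(2)])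
  then show "rel_interior F = \<gamma> F ` interior (S F)"
    by (auto simp: ri L(3) image_image)
qed

text \<open>Around an interior point of the parameter set every direction \<open>h\<close> is
  realised, up to scaling, by a difference of two points of the facet.\<close>

lemma facet_directions:
  assumes F: "F facet_of P" and y: "y \<in> F" and m: "\<And>z. z \<in> F \<Longrightarrow> m \<bullet> (z - y) = 0"
  shows "m \<bullet> (B F *v h) = 0"
proof -
  obtain s where s: "s \<in> interior (S F)" using S_props(3)[OF F] by blast
  then obtain r where r: "r > 0" "cball s r \<subseteq> S F"
    using mem_interior_cball by blast
  have "\<gamma> F s \<in> F" using r by (auto simp: S_def subset_iff)
  \<comment> \<open>Scales \<open>h\<close> to length at most \<open>r\<close>; the summand 1 covers
    \<open>h = 0\<close>.\<close>
  define c where "c = r / (1 + norm h)"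
  have c: "c > 0" "norm (c *\<^sub>R h) \<le> r"
    using r by (auto simp: c_def divide_simps algebra_simps add_pos_nonneg)
  then have "s + c *\<^sub>R h \<in> S F" using r(2) by (auto simp: dist_norm subset_iff)
  then have "\<gamma> F (s + c *\<^sub>R h) \<in> F" by (simp add: S_def)
  from m[OF this] m[OF \<open>\<gamma> F s \<in> F\<close>] have "m \<bullet> (\<gamma> F (s + c *\<^sub>R h) - \<gamma> F s) = 0"
    by (simp add: inner_diff_right)
  then show ?thesis
    using c(1) by (simp add: chart_affine(1)[OF F, of s] chart_affine(1)[OF F, of "s + c *\<^sub>R h"]
        matrix_vector_mult_add_rdistrib matrix_vector_right_distrib matrix_vector_mult_scaleR)
qed

lemma range_B_eq_hyperplane:
  assumes F: "F facet_of P" and n: "n \<noteq> 0" "\<And>h. n \<bullet> (B F *v h) = 0"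
  shows "range ((*v) (B F)) = {x. n \<bullet> x = 0}"
proof (rule subspace_dim_equal)
  show "subspace (range ((*v) (B F)))"
    by (intro linear_subspace_image) auto
  show "subspace {x. n \<bullet> x = 0}" by (rule subspace_hyperplane)
  have "dim (range ((*v) (B F))) = CARD('f)"
    using dim_image_eq[of "(*v) (B F)" UNIV] chart_affine(2)[OF F] by (simp add: inj_on_subset)
  then show "dim (range ((*v) (B F))) \<ge> dim {x. n \<bullet> x = 0}"
    using n(1) card by (simp add: dim_hyperplane)
qed (use n in auto)

text \<open>The part of \<open>m\<close> orthogonal to \<open>n\<close> is a tangent direction,
  hence orthogonal to \<open>m\<close> and so to itself.\<close>

lemma parallel_normal:
  assumes F: "F facet_of P" and n: "norm n = 1" "\<And>h. n \<bullet> (B F *v h) = 0" "\<And>h. m \<bullet> (B F *v h) = 0"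
  shows "m = (m \<bullet> n) *\<^sub>R n"
proof -
  let ?w = "m - (m \<bullet> n) *\<^sub>R n"
  have nn: "n \<bullet> n = 1" using n(1) by (simp add: norm_eq_1)
  have "n \<bullet> ?w = 0" by (simp add: inner_diff_right nn inner_commute)
  then have "?w \<in> range ((*v) (B F))"
    using range_B_eq_hyperplane[OF F _ n(2)] n(1) by force
  then have "m \<bullet> ?w = 0" using n(3) by auto
  then have "?w \<bullet> ?w = 0" using \<open>n \<bullet> ?w = 0\<close> by (simp add: inner_diff_left)
  then show ?thesis by simp
qed

text \<open>Orthogonality to the facet fixes \<open>m\<close> up to a factor, and an interior point
  of \<open>P\<close> fixes the sign. The length of \<open>m\<close> is left free so that normals of
  curved cells, pulled back by a transposed Jacobian, can be compared with \<open>n\<close>.\<close>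

lemma normal_unique:
  assumes F: "F facet_of P" and y: "y \<in> F"
    and n: "norm n = 1" "\<And>z. z \<in> F \<Longrightarrow> n \<bullet> (z - y) = 0" "\<And>z. z \<in> P \<Longrightarrow> n \<bullet> (z - y) \<le> 0"
    and m: "\<And>z. z \<in> F \<Longrightarrow> m \<bullet> (z - y) = 0" "\<And>z. z \<in> P \<Longrightarrow> m \<bullet> (z - y) \<le> 0"
  shows "m = norm m *\<^sub>R n"
proof -
  have eq: "m = (m \<bullet> n) *\<^sub>R n"
    by (rule parallel_normal[OF F n(1)]) (use facet_directions[OF F y] n m in blast)+
  obtain z where z: "z \<in> interior P" using interior_nonempty by blast
  then obtain r where r: "r > 0" "cball z r \<subseteq> P"
    using mem_interior_cball by blast
  \<comment> \<open>A small step from the interior point in the direction \<open>n\<close> stays in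
    \<open>P\<close>, which makes the inequality at \<open>z\<close> strict.\<close>
  have "z + r *\<^sub>R n \<in> P" using r n(1) by (auto simp: dist_norm subset_iff)
  then have "n \<bullet> (z - y) + r * (n \<bullet> n) \<le> 0"
    using n(3)[of "z + r *\<^sub>R n"] by (simp add: algebra_simps inner_simps)
  then have neg: "n \<bullet> (z - y) < 0" using n(1) r(1) by (simp add: norm_eq_1)
  have "(m \<bullet> n) * (n \<bullet> (z - y)) \<le> 0"
    using m(2)[of z] z interior_subset eq by (metis inner_scaleR_left subsetD)
  then have "m \<bullet> n \<ge> 0" using neg by (simp add: mult_le_0_iff)
  moreover have "norm m = \<bar>m \<bullet> n\<bar>" using eq n(1) by (metis mult.right_neutral norm_scaleR)
  ultimately show ?thesis using eq by simp
qed

text \<open>The definite description denotes: a facet inequality of the polyhedron, scaled to unit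
  length, gives existence, and \<open>normal_unique\<close> gives uniqueness.\<close>

lemma nrm_props:
  assumes F: "F facet_of P"
  shows "norm (nrm F) = 1" "P \<subseteq> {x. nrm F \<bullet> x \<le> off F}" "F = P \<inter> {x. nrm F \<bullet> x = off F}"
    "nrm F \<bullet> (B F *v h) = 0" "range ((*v) (B F)) = {x. nrm F \<bullet> x = 0}"
    "nrm F \<bullet> \<gamma> F s = off F"
proof -
  obtain a b where ab: "a \<noteq> 0" "P \<subseteq> {x. a \<bullet> x \<le> b}" "F = P \<inter> {x. a \<bullet> x = b}"
    using facet_of_polyhedron[OF P_props(4) F] by blast
  have Fne: "F \<noteq> {}" using F by (auto simp: facet_of_def)
  then obtain y where y: "y \<in> F" by blast
  define n where "n = a /\<^sub>R norm a"
  define c where "c = b / norm a"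
  have n: "norm n = 1" "P \<subseteq> {x. n \<bullet> x \<le> c}" "F = P \<inter> {x. n \<bullet> x = c}"
    using ab by (auto simp: n_def c_def field_simps)
  have uniq: "m = n" if "norm m = 1" "P \<subseteq> {x. m \<bullet> x \<le> d}" "F \<subseteq> {x. m \<bullet> x = d}" for m d
  proof -
    have "m = norm m *\<^sub>R n"
      by (rule normal_unique[OF F y n(1)])
        (use n(2,3) that y in \<open>auto simp: inner_diff_right subset_iff\<close>)
    then show ?thesis using that(1) by simp
  qed
  have nn: "nrm F = n"
    unfolding nrm_def
  proof (rule the_equality)
    show "norm n = 1 \<and> (\<exists>c. P \<subseteq> {x. n \<bullet> x \<le> c} \<and> F \<subseteq> {x. n \<bullet> x = c})"
      using n by auto
  qed (use uniq in blast)
  have B: "n \<bullet> (B F *v h) = 0" for h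
    by (rule facet_directions[OF F y]) (use n(3) y in \<open>auto simp: inner_diff_right\<close>)
  obtain s0 where "y = \<gamma> F s0" using y chart_affine(3)[OF F] by blast
  then have "n \<bullet> y = n \<bullet> \<gamma> F 0"
    using B[of s0] by (simp add: inner_add_right chart_affine(1)[OF F, of s0])
  moreover have "n \<bullet> y = c" using n(3) y by blast
  ultimately have "n \<bullet> \<gamma> F 0 = c" by simp
  then have off: "off F = c" by (simp add: off_def nn)
  show "norm (nrm F) = 1" "P \<subseteq> {x. nrm F \<bullet> x \<le> off F}" "F = P \<inter> {x. nrm F \<bullet> x = off F}"
    "nrm F \<bullet> (B F *v h) = 0" 
    unfolding nn off using n B by blast+
  show "range ((*v) (B F)) = {x. nrm F \<bullet> x = 0}"
    unfolding nn using n(1) B by (intro range_B_eq_hyperplane[OF F]) auto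
  show "nrm F \<bullet> \<gamma> F s = off F"
    by (simp add: chart_affine(1)[OF F, of s] inner_add_right nn B off \<open>n \<bullet> \<gamma> F 0 = c\<close>)
qed

section \<open>The polytope as intersection of the half-spaces of its facets\<close>

lemma facet_subset_frontier:
  assumes "F facet_of P" shows "F \<subseteq> P" "F \<inter> interior P = {}" "F \<subseteq> frontier P"
proof -
  show "F \<subseteq> P" using assms by (rule facet_of_imp_subset)
  moreover show "F \<inter> interior P = {}"
    using assms by (intro face_of_disjoint_interior) (auto simp: facet_of_imp_face_of)
  ultimately show "F \<subseteq> frontier P"
    using P_props(3) by (auto simp: frontier_def)
qed

lemma frontier_eq_facets: "frontier P = \<Union>{F. F facet_of P}"
proof -
  have "frontier P = P - rel_interior P"
    using P_props interior_rel_interior[of P] by (simp add: frontier_def)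
  then show ?thesis
    using rel_boundary_of_polyhedron[OF P_props(4)] by simp
qed

lemma facet_inequality_strict:
  assumes "F facet_of P" "x \<in> P" "x \<notin> F" shows "nrm F \<bullet> x < off F"
  using nrm_props(2,3)[OF assms(1)] assms(2,3) by fastforce

text \<open>A point outside \<open>P\<close> is joined to an interior point by a segment that
  crosses some facet. There a convex combination of a strict and a weak inequality would have to be
  an equality.\<close>

lemma mem_P_iff: "x \<in> P \<longleftrightarrow> (\<forall>F. F facet_of P \<longrightarrow> nrm F \<bullet> x \<le> off F)"
proof
  show "x \<in> P \<Longrightarrow> \<forall>F. F facet_of P \<longrightarrow> nrm F \<bullet> x \<le> off F"
    using nrm_props(2) by blast
next
  assume le: "\<forall>F. F facet_of P \<longrightarrow> nrm F \<bullet> x \<le> off F"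
  show "x \<in> P"
  proof (rule ccontr)
    assume "x \<notin> P"
    obtain p where p: "p \<in> interior P" using interior_nonempty by blast
    then have "p \<in> P" using interior_subset by blast
    have "closed_segment p x \<inter> frontier P \<noteq> {}"
      using \<open>x \<notin> P\<close> \<open>p \<in> P\<close> by (intro connected_Int_frontier) auto
    then obtain y F where y: "y \<in> closed_segment p x" "y \<in> F" "F facet_of P"
      using frontier_eq_facets by auto
    obtain t where t: "y = (1 - t) *\<^sub>R p + t *\<^sub>R x" "0 \<le> t" "t \<le> 1"
      using y(1) by (auto simp: in_segment)
    have "t \<noteq> 1" using t y \<open>x \<notin> P\<close> facet_subset_frontier(1)[OF y(3)] by auto
    have "p \<notin> F" using p facet_subset_frontier(2)[OF y(3)] by blast
    have "nrm F \<bullet> y = off F" using y nrm_props(3) by blast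
    then have "off F = (1 - t) * (nrm F \<bullet> p) + t * (nrm F \<bullet> x)"
      by (simp add: t(1) inner_simps)
    moreover have "(1 - t) * (nrm F \<bullet> p) < (1 - t) * off F"
      using facet_inequality_strict[OF y(3) \<open>p \<in> P\<close> \<open>p \<notin> F\<close>] t \<open>t \<noteq> 1\<close> by simp
    moreover have "t * (nrm F \<bullet> x) \<le> t * off F"
      using le y(3) t by (simp add: mult_left_mono)
    ultimately show False by (simp add: algebra_simps)
  qed
qed

text \<open>A face that meets the relative interior of \<open>F\<close> contains \<open>F\<close>,
  and facets have equal dimension.\<close>

lemma rel_interior_facet_unique:
  assumes "F facet_of P" "F' facet_of P" "x \<in> rel_interior F" "x \<in> F'"
  shows "F' = F"
proof -
  have "F \<subseteq> F'"
    using assms facet_of_imp_face_of facet_of_imp_subset[OF assms(1)]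
    by (intro subset_of_face_of[of F' P]) auto
  then have "F face_of F'"
    using assms(1,2) facet_of_imp_face_of face_of_subset facet_of_imp_subset by metis
  moreover have "aff_dim F = aff_dim F'" using assms(1,2) by (simp add: facet_of_def)
  moreover have "convex F'" using assms(2) facet_of_imp_face_of face_of_imp_convex P_props(2) by blast
  ultimately show ?thesis using face_of_aff_dim_lt[of F' F] by auto
qed

text \<open>Inequalities of facets that avoid \<open>x\<close> are strict at \<open>x\<close> and
  persist nearby, so only the facets through \<open>x\<close> have to be checked.\<close>

lemma eventually_in_P:
  assumes x: "x \<in> P" and X: "\<And>F. F facet_of P \<Longrightarrow> x \<in> F \<Longrightarrow> eventually (\<lambda>k. nrm F \<bullet> X k \<le> off F) G"
    and lim: "(X \<longlongrightarrow> x) G"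
  shows "eventually (\<lambda>k. X k \<in> P) G"
proof -
  have "eventually (\<lambda>k. nrm F \<bullet> X k \<le> off F) G" if F: "F facet_of P" for F
  proof (cases "x \<in> F")
    case False
    have "((\<lambda>k. nrm F \<bullet> X k) \<longlongrightarrow> nrm F \<bullet> x) G"
      by (intro tendsto_intros lim)
    from order_tendstoD(2)[OF this facet_inequality_strict[OF F x False]]
    show ?thesis by (rule eventually_mono) auto
  qed (use X F in auto)
  then have "eventually (\<lambda>k. \<forall>F\<in>{F. F facet_of P}. nrm F \<bullet> X k \<le> off F) G"
    using finite_facets by (subst eventually_ball_finite_distrib) auto
  then show ?thesis
    by (rule eventually_mono) (simp add: mem_P_iff)
qed

text \<open>Base times height: only the normal component of \<open>e\<close> contributes to the
  volume.\<close>

lemma abs_det_bordered_facet: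
  assumes p: "bij p" and F: "F facet_of P" 
  shows "\<bar>det (bordered p (B F) e)\<bar> = \<bar>nrm F \<bullet> e\<bar> * gram F"
proof -
  have n: "transpose (B F) *v nrm F = 0"
  proof -
    have "(transpose (B F) *v nrm F) \<bullet> h = 0" for h
      using nrm_props(4)[OF F, of h] by (simp add: dot_lmul_matrix[symmetric] vector_transpose_matrix)
    then show ?thesis by (metis inner_eq_zero_iff)
  qed
  have "nrm F \<bullet> (e - (nrm F \<bullet> e) *\<^sub>R nrm F) = 0"
    using nrm_props(1)[OF F] by (simp add: inner_diff_right norm_eq_1)
  then obtain s where "B F *v s = e - (nrm F \<bullet> e) *\<^sub>R nrm F"
    using nrm_props(5)[OF F] by force
  then have "e = B F *v s + (nrm F \<bullet> e) *\<^sub>R nrm F" by simp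
  then show ?thesis
    using det_bordered_add[OF p, of "B F" s "nrm F \<bullet> e" "nrm F"] 
      abs_det_bordered_unit[OF p n nrm_props(1)[OF F]]
    by (simp add: abs_mult gram_def)
qed


section \<open>Lines and half-infinite cylinders over facets\<close>

definition lines :: "real^'d \<Rightarrow> (real^'d) set \<Rightarrow> (real^'d) set" where
  "lines e F = {x + t *\<^sub>R e | x t. x \<in> F}"

definition cylinder :: "real^'d \<Rightarrow> (real^'d) set \<Rightarrow> (real^'d) set" where
  "cylinder e F = {x + t *\<^sub>R e | x t. x \<in> F \<and> 0 \<le> t}"

lemma mem_lines: "z \<in> lines e F \<longleftrightarrow> (\<exists>t. z - t *\<^sub>R e \<in> F)"
proof
  show "\<exists>t. z - t *\<^sub>R e \<in> F \<Longrightarrow> z \<in> lines e F"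
    unfolding lines_def by (metis (mono_tags, lifting) diff_add_cancel mem_Collect_eq)
next
  assume "z \<in> lines e F"
  then obtain x t where "x \<in> F" "z = x + t *\<^sub>R e" unfolding lines_def by blast
  then show "\<exists>t. z - t *\<^sub>R e \<in> F" by (intro exI[of _ t]) simp
qed

lemma mem_cylinder: "z \<in> cylinder e F \<longleftrightarrow> (\<exists>t\<ge>0. z - t *\<^sub>R e \<in> F)"
proof
  show "\<exists>t\<ge>0. z - t *\<^sub>R e \<in> F \<Longrightarrow> z \<in> cylinder e F"
    unfolding cylinder_def by (metis (mono_tags, lifting) diff_add_cancel mem_Collect_eq)
next
  assume "z \<in> cylinder e F"
  then obtain x t where "x \<in> F" "z = x + t *\<^sub>R e" "0 \<le> t" unfolding cylinder_def by blast
  then show "\<exists>t\<ge>0. z - t *\<^sub>R e \<in> F" by (intro exI[of _ t]) simp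
qed

text \<open>If \<open>e\<close> were parallel to \<open>F\<close>, the swept set would lie in a
  hyperplane and have no interior. Otherwise a neighbourhood of the hit point in the plane of
  \<open>F\<close>, shifted near \<open>z\<close>, consists of points on lines through
  \<open>F\<close>; sliding back along the transversal direction shows that it lies in
  \<open>F\<close>.\<close>

lemma generic_point:
  assumes F: "F facet_of P" and z: "z \<notin> frontier (lines e F)" and x: "z - t *\<^sub>R e \<in> F"
  shows "nrm F \<bullet> e \<noteq> 0" "z - t *\<^sub>R e \<in> rel_interior F"
proof -
  have "z \<in> lines e F" using x mem_lines by blast
  then have zi: "z \<in> interior (lines e F)"
    using z closure_subset unfolding frontier_def by blast
  have n0: "nrm F \<noteq> 0" using nrm_props(1)[OF F] by auto
  have FH: "nrm F \<bullet> y = off F" if "y \<in> F" for y using nrm_props(3)[OF F] that by blast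
  show ne: "nrm F \<bullet> e \<noteq> 0"
  proof
    assume "nrm F \<bullet> e = 0"
    then have "lines e F \<subseteq> {y. nrm F \<bullet> y = off F}"
      using FH by (auto simp: lines_def inner_add_right)
    then have "interior (lines e F) \<subseteq> interior {y. nrm F \<bullet> y = off F}" by (rule interior_mono)
    then show False using zi interior_hyperplane[OF n0] by auto
  qed
  let ?T = "(\<lambda>y. - t *\<^sub>R e + y) ` interior (lines e F)"
  have "open ?T" by (rule open_translation) simp
  moreover have "z - t *\<^sub>R e \<in> ?T" using zi by (intro image_eqI[of _ _ z]) auto
  moreover have "?T \<inter> affine hull F \<subseteq> F"
  proof
    fix y assume y: "y \<in> ?T \<inter> affine hull F"
    have "affine hull F \<subseteq> {y. nrm F \<bullet> y = off F}"
      by (rule hull_minimal) (use FH in \<open>auto simp: affine_hyperplane\<close>)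
    then have yn: "nrm F \<bullet> y = off F" using y by blast
    have "y + t *\<^sub>R e \<in> lines e F" using y interior_subset by fastforce
    then obtain t' where t': "y + t *\<^sub>R e - t' *\<^sub>R e \<in> F" using mem_lines by blast
    then have "(t - t') * (nrm F \<bullet> e) = 0"
      using FH[OF t'] yn by (simp add: inner_simps algebra_simps)
    then show "y \<in> F" using ne t' by simp
  qed
  ultimately show "z - t *\<^sub>R e \<in> rel_interior F"
    using x mem_rel_interior by blast
qed

text \<open>If no facet inequality active at \<open>x\<close> increased along \<open>v\<close>, a
  small step along \<open>v\<close> would stay in \<open>P\<close>.\<close>

lemma last_point_facet:
  assumes x: "x \<in> P" and out: "\<And>r. r > 0 \<Longrightarrow> x + r *\<^sub>R v \<notin> P"
  shows "\<exists>F. F facet_of P \<and> x \<in> F \<and> nrm F \<bullet> v > 0"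
proof (rule ccontr)
  assume "\<not> ?thesis"
  then have le: "nrm F \<bullet> v \<le> 0" if "F facet_of P" "x \<in> F" for F using that by force
  have "eventually (\<lambda>r. x + r *\<^sub>R v \<in> P) (at_right 0)"
  proof (rule eventually_in_P[OF x])
    have "((\<lambda>r. x + r *\<^sub>R v) \<longlongrightarrow> x + 0 *\<^sub>R v) (at_right 0)" by (intro tendsto_intros)
    then show "((\<lambda>r. x + r *\<^sub>R v) \<longlongrightarrow> x) (at_right 0)" by simp
    fix F assume F: "F facet_of P" "x \<in> F"
    have "nrm F \<bullet> x = off F" using nrm_props(3) F by blast
    then show "eventually (\<lambda>r. nrm F \<bullet> (x + r *\<^sub>R v) \<le> off F) (at_right 0)"
      using le[OF F] eventually_at_right_less[of "0::real"]
      by (auto simp: inner_simps mult_nonneg_nonpos elim!: eventually_mono)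
  qed
  then have "eventually (\<lambda>r. x + r *\<^sub>R v \<in> P \<and> r > 0) (at_right 0)"
    using eventually_at_right_less[of "0::real"] by (rule eventually_conj)
  then obtain r where "x + r *\<^sub>R v \<in> P" "r > 0"
    using eventually_happens'[OF trivial_limit_at_right_real] by blast
  then show False using out by blast
qed

text \<open>A generic backward ray from \<open>z\<close> leaves \<open>P\<close> through exactly one facet, and enters it
  through exactly one facet if it starts outside; counted with signs this gives the indicator
  function of \<open>P\<close>.\<close>

lemma indicator_cylinders:
  assumes e: "e \<noteq> 0" and z: "z \<notin> frontier P" "\<And>F. F facet_of P \<Longrightarrow> z \<notin> frontier (lines e F)"
  shows "indicator P z = (\<Sum>F | F facet_of P. - sgn (nrm F \<bullet> e) * indicator (cylinder e F) z)"
proof -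
  let ?I = "{t. z - t *\<^sub>R e \<in> P}"
  have FP: "F \<subseteq> P" if "F facet_of P" for F using that by (rule facet_of_imp_subset)
  show ?thesis
  proof (cases "?I = {}")
    case True
    then have "z \<notin> P" by (metis (mono_tags, lifting) diff_zero emptyE mem_Collect_eq scaleR_zero_left)
    moreover have "z \<notin> cylinder e F" if "F facet_of P" for F
      using True FP[OF that] by (auto simp: mem_cylinder)
    ultimately show ?thesis by simp
  next
    case False
    have cl: "closed ?I"
      using continuous_closed_vimage[OF P_props(3), of "\<lambda>t. z - t *\<^sub>R e"] by (simp add: vimage_def)
    obtain C where C: "\<And>x. x \<in> P \<Longrightarrow> norm x \<le> C"
      using P_props(1) compact_imp_bounded bounded_iff by metis
    have "\<bar>t\<bar> \<le> (C + norm z) / norm e" if "t \<in> ?I" for t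
    proof -
      have "\<bar>t\<bar> * norm e = norm (t *\<^sub>R e)" by simp
      also have "\<dots> \<le> norm (z - t *\<^sub>R e) + norm z" using norm_triangle_ineq4[of z "z - t *\<^sub>R e"] by simp
      also have "\<dots> \<le> C + norm z" using C that by simp
      finally show ?thesis using e by (simp add: field_simps)
    qed
    then have "bounded ?I" unfolding bounded_iff real_norm_def by blast
    then have cI: "compact ?I" using cl compact_eq_bounded_closed by blast
    \<comment> \<open>\<open>P\<close> meets the line through \<open>z\<close> in a compact set of
      parameters. Along the backward direction \<open>- e\<close>, \<alpha> is the parameter of
      entry and \<beta> that of exit.\<close>
    obtain \<beta> where \<beta>: "\<beta> \<in> ?I" "\<And>t. t \<in> ?I \<Longrightarrow> t \<le> \<beta>"
      using compact_attains_sup[OF cI False] by blast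
    obtain \<alpha> where \<alpha>: "\<alpha> \<in> ?I" "\<And>t. t \<in> ?I \<Longrightarrow> \<alpha> \<le> t"
      using compact_attains_inf[OF cI False] by blast
    have "z - \<beta> *\<^sub>R e + r *\<^sub>R (- e) \<notin> P" if "r > 0" for r
      using \<beta>(2)[of "\<beta> + r"] that by (auto simp: algebra_simps)
    then obtain Fb where Fb: "Fb facet_of P" "z - \<beta> *\<^sub>R e \<in> Fb" "nrm Fb \<bullet> e < 0"
      using last_point_facet[of "z - \<beta> *\<^sub>R e" "- e"] \<beta>(1) by auto
    have "z - \<alpha> *\<^sub>R e + r *\<^sub>R e \<notin> P" if "r > 0" for r
      using \<alpha>(2)[of "\<alpha> - r"] that by (auto simp: algebra_simps)
    then obtain Fa where Fa: "Fa facet_of P" "z - \<alpha> *\<^sub>R e \<in> Fa" "nrm Fa \<bullet> e > 0"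
      using last_point_facet[of "z - \<alpha> *\<^sub>R e" "e"] \<alpha>(1) by auto
    \<comment> \<open>By genericity every hit lies in the relative interior of its facet and so on
      no other facet; the sign of \<open>nrm F \<bullet> e\<close> distinguishes exit from
      entry.\<close>
    have hit: "z - t *\<^sub>R e \<in> F \<longleftrightarrow> (nrm F \<bullet> e < 0 \<and> t = \<beta> \<and> F = Fb \<or> nrm F \<bullet> e > 0 \<and> t = \<alpha> \<and> F = Fa)"
      if F: "F facet_of P" for F t
    proof
      assume h: "z - t *\<^sub>R e \<in> F"
      note g = generic_point[OF F z(2)[OF F] h]
      have t: "t \<in> ?I" using h FP[OF F] by blast
      have eq: "nrm F \<bullet> (z - t *\<^sub>R e) = off F" using h nrm_props(3)[OF F] by blast
      have "nrm F \<bullet> (z - \<beta> *\<^sub>R e) \<le> off F" "nrm F \<bullet> (z - \<alpha> *\<^sub>R e) \<le> off F"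
        using nrm_props(2)[OF F] \<alpha>(1) \<beta>(1) by blast+
      then have le: "(t - \<beta>) * (nrm F \<bullet> e) \<le> 0" "(t - \<alpha>) * (nrm F \<bullet> e) \<le> 0"
        using eq by (auto simp: inner_simps algebra_simps)
      show "nrm F \<bullet> e < 0 \<and> t = \<beta> \<and> F = Fb \<or> nrm F \<bullet> e > 0 \<and> t = \<alpha> \<and> F = Fa"
      proof (cases "nrm F \<bullet> e < 0")
        case True
        then have "t = \<beta>" using le(1) \<beta>(2)[OF t] by (simp add: mult_le_0_iff)
        then show ?thesis
          using True rel_interior_facet_unique[OF F Fb(1) g(2)] Fb(2) by simp
      next
        case False
        then have pos: "nrm F \<bullet> e > 0" using g(1) by simp
        then have "t = \<alpha>" using le(2) \<alpha>(2)[OF t] by (simp add: mult_le_0_iff)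
        then show ?thesis
          using pos rel_interior_facet_unique[OF F Fa(1) g(2)] Fa(2) by simp
      qed
    qed (use Fa Fb in auto)
    have summand: "- sgn (nrm F \<bullet> e) * indicator (cylinder e F) z 
        = (if F = Fb then of_bool (0 \<le> \<beta>) else 0) - (if F = Fa then of_bool (0 \<le> \<alpha>) else (0::real))"
      if F: "F facet_of P" for F
    proof -
      have "z \<in> cylinder e F \<longleftrightarrow> nrm F \<bullet> e < 0 \<and> 0 \<le> \<beta> \<and> F = Fb \<or> nrm F \<bullet> e > 0 \<and> 0 \<le> \<alpha> \<and> F = Fa"
        unfolding mem_cylinder hit[OF F] by blast
      then show ?thesis
        using Fa(3) Fb(3) by (auto simp: indicator_def sgn_if)
    qed
    \<comment> \<open>Otherwise \<open>z\<close> would lie on a facet. This settles the borderline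
      case of the closed condition \<open>0 \<le> \<alpha>\<close>.\<close>
    have "\<alpha> \<noteq> 0"
      using Fa(2) facet_subset_frontier(3)[OF Fa(1)] z(1) by auto
    have mem: "z \<in> P \<longleftrightarrow> \<alpha> \<le> 0 \<and> 0 \<le> \<beta>"
    proof
      assume "z \<in> P" then show "\<alpha> \<le> 0 \<and> 0 \<le> \<beta>" using \<alpha>(2)[of 0] \<beta>(2)[of 0] by simp
    next
      assume *: "\<alpha> \<le> 0 \<and> 0 \<le> \<beta>"
      then have lt: "\<beta> - \<alpha> > 0" using \<open>\<alpha> \<noteq> 0\<close> by auto
      then have one: "\<beta> / (\<beta> - \<alpha>) + - \<alpha> / (\<beta> - \<alpha>) = 1"
        by (simp add: diff_divide_distrib[symmetric])
      \<comment> \<open>\<open>z\<close> is a convex combination of the entry and the exit point,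
        the parameter 0 lying between \<alpha> and \<beta>.\<close>
      have "(\<beta> / (\<beta> - \<alpha>)) *\<^sub>R (z - \<alpha> *\<^sub>R e) + (- \<alpha> / (\<beta> - \<alpha>)) *\<^sub>R (z - \<beta> *\<^sub>R e) \<in> P"
        by (rule convexD[OF P_props(2)]) (use \<alpha>(1) \<beta>(1) * lt one in \<open>auto simp: zero_le_divide_iff divide_le_0_iff\<close>)
      also have "(\<beta> / (\<beta> - \<alpha>)) *\<^sub>R (z - \<alpha> *\<^sub>R e) + (- \<alpha> / (\<beta> - \<alpha>)) *\<^sub>R (z - \<beta> *\<^sub>R e)
          = (\<beta> / (\<beta> - \<alpha>) + - \<alpha> / (\<beta> - \<alpha>)) *\<^sub>R z"
        by (simp add: algebra_simps)
      finally show "z \<in> P" unfolding one by simp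
    qed
    have "(\<Sum>F | F facet_of P. - sgn (nrm F \<bullet> e) * indicator (cylinder e F) z)
        = (\<Sum>F | F facet_of P. (if F = Fb then of_bool (0 \<le> \<beta>) else 0) - (if F = Fa then of_bool (0 \<le> \<alpha>) else 0))"
      by (rule sum.cong[OF refl], rule summand) blast
    also have "\<dots> = of_bool (0 \<le> \<beta>) - of_bool (0 \<le> \<alpha>)"
      using Fa(1) Fb(1) by (simp add: sum_subtractf finite_facets sum.delta)
    also have "\<dots> = indicator P z"
      using mem \<alpha>(2)[OF \<beta>(1)] \<open>\<alpha> \<noteq> 0\<close> by (auto simp: indicator_def)
    finally show ?thesis by simp
  qed
qed

end

section \<open>The divergence theorem on a polytope\<close>

text \<open>The squared positive part is C1 and vanishes on a half-line; two of them, nested, give a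
  cut-off function.\<close>

lemma C1_fun_max_square: "C1_fun (\<lambda>t::real. (max 0 t)\<^sup>2)"
proof (rule C1_funI[where f'="\<lambda>t h. 2 * max 0 t * h"])
  fix t :: real
  have "((\<lambda>t. (max 0 t)\<^sup>2) has_real_derivative 2 * max 0 t) (at t)"
  proof -
    consider "t > 0" | "t < 0" | "t = 0" by linarith
    then show ?thesis
    proof cases
      case 1
      have "((\<lambda>t. t\<^sup>2) has_real_derivative 2 * t) (at t)"
        by (auto intro!: derivative_eq_intros)
      then have "((\<lambda>t. (max 0 t)\<^sup>2) has_real_derivative 2 * t) (at t)"
        by (rule has_field_derivative_transform_within_open[where S="{0<..}"]) (use 1 in \<open>auto simp: max_def\<close>)
      then show ?thesis using 1 by (simp add: max_def)
    next
      case 2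
      have "((\<lambda>t. 0) has_real_derivative 0) (at t)" by (rule DERIV_const)
      then have "((\<lambda>t. (max 0 t)\<^sup>2) has_real_derivative 0) (at t)"
        by (rule has_field_derivative_transform_within_open[where S="{..<0}"]) (use 2 in \<open>auto simp: max_def\<close>)
      then show ?thesis using 2 by (simp add: max_def)
    next
      case 3
      have "((\<lambda>h. max 0 h) \<longlongrightarrow> max 0 0) (at (0::real))" by (intro tendsto_intros)
      then have "((\<lambda>h. max 0 h) \<longlongrightarrow> 0) (at (0::real))" by simp
      then have "((\<lambda>h. (max 0 h)\<^sup>2 / h) \<longlongrightarrow> 0) (at (0::real))"
        by (rule Lim_transform_eventually) (auto simp: eventually_at_filter max_def power2_eq_square)
      then show ?thesis using 3 by (simp add: DERIV_def)
    qed
  qed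
  then show "((\<lambda>t. (max 0 t)\<^sup>2) has_derivative (\<lambda>h. 2 * max 0 t * h)) (at t)"
    by (simp only: has_field_derivative_def)
qed (intro continuous_intros)

lemma C1_cutoff:
  obtains \<eta> :: "'a::euclidean_space \<Rightarrow> real"
  where "C1_fun \<eta>" "\<And>x. norm x < r \<Longrightarrow> \<eta> x = 1" "\<And>x. norm x \<ge> r + 1 \<Longrightarrow> r \<ge> 0 \<Longrightarrow> \<eta> x = 0"
proof
  let ?k = "\<lambda>t::real. (max 0 t)\<^sup>2"
  \<comment> \<open>Inside the ball the inner square is 0 and the value 1. From radius
    \<open>r + 1\<close> on, \<open>x \<bullet> x - r\<^sup>2\<close> is at least
    \<open>2 * r + 1\<close>, so the inner square is at least 1 and the value 0.\<close>
  let ?\<eta> = "\<lambda>x::'a. ?k (1 - ?k (x \<bullet> x - r\<^sup>2))"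
  have "C1_fun (\<lambda>x::'a. x \<bullet> x + (- r\<^sup>2))"
  proof (rule C1_fun_add)
    have "(\<lambda>x::'a. x \<bullet> x) = (\<lambda>x. \<Sum>b\<in>Basis. (x \<bullet> b) * (x \<bullet> b))"
      by (rule ext) (rule euclidean_inner)
    moreover have "C1_fun (\<lambda>x::'a. \<Sum>b\<in>Basis. (x \<bullet> b) * (x \<bullet> b))"
      by (intro C1_fun_sum C1_fun_mult C1_fun_bounded_linear bounded_linear_inner_left)
    ultimately show "C1_fun (\<lambda>x::'a. x \<bullet> x)" by (simp only:)
  qed simp
  from C1_fun_compose[OF this C1_fun_max_square]
  have "C1_fun (\<lambda>x::'a. ?k (x \<bullet> x - r\<^sup>2))" by simp
  from C1_fun_add[OF C1_fun_const[of 1] C1_fun_mult[OF C1_fun_const[of "-1"] this]]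
  have "C1_fun (\<lambda>x::'a. 1 - ?k (x \<bullet> x - r\<^sup>2))" by simp
  from C1_fun_compose[OF this C1_fun_max_square] show "C1_fun ?\<eta>" .
  show "?\<eta> x = 1" if "norm x < r" for x
  proof -
    have "x \<bullet> x \<le> r\<^sup>2" using that by (simp add: dot_square_norm power_mono)
    then show ?thesis by simp
  qed
  show "?\<eta> x = 0" if "norm x \<ge> r + 1" "r \<ge> 0" for x
  proof -
    have "x \<bullet> x \<ge> (r + 1)\<^sup>2" using that by (simp add: dot_square_norm power_mono)
    then have "x \<bullet> x - r\<^sup>2 \<ge> 1" using that by (simp add: power2_eq_square algebra_simps)
    then have "?k (x \<bullet> x - r\<^sup>2) \<ge> 1" by (simp add: one_le_power)
    then show ?thesis by simp
  qed
qed

context charted_polytope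
begin

lemma coordinate_bij: "\<exists>p :: 'f option \<Rightarrow> 'd. bij p"
  using finite_same_card_bij[of "UNIV::'f option set" "UNIV::'d set"] card by (auto simp: card_UNIV_option)

text \<open>The columns of \<open>B F\<close> are independent because the chart is injective, and
  the normal is independent of them, so the bordered matrix is regular.\<close>

lemma gram_pos:
  assumes F: "F facet_of P" shows "gram F > 0"
proof -
  obtain p :: "'f option \<Rightarrow> 'd" where p: "bij p" using coordinate_bij by blast
  have "gram F \<noteq> 0"
  proof
    assume "gram F = 0"
    then have "det (bordered p (B F) (nrm F)) = 0" using abs_det_bordered_facet[OF p F, of "nrm F"] by simp
    then have "\<not> invertible (bordered p (B F) (nrm F))" using invertible_det_nz by blast
    moreover have "inj ((*v) (bordered p (B F) (nrm F)))"
    proof -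
      have "x = 0" if "bordered p (B F) (nrm F) *v x = 0" for x
      proof -
        define s where "s = (\<chi> k. x $ p (Some k))"
        define t where "t = x $ p None"
        have x: "x = join_coords p (s, t)"
          using surjD[OF bij_is_surj[OF p]] p
          by (auto simp: vec_eq_iff join_coords_def s_def t_def bij_is_inj bij_is_surj surj_f_inv_f split: option.splits)
            (metis bij_is_surj surj_f_inv_f)+
        have 0: "B F *v s + t *\<^sub>R nrm F = 0" using that bordered_join_coords[OF p] x by metis
        then have "nrm F \<bullet> (B F *v s + t *\<^sub>R nrm F) = 0" by simp
        then have "t = 0" using nrm_props(1,4)[OF F] by (auto simp: inner_add_right norm_eq_1)
        then have "B F *v s = B F *v 0" using 0 by simp
        then have "s = 0" using chart_affine(2)[OF F] by (metis injD)
        then show ?thesis using x \<open>t = 0\<close> linear_0[OF join_coords_linear] by (simp add: zero_prod_def)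
      qed
      then show ?thesis by (simp add: linear_injective_0)
    qed
    ultimately show False
      by (metis invertible_left_inverse matrix_left_invertible_injective)
  qed
  moreover have "gram F \<ge> 0"
    using abs_det_bordered_facet[OF p F, of "nrm F"] nrm_props(1)[OF F] by (simp add: norm_eq_1)
  ultimately show ?thesis by simp
qed

text \<open>Bounded support makes the far end of each cylinder contribute nothing, so the
  fundamental theorem leaves only the values on the facets.\<close>

lemma integral_directional_derivative_compact_support:
  assumes card3: "CARD('d) \<le> 3"
    and u: "C1_fun u" "\<And>x. norm x \<ge> \<rho> \<Longrightarrow> u x = (0::real)"
  shows "integral P (\<lambda>x. frechet_derivative u (at x) e)
    = (\<Sum>F | F facet_of P. (nrm F \<bullet> e) * gram F * integral (S F) (\<lambda>s. u (\<gamma> F s)))"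
proof (cases "e = 0")
  case True
  then show ?thesis
    using linear_0[OF has_derivative_linear[OF C1_fun_derivative(1)[OF u(1)]]] by simp
next
  case e: False
  let ?f = "\<lambda>x. frechet_derivative u (at x) e"
  obtain p :: "'f option \<Rightarrow> 'd" where p: "bij p" using coordinate_bij by blast
  have cf: "continuous_on X ?f" for X by (rule C1_fun_derivative(2)[OF u(1)])
  obtain C where C: "\<And>x. x \<in> P \<Longrightarrow> norm x \<le> C"
    using P_props(1) compact_imp_bounded bounded_iff by metis
  \<comment> \<open>Facet points have norm at most \<open>C\<close>, so at height \<open>R\<close>
    the cylinder has left the open ball of radius \<rho>, outside of which \<open>u\<close>
    vanishes; the maximum keeps the interval of heights nonempty.\<close>
  define R where "R = max 0 ((\<rho> + C) / norm e)"
  have R: "R \<ge> 0" "R * norm e \<ge> \<rho> + C"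
    using e by (auto simp: R_def max_def field_simps not_le)
  have f0: "?f x = 0" if "norm x > \<rho>" for x
  proof -
    have "((\<lambda>x. 0) has_derivative (\<lambda>h. 0)) (at x)" by simp
    then have "(u has_derivative (\<lambda>h. 0)) (at x)"
      by (rule has_derivative_transform_within_open[where s="{x. norm x > \<rho>}"])
        (use that u(2) in \<open>auto intro!: open_Collect_less continuous_intros\<close>)
    then show ?thesis by (simp add: frechet_derivative_at[symmetric])
  qed
  let ?cyl = "\<lambda>F. (\<lambda>(s, t). \<gamma> F 0 + B F *v s + t *\<^sub>R e) ` (S F \<times> {0..R})"
  have ccyl: "compact (?cyl F)" if "F facet_of P" for F
    using S_props(1)[OF that] unfolding case_prod_beta
    by (intro compact_continuous_image compact_Times compact_Icc continuous_intros
      continuous_on_compose2[OF matrix_vector_mult_linear_continuous_on[of UNIV]] subset_UNIV)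
  have cyl: "indicator (cylinder e F) z * ?f z = (if z \<in> ?cyl F then ?f z else 0)" if F: "F facet_of P" for F z
  proof (cases "?f z = 0")
    case False
    then have nz: "norm z \<le> \<rho>" using f0 by force
    have "z \<in> cylinder e F \<longleftrightarrow> z \<in> ?cyl F"
    proof
      assume "z \<in> cylinder e F"
      then obtain x t where x: "x \<in> F" "0 \<le> t" "z = x + t *\<^sub>R e" unfolding cylinder_def by blast
      have "t * norm e = norm (z - x)" using x by simp
      also have "\<dots> \<le> \<rho> + C"
        using norm_triangle_ineq4[of z x] nz C[of x] x(1) facet_subset_frontier(1)[OF F] by fastforce
      finally have "t * norm e \<le> R * norm e" using R(2) by linarith
      then have "t \<le> R" using e by simp
      moreover obtain s where "s \<in> S F" "x = \<gamma> F s" using chart_image[OF F] x(1) by blast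
      ultimately show "z \<in> ?cyl F"
        using x chart_affine(1)[OF F, of s] by (intro image_eqI[of _ _ "(s, t)"]) auto
    next
      assume "z \<in> ?cyl F"
      then obtain s t where "s \<in> S F" "0 \<le> t" "z = \<gamma> F 0 + B F *v s + t *\<^sub>R e"
        by auto
      moreover from this have "z = \<gamma> F s + t *\<^sub>R e" "\<gamma> F s \<in> F"
        using chart_affine(1)[OF F, of s] by (simp_all add: S_def)
      ultimately show "z \<in> cylinder e F" unfolding cylinder_def by blast
    qed
    then show ?thesis by (simp add: indicator_def)
  qed simp
  \<comment> \<open>The volume factor of the cylinder contains
    \<open>\<bar>nrm F \<bullet> e\<bar>\<close>, and the sign restores
    \<open>nrm F \<bullet> e\<close>; the minus sign comes from the facet being the lower end of the
    cylinder. For \<open>e\<close> parallel to the facet both sides are zero.\<close>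
  have int_cyl: "sgn (nrm F \<bullet> e) * integral (?cyl F) ?f = - ((nrm F \<bullet> e) * gram F * integral (S F) (\<lambda>s. u (\<gamma> F s)))"
    if F: "F facet_of P" for F
  proof (cases "nrm F \<bullet> e = 0")
    case False
    have gp: "gram F \<noteq> 0" using gram_pos[OF F] by simp
    have dn: "det (bordered p (B F) e) \<noteq> 0"
      using abs_det_bordered_facet[OF p F, of e] False gp by auto
    have inner: "integral {0..R} (\<lambda>t. ?f (\<gamma> F 0 + B F *v s + t *\<^sub>R e)) = - u (\<gamma> F s)" if s: "s \<in> S F" for s
    proof -
      let ?x = "\<gamma> F s"
      have "((\<lambda>t. u (?x + t *\<^sub>R e)) has_vector_derivative ?f (?x + t *\<^sub>R e)) (at t within {0..R})" for t
      proof -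
        have "((\<lambda>t. u (?x + t *\<^sub>R e)) has_derivative (\<lambda>h. frechet_derivative u (at (?x + t *\<^sub>R e)) (h *\<^sub>R e))) (at t)"
          by (rule has_derivative_compose[OF _ C1_fun_derivative(1)[OF u(1)]])
            (auto intro!: derivative_eq_intros)
        moreover have "frechet_derivative u (at (?x + t *\<^sub>R e)) (h *\<^sub>R e) = h *\<^sub>R ?f (?x + t *\<^sub>R e)" for h
          using C1_fun_derivative(1)[OF u(1)] has_derivative_linear linear_scale by blast
        ultimately show ?thesis
          by (simp add: has_vector_derivative_def has_derivative_at_withinI)
      qed
      then have "((\<lambda>t. ?f (?x + t *\<^sub>R e)) has_integral u (?x + R *\<^sub>R e) - u (?x + 0 *\<^sub>R e)) {0..R}"
        by (intro fundamental_theorem_of_calculus R(1))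
      moreover have "u (?x + R *\<^sub>R e) = 0"
      proof (rule u(2))
        have "?x \<in> P" using s facet_subset_frontier(1)[OF F] by (auto simp: S_def)
        then show "norm (?x + R *\<^sub>R e) \<ge> \<rho>"
          using R C[of ?x] norm_diff_ineq[of "R *\<^sub>R e" ?x] by (simp add: add.commute)
      qed
      ultimately show ?thesis
        using chart_affine(1)[OF F, of s] by (simp add: integral_unique)
    qed
    have "integral (?cyl F) ?f = \<bar>nrm F \<bullet> e\<bar> * gram F * integral (S F) (\<lambda>s. - u (\<gamma> F s))"
      using integral_cylinder[OF card3 p dn S_props(1)[OF F] cf, of "\<gamma> F 0" R] abs_det_bordered_facet[OF p F, of e]
        Henstock_Kurzweil_Integration.integral_cong[of "S F", OF inner]
      by simp
    moreover have "sgn x * \<bar>x\<bar> = x" for x :: real by (simp add: sgn_if abs_if)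
    ultimately show ?thesis by (simp flip: mult.assoc)
  qed simp
  \<comment> \<open>Exceptional set of the indicator formula. It is null because \<open>P\<close>
    and the sets \<open>lines e F\<close>, sums of a facet and a line, are convex.\<close>
  let ?N = "frontier P \<union> (\<Union>F\<in>{F. F facet_of P}. frontier (lines e F))"
  have N: "negligible ?N"
  proof -
    have "convex (lines e F)" if "F facet_of P" for F
    proof -
      have "lines e F = (\<Union>x\<in>F. \<Union>y\<in>range (\<lambda>t. t *\<^sub>R e). {x + y})" unfolding lines_def by blast
      moreover have "convex F" using that P_props(2) facet_of_imp_face_of face_of_imp_convex by blast
      moreover have "convex (range (\<lambda>t. t *\<^sub>R e))"
        by (intro convex_linear_image linearI) (auto simp: algebra_simps)
      ultimately show ?thesis using convex_sums by metis
    qed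
    then show ?thesis
      using finite_facets negligible_convex_frontier P_props(2) by (intro negligible_Un negligible_Union) auto
  qed
  have "integral P ?f = integral UNIV (\<lambda>z. if z \<in> P then ?f z else 0)"
    by (simp add: integral_restrict_UNIV)
  also have "\<dots> = integral UNIV (\<lambda>z. \<Sum>F | F facet_of P. - sgn (nrm F \<bullet> e) * (if z \<in> ?cyl F then ?f z else 0))"
  proof (rule integral_spike[OF N])
    fix z assume z: "z \<in> UNIV - ?N"
    have "(if z \<in> P then ?f z else 0) = indicator P z * ?f z" by (simp add: indicator_def)
    also have "\<dots> = (\<Sum>F | F facet_of P. - sgn (nrm F \<bullet> e) * (indicator (cylinder e F) z * ?f z))"
      using z by (subst indicator_cylinders[OF e]) (auto simp: sum_distrib_right mult.assoc)
    also have "\<dots> = (\<Sum>F | F facet_of P. - sgn (nrm F \<bullet> e) * (if z \<in> ?cyl F then ?f z else 0))"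
      by (intro sum.cong) (auto simp: cyl)
    finally show "(\<Sum>F | F facet_of P. - sgn (nrm F \<bullet> e) * (if z \<in> ?cyl F then ?f z else 0)) = (if z \<in> P then ?f z else 0)"
      by simp
  qed
  also have "\<dots> = (\<Sum>F | F facet_of P. - sgn (nrm F \<bullet> e) * integral (?cyl F) ?f)"
  proof -
    have "(\<lambda>z. if z \<in> ?cyl F then ?f z else 0) integrable_on UNIV" if F: "F facet_of P" for F
      unfolding integrable_restrict_UNIV
      by (rule integral_compact_lborel(4)[OF ccyl[OF F] cf])
    from integrable_cmul[OF this, unfolded real_scaleR_def]
    have "(\<lambda>z. - sgn (nrm F \<bullet> e) * (if z \<in> ?cyl F then ?f z else 0)) integrable_on UNIV"
      if "F facet_of P" for F using that by blast
    then show ?thesis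
      by (subst Henstock_Kurzweil_Integration.integral_sum)
        (simp_all add: finite_facets integral_restrict_UNIV del: mult_minus_left)
  qed
  also have "\<dots> = (\<Sum>F | F facet_of P. (nrm F \<bullet> e) * gram F * integral (S F) (\<lambda>s. u (\<gamma> F s)))"
    by (intro sum.cong) (auto simp: int_cyl)
  finally show ?thesis .
qed

text \<open>Both sides see \<open>u\<close> only near \<open>P\<close>, so a cut-off that equals one
  there reduces the claim to bounded support.\<close>

lemma integral_directional_derivative:
  fixes u :: "real^'d \<Rightarrow> real"
  assumes card3: "CARD('d) \<le> 3" and u: "C1_fun u"
  shows "integral P (\<lambda>x. frechet_derivative u (at x) e)
    = (\<Sum>F | F facet_of P. (nrm F \<bullet> e) * gram F * integral (S F) (\<lambda>s. u (\<gamma> F s)))"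
proof -
  obtain C where C: "\<And>x. x \<in> P \<Longrightarrow> norm x \<le> C"
    using P_props(1) compact_imp_bounded bounded_iff by metis
  \<comment> \<open>One more than a bound of \<open>P\<close>: the cut-off is then constant on an
    open set around \<open>P\<close>, and derivatives are unchanged as well.\<close>
  define r where "r = \<bar>C\<bar> + 1"
  obtain \<eta> :: "real^'d \<Rightarrow> real" where \<eta>: "C1_fun \<eta>" "\<And>x. norm x < r \<Longrightarrow> \<eta> x = 1"
    "\<And>x. norm x \<ge> r + 1 \<Longrightarrow> r \<ge> 0 \<Longrightarrow> \<eta> x = 0"
    using C1_cutoff by blast
  let ?u = "\<lambda>x. \<eta> x * u x"
  have r: "r \<ge> 0" "\<And>x. x \<in> P \<Longrightarrow> norm x < r" using C by (force simp: r_def)+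
  have "frechet_derivative ?u (at x) = frechet_derivative u (at x)" if "x \<in> P" for x
  proof -
    have "(?u has_derivative frechet_derivative u (at x)) (at x)"
      by (rule has_derivative_transform_within_open[OF C1_fun_derivative(1)[OF u], where s="{x. norm x < r}"])
        (use r that \<eta>(2) in \<open>auto intro!: open_Collect_less continuous_intros\<close>)
    then show ?thesis by (rule frechet_derivative_at[symmetric])
  qed
  then have "integral P (\<lambda>x. frechet_derivative u (at x) e) = integral P (\<lambda>x. frechet_derivative ?u (at x) e)"
    by (intro Henstock_Kurzweil_Integration.integral_cong) simp
  also have "\<dots> = (\<Sum>F | F facet_of P. (nrm F \<bullet> e) * gram F * integral (S F) (\<lambda>s. ?u (\<gamma> F s)))"
    by (rule integral_directional_derivative_compact_support[OF card3 C1_fun_mult[OF \<eta>(1) u], of "r + 1"])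
      (use \<eta>(3) r in auto)
  also have "\<dots> = (\<Sum>F | F facet_of P. (nrm F \<bullet> e) * gram F * integral (S F) (\<lambda>s. u (\<gamma> F s)))"
  proof (rule sum.cong[OF refl])
    fix F assume F: "F \<in> {F. F facet_of P}"
    have "?u (\<gamma> F s) = u (\<gamma> F s)" if "s \<in> S F" for s
      using that F facet_subset_frontier(1)[of F] r(2) \<eta>(2) by (auto simp: S_def)
    then show "(nrm F \<bullet> e) * gram F * integral (S F) (\<lambda>s. ?u (\<gamma> F s))
      = (nrm F \<bullet> e) * gram F * integral (S F) (\<lambda>s. u (\<gamma> F s))"
      by (metis (no_types, lifting) Henstock_Kurzweil_Integration.integral_cong)
  qed
  finally show ?thesis .
qed

text \<open>Sums the directional formula over the coordinates, with the \<open>i\<close>-th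
  component of \<open>v\<close> times \<psi> differentiated along the \<open>i\<close>-th axis; the
  product rule separates the two volume integrals.\<close>

theorem divergence_theorem:
  fixes v :: "real^'d \<Rightarrow> real^'d" and \<psi> :: "real^'d \<Rightarrow> real"
  assumes card3: "CARD('d) \<le> 3" and v: "C1_fun v" and \<psi>: "C1_fun \<psi>"
  shows "integral P (\<lambda>x. v x \<bullet> grad \<psi> x) =
    (\<Sum>F | F facet_of P. gram F * integral (S F) (\<lambda>s. (v (\<gamma> F s) \<bullet> nrm F) * \<psi> (\<gamma> F s)))
     - integral P (\<lambda>x. divergence v x * \<psi> x)"
proof -
  let ?u = "\<lambda>i x. v x $ i * \<psi> x"
  have vi: "C1_fun (\<lambda>x. v x $ i)" for i
    by (rule C1_fun_compose[OF v C1_fun_bounded_linear[OF bounded_linear_vec_nth]])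
  have u: "C1_fun (?u i)" for i by (rule C1_fun_mult[OF vi \<psi>])
  have der: "(\<Sum>i\<in>UNIV. frechet_derivative (?u i) (at x) (axis i 1)) = v x \<bullet> grad \<psi> x + divergence v x * \<psi> x" for x
  proof -
    have vx: "((\<lambda>x. v x $ i) has_derivative (\<lambda>h. (jacobian v (at x) *v h) $ i)) (at x)" for i
      using bounded_linear.has_derivative[OF bounded_linear_vec_nth C1_fun_jacobian(1)[OF v]] .
    have "frechet_derivative (?u i) (at x) (axis i 1) 
        = v x $ i * grad \<psi> x $ i + jacobian v (at x) $ i $ i * \<psi> x" for i
    proof -
      have "(?u i has_derivative (\<lambda>h. v x $ i * frechet_derivative \<psi> (at x) h + (jacobian v (at x) *v h) $ i * \<psi> x)) (at x)"
        by (rule has_derivative_mult[OF vx C1_fun_derivative(1)[OF \<psi>]])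
      from frechet_derivative_at[OF this, symmetric]
      show ?thesis
        by (simp add: frechet_derivative_grad(1)[OF \<psi>] inner_axis matrix_vector_mul_component)
    qed
    then show ?thesis
      by (simp add: sum.distrib inner_vec_def divergence_def trace_def sum_distrib_right)
  qed
  have cP: "f integrable_on P" if "continuous_on P f" for f :: "real^'d \<Rightarrow> real"
    by (rule integral_compact_lborel(4)[OF P_props(1) that])
  have cdiv: "continuous_on P (divergence v)"
    unfolding divergence_def trace_def using C1_fun_jacobian(3)[OF v] by (intro continuous_intros)
  have "integral P (\<lambda>x. v x \<bullet> grad \<psi> x) + integral P (\<lambda>x. divergence v x * \<psi> x)
      = integral P (\<lambda>x. \<Sum>i\<in>UNIV. frechet_derivative (?u i) (at x) (axis i 1))"
    unfolding der
    by (intro Henstock_Kurzweil_Integration.integral_add[symmetric] cP continuous_intros cdiv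
        C1_fun_continuous v \<psi> frechet_derivative_grad(2))
  also have "\<dots> = (\<Sum>i\<in>UNIV. integral P (\<lambda>x. frechet_derivative (?u i) (at x) (axis i 1)))"
    by (intro Henstock_Kurzweil_Integration.integral_sum cP C1_fun_derivative(2) u) auto
  also have "\<dots> = (\<Sum>i\<in>UNIV. \<Sum>F | F facet_of P. nrm F $ i * gram F * integral (S F) (\<lambda>s. ?u i (\<gamma> F s)))"
    by (simp add: integral_directional_derivative[OF card3 u] inner_axis)
  also have "\<dots> = (\<Sum>F | F facet_of P. \<Sum>i\<in>UNIV. nrm F $ i * gram F * integral (S F) (\<lambda>s. ?u i (\<gamma> F s)))"
    by (rule sum.swap)
  also have "\<dots> = (\<Sum>F | F facet_of P. gram F * integral (S F) (\<lambda>s. (v (\<gamma> F s) \<bullet> nrm F) * \<psi> (\<gamma> F s)))"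
  proof (rule sum.cong[OF refl])
    fix F assume F: "F \<in> {F. F facet_of P}"
    have int: "(\<lambda>s. ?u i (\<gamma> F s)) integrable_on S F" for i
    proof -
      have "continuous_on (S F) (\<lambda>s. ?u i (\<gamma> F s))"
        using F by (intro continuous_on_compose2[OF C1_fun_continuous[OF u, of UNIV] chart_continuous]) auto
      with F show ?thesis
        by (intro integral_compact_lborel(4) S_props(1)) auto
    qed
    have "integral (S F) (\<lambda>s. (v (\<gamma> F s) \<bullet> nrm F) * \<psi> (\<gamma> F s)) = integral (S F) (\<lambda>s. \<Sum>i\<in>UNIV. nrm F $ i * ?u i (\<gamma> F s))"
      by (simp add: inner_vec_def sum_distrib_right sum_distrib_left mult_ac)
    also have "\<dots> = (\<Sum>i\<in>UNIV. nrm F $ i * integral (S F) (\<lambda>s. ?u i (\<gamma> F s)))"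
      by (subst Henstock_Kurzweil_Integration.integral_sum) (auto intro!: integrable_cmul[OF int, unfolded real_scaleR_def])
    finally show "(\<Sum>i\<in>UNIV. nrm F $ i * gram F * integral (S F) (\<lambda>s. ?u i (\<gamma> F s)))
       = gram F * integral (S F) (\<lambda>s. (v (\<gamma> F s) \<bullet> nrm F) * \<psi> (\<gamma> F s))"
      by (simp add: sum_distrib_left mult_ac)
  qed
  finally show ?thesis by simp
qed

end

section \<open>Cells and shared facets\<close>

text \<open>A kernel vector would move a point inside a ball of \<open>X\<close> without changing
  its image. This supplies the injectivity of the identifications between reference faces, which the
  mesh definition does not state.\<close>

lemma affine_inj_on_interior:
  fixes A :: "'a::euclidean_space \<Rightarrow> 'b::real_vector"
  assumes A: "linear A" and X: "interior X \<noteq> {}" and inj: "inj_on (\<lambda>x. c + A x) X"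
  shows "inj A"
proof -
  have "h = 0" if "A h = 0" for h
  proof -
    obtain x r where r: "r > 0" "cball x r \<subseteq> X"
      using X mem_interior_cball by blast
    define t where "t = r / (1 + norm h)"
    have t: "t > 0" "norm (t *\<^sub>R h) \<le> r"
      using r by (auto simp: t_def divide_simps algebra_simps add_pos_nonneg)
    then have "x \<in> X" "x + t *\<^sub>R h \<in> X" using r by (auto simp: dist_norm subset_iff)
    moreover have "c + A (x + t *\<^sub>R h) = c + A x"
      using that by (simp add: linear_add[OF A] linear_scale[OF A])
    ultimately have "x + t *\<^sub>R h = x" using inj_onD[OF inj] by blast
    then show ?thesis using t by simp
  qed
  then show ?thesis using linear_injective_0[OF A] by blast
qed

lemma conforming_meshD:
  fixes M :: "('d::finite, 'f::finite) mesh"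
  assumes "conforming_mesh M"
  shows "CARD('d) = CARD('f) + 1"
    and "F facet_of ref_cell M \<Longrightarrow> \<exists>L b. linear L \<and> inj L \<and> chart M F = (\<lambda>s. b + L s) \<and> F \<subseteq> range (chart M F)"
    and "open (domain M)" "finite (cells M)" "\<Union>(cells M) = closure (domain M)"
    and "K \<in> cells M \<Longrightarrow> interior K \<subseteq> domain M"
    and "polytope (ref_cell M)" "interior (ref_cell M) \<noteq> {}"
    and "K \<in> cells M \<Longrightarrow> polynomial_function (geo M K)"
    and "K \<in> cells M \<Longrightarrow> inj_on (geo M K) (ref_cell M)"
    and "K \<in> cells M \<Longrightarrow> y \<in> ref_cell M \<Longrightarrow> det (jacobian (geo M K) (at y)) \<noteq> 0"
    and "K \<in> cells M \<Longrightarrow> geo M K ` ref_cell M = K"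
    and "K \<in> cells M \<Longrightarrow> K' \<in> cells M \<Longrightarrow> K \<noteq> K' \<Longrightarrow>
        \<exists>E L b. E face_of ref_cell M \<and> linear L \<and> (\<lambda>x. b + L x) ` E face_of ref_cell M \<and>
          K \<inter> K' = geo M K ` E \<and> (\<forall>x\<in>E. geo M K x = geo M K' (b + L x))"
proof -
  have shape: "simplicial M \<or> box_shaped M"
    using assms unfolding conforming_mesh_def by blast
  then show "polytope (ref_cell M)"
    unfolding simplicial_def box_shaped_def using simplex_imp_polytope polytope_interval by metis
  have "interior (ref_cell M) \<noteq> {}" if "simplicial M"
  proof -
    have s: "int CARD('d) simplex ref_cell M" using that by (simp add: simplicial_def)
    then have "aff_dim (ref_cell M) = int (DIM(real^'d))" by (simp add: aff_dim_simplex)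
    then have "rel_interior (ref_cell M) = interior (ref_cell M)" by (rule interior_rel_interior)
    moreover have "ref_cell M \<noteq> {}" using s by auto
    ultimately show ?thesis using convex_simplex[OF s] rel_interior_eq_empty by metis
  qed
  moreover have "interior (ref_cell M) \<noteq> {}" if "box_shaped M"
    using that by (auto simp: box_shaped_def)
  ultimately show "interior (ref_cell M) \<noteq> {}" using shape by blast
  show "polynomial_function (geo M K)" if "K \<in> cells M"
  proof -
    have "(\<exists>k. geo M K \<in> Pk k) \<or> (\<exists>k. geo M K \<in> Qk k)"
      using assms that unfolding conforming_mesh_def by fast
    then show ?thesis
      unfolding Pk_def Qk_def using poly_maps_polynomial_function by blast
  qed
  show "K \<in> cells M \<Longrightarrow> K' \<in> cells M \<Longrightarrow> K \<noteq> K' \<Longrightarrow>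
        \<exists>E L b. E face_of ref_cell M \<and> linear L \<and> (\<lambda>x. b + L x) ` E face_of ref_cell M \<and>
          K \<inter> K' = geo M K ` E \<and> (\<forall>x\<in>E. geo M K x = geo M K' (b + L x))"
    using assms unfolding conforming_mesh_def Let_def by blast
qed (use assms in \<open>auto simp: conforming_mesh_def C1_diffeo_on_def\<close>)

locale mesh_ctx =
  fixes M :: "('d::finite, 'f::finite) mesh"
  assumes conf: "conforming_mesh M" and dim: "CARD('d) = 2 \<or> CARD('d) = 3"
begin

sublocale charted_polytope "ref_cell M" "chart M"
  using conforming_meshD[OF conf] by unfold_locales auto

abbreviation "P \<equiv> ref_cell M"
abbreviation "J K y \<equiv> jacobian (geo M K) (at y)"

definition X :: "(real^'d) set \<Rightarrow> (real^'d) set \<Rightarrow> real^'f \<Rightarrow> real^'d" where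
  "X K F s = geo M K (chart M F s)"

lemma card3: "CARD('d) \<le> 3" "CARD('f) \<le> 3"
  using dim card by auto

lemma geo_C1: "K \<in> cells M \<Longrightarrow> C1_fun (geo M K)"
  using conforming_meshD(9)[OF conf] C1_fun_polynomial by blast

lemmas geo_inj = conforming_meshD(10)[OF conf]
lemmas det_J = conforming_meshD(11)[OF conf]
lemmas geo_image = conforming_meshD(12)[OF conf]

lemma geo_eq_iff: "K \<in> cells M \<Longrightarrow> y \<in> P \<Longrightarrow> z \<in> P \<Longrightarrow> geo M K y = geo M K z \<longleftrightarrow> y = z"
  using geo_inj by (auto simp: inj_on_def)

lemma compact_cell: "K \<in> cells M \<Longrightarrow> compact K"
  using geo_image compact_continuous_image[OF C1_fun_continuous[OF geo_C1] P_props(1)] by metis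

lemma geo_interior:
  assumes "K \<in> cells M"
  shows "open (geo M K ` interior P)" "geo M K ` interior P \<subseteq> interior K"
proof -
  show o: "open (geo M K ` interior P)"
    by (rule invariance_of_domain_gen)
      (use assms geo_inj interior_subset in \<open>auto intro: C1_fun_continuous geo_C1 inj_on_subset\<close>)
  then show "geo M K ` interior P \<subseteq> interior K"
    using geo_image[OF assms] interior_subset by (intro interior_maximal) blast+
qed

lemma negligible_geo_image:
  assumes "K \<in> cells M" "negligible N" shows "negligible (geo M K ` N)"
  by (rule negligible_differentiable_image_negligible[OF _ assms(2)])
    (use C1_fun_differentiable[OF geo_C1[OF assms(1)]] in \<open>auto simp: differentiable_on_def intro: differentiable_at_withinI\<close>)

lemma negligible_frontier_P: "negligible (frontier P)"
  by (rule negligible_convex_frontier[OF P_props(2)])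

text \<open>Interior points of the reference cell go to interior points of \<open>K\<close>, so the
  boundary of \<open>K\<close> is covered by the differentiable image of a null set.\<close>

lemma negligible_frontier_cell:
  assumes K: "K \<in> cells M" shows "negligible (frontier K)"
proof (rule negligible_subset[OF negligible_geo_image[OF K negligible_frontier_P]])
  show "frontier K \<subseteq> geo M K ` frontier P"
  proof
    fix x assume x: "x \<in> frontier K"
    then have "x \<in> K" "x \<notin> interior K"
      using compact_imp_closed[OF compact_cell[OF K]] by (auto simp: frontier_def)
    then obtain y where "y \<in> P" "x = geo M K y" using geo_image[OF K] by blast
    moreover have "y \<notin> interior P" using calculation \<open>x \<notin> interior K\<close> geo_interior(2)[OF K] by blast
    ultimately show "x \<in> geo M K ` frontier P"
      using P_props(3) by (auto simp: frontier_def)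
  qed
qed

text \<open>Adds that the common face is proper: otherwise \<tau> would be injective and map
  \<open>P\<close> onto a face of full dimension, hence onto \<open>P\<close>, and the two cells
  would coincide.\<close>

lemma cell_intersection:
  assumes K: "K \<in> cells M" "K' \<in> cells M" "K \<noteq> K'"
  obtains E L b where "E face_of P" "E \<noteq> P" "linear L" "(\<lambda>x. b + L x) ` E face_of P"
    "K \<inter> K' = geo M K ` E" "\<And>x. x \<in> E \<Longrightarrow> geo M K x = geo M K' (b + L x)"
proof -
  obtain E L b where E: "E face_of P" "linear L" "(\<lambda>x. b + L x) ` E face_of P"
    "K \<inter> K' = geo M K ` E" "\<And>x. x \<in> E \<Longrightarrow> geo M K x = geo M K' (b + L x)"
    using conforming_meshD(13)[OF conf K] by metis
  have "E \<noteq> P"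
  proof
    assume EP: "E = P"
    let ?\<tau> = "\<lambda>x. b + L x"
    have "inj_on ?\<tau> P"
      using E(5) geo_eq_iff[OF K(1)] by (intro inj_onI) (metis EP)
    then have inj: "inj L"
      by (rule affine_inj_on_interior[OF E(2) interior_nonempty])
    have "?\<tau> ` P = (+) b ` L ` P" by (simp add: image_image)
    then have "aff_dim (?\<tau> ` P) = aff_dim P"
      by (simp only: aff_dim_translation_eq aff_dim_injective_linear_image[OF E(2) inj])
    then have "?\<tau> ` P = P"
      using face_of_aff_dim_lt[OF P_props(2)] E(3) EP by force
    then have "geo M K ` P = geo M K' ` P"
      using E(5) EP by (metis (mono_tags, lifting) image_cong image_image)
    then show False using geo_image K by metis
  qed
  then show thesis using E that by blast
qed

lemma negligible_cell_Int:
  assumes K: "K \<in> cells M" "K' \<in> cells M" "K \<noteq> K'"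
  shows "negligible (K \<inter> K')"
proof -
  obtain E where E: "E face_of P" "E \<noteq> P" "K \<inter> K' = geo M K ` E"
    using cell_intersection[OF K] by metis
  have "E \<subseteq> frontier P"
    using E face_of_disjoint_interior[OF E(1,2)] face_of_imp_subset[OF E(1)] P_props(3)
    by (auto simp: frontier_def)
  then show ?thesis
    using E(3) negligible_geo_image[OF K(1)] negligible_subset[OF negligible_frontier_P] by auto
qed

section \<open>Parametrised facets and their transition maps\<close>

lemma X_C1: "K \<in> cells M \<Longrightarrow> F facet_of P \<Longrightarrow> C1_fun (X K F)"
proof -
  assume K: "K \<in> cells M" and F: "F facet_of P"
  have "C1_fun (chart M F)"
    by (subst chart_eq[OF F], intro C1_fun_add C1_fun_const C1_fun_bounded_linear matrix_vector_mul_bounded_linear)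
  from C1_fun_compose[OF this geo_C1[OF K]] show ?thesis by (simp add: X_def[abs_def])
qed

lemma chart_in_F: "s \<in> S F \<Longrightarrow> chart M F s \<in> F"
  by (simp add: S_def)

lemma chart_in_P: "F facet_of P \<Longrightarrow> s \<in> S F \<Longrightarrow> chart M F s \<in> P"
  using facet_subset_frontier(1) chart_in_F by blast

lemma X_inj: "K \<in> cells M \<Longrightarrow> F facet_of P \<Longrightarrow> inj_on (X K F) (S F)"
  unfolding X_def using geo_eq_iff chart_in_P chart_inj by (auto simp: inj_on_def dest: injD)

lemma X_image: "F facet_of P \<Longrightarrow> X K F ` S F = facet M K F"
  using chart_image by (simp add: facet_def X_def image_image[symmetric])

lemma jacobian_X:
  assumes "K \<in> cells M" "F facet_of P"
  shows "jacobian (X K F) (at s) = J K (chart M F s) ** B F"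
proof -
  have "(chart M F has_derivative (*v) (B F)) (at s)"
    by (subst chart_eq[OF assms(2)]) (auto intro!: derivative_eq_intros bounded_linear_imp_has_derivative)
  from diff_chain_at[OF this C1_fun_jacobian(1)[OF geo_C1[OF assms(1)]]]
  have "(X K F has_derivative (\<lambda>h. (J K (chart M F s) ** B F) *v h)) (at s)"
    by (simp add: o_def X_def[abs_def] matrix_vector_mul_assoc)
  from frechet_derivative_at[OF this, symmetric] show ?thesis
    by (simp add: jacobian_def matrix_of_matrix_vector_mul)
qed

text \<open>Change of parameters between two descriptions of the same curved facet. It is affine, so
  its Jacobian determinant is a constant.\<close>

definition transition :: "(real^'d) set \<Rightarrow> (real^'d) set \<Rightarrow> (real^'d) set \<Rightarrow> (real^'d) set \<Rightarrow> real^'f \<Rightarrow> real^'f^'f \<Rightarrow> bool" where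
  "transition K F K' F' c A \<longleftrightarrow> det A \<noteq> 0 \<and> (\<lambda>s. c + A *v s) ` S F = S F' \<and>
     (\<forall>s\<in>interior (S F). c + A *v s \<in> interior (S F')) \<and>
     (\<forall>s\<in>S F. X K F s = X K' F' (c + A *v s))"

text \<open>The common face of the two cells contains a relative interior point of \<open>F\<close>,
  hence all of \<open>F\<close>; being proper, it equals \<open>F\<close>. The change of parameters
  is \<tau> read in the two charts.\<close>

lemma adjacent:
  assumes K: "K \<in> cells M" "K' \<in> cells M" "K \<noteq> K'" and F: "F facet_of P"
    and s: "s \<in> interior (S F)" "X K F s \<in> K'"
  shows "\<exists>F' c A. F' facet_of P \<and> transition K F K' F' c A \<and> K \<inter> K' = facet M K F \<and>
    facet M K F = facet M K' F'"
proof -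
  obtain E L b where E: "E face_of P" "E \<noteq> P" "linear L" "(\<lambda>x. b + L x) ` E face_of P"
    "K \<inter> K' = geo M K ` E" "\<And>x. x \<in> E \<Longrightarrow> geo M K x = geo M K' (b + L x)"
    using cell_intersection[OF K] by metis
  let ?\<gamma> = "chart M F" and ?\<tau> = "\<lambda>x. b + L x"
  have sS: "s \<in> S F" using s(1) interior_subset by blast
  have "X K F s \<in> K" using chart_in_P[OF F sS] geo_image[OF K(1)] by (auto simp: X_def)
  then obtain y where "y \<in> E" "geo M K (?\<gamma> s) = geo M K y"
    using s(2) E(5) by (auto simp: X_def)
  then have yE: "?\<gamma> s \<in> E"
    using geo_eq_iff[OF K(1) chart_in_P[OF F sS]] face_of_imp_subset[OF E(1)] by blast
  have "?\<gamma> s \<in> rel_interior F" using S_props(6)[OF F] s(1) by blast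
  then have "F \<subseteq> E"
    using subset_of_face_of[OF E(1), of F] yE facet_of_imp_subset[OF F] by blast
  then have "F face_of E"
    using F E(1) face_of_imp_subset facet_of_imp_face_of face_of_subset by metis
  moreover have "aff_dim E < aff_dim P" using face_of_aff_dim_lt P_props(2) E(1,2) by blast
  moreover have "aff_dim F = aff_dim P - 1" using F by (simp add: facet_of_def)
  ultimately have EF: "E = F"
    using face_of_aff_dim_lt[of E F] face_of_imp_convex[OF E(1)] by force
  define F' where "F' = ?\<tau> ` F"
  have Xeq: "X K F s = geo M K' (?\<tau> (?\<gamma> s))" if "s \<in> S F" for s
    using E(6) EF chart_in_F[OF that] by (simp add: X_def)
  \<comment> \<open>On \<open>F\<close> the map \<tau> inherits injectivity from
    \<open>geo M K\<close>, since equal images under \<tau> are the same point of the mesh; so the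
    dimension of the face is preserved.\<close>
  have F'f: "F' facet_of P"
  proof -
    have lin: "linear (\<lambda>s. L (B F *v s))"
      using linear_compose[OF matrix_vector_mul_linear E(3)] by (simp add: o_def)
    have eq: "?\<tau> (?\<gamma> s) = (b + L (?\<gamma> 0)) + L (B F *v s)" for s
      using chart_affine(1)[OF F, of s] by (simp add: linear_add[OF E(3)])
    have "inj_on (\<lambda>s. (b + L (?\<gamma> 0)) + L (B F *v s)) (S F)"
    proof (rule inj_onI)
      fix s t assume st: "s \<in> S F" "t \<in> S F" "(b + L (?\<gamma> 0)) + L (B F *v s) = (b + L (?\<gamma> 0)) + L (B F *v t)"
      then have "?\<tau> (?\<gamma> s) = ?\<tau> (?\<gamma> t)" using eq[of s] eq[of t] by simp
      then have "X K F s = X K F t" using Xeq st(1,2) by simp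
      then show "s = t" using X_inj[OF K(1) F] st(1,2) by (simp add: inj_on_eq_iff)
    qed
    then have inj: "inj (\<lambda>s. L (B F *v s))"
      by (rule affine_inj_on_interior[OF lin S_props(3)[OF F]])
    have "F' = ?\<tau> ` ?\<gamma> ` S F" using chart_image[OF F] by (simp add: F'_def)
    then have "F' = (+) (b + L (?\<gamma> 0)) ` (\<lambda>s. L (B F *v s)) ` S F"
      unfolding image_image using eq by (metis (no_types, lifting) image_cong)
    then have "aff_dim F' = aff_dim (S F)"
      by (simp only: aff_dim_translation_eq aff_dim_injective_linear_image[OF lin inj])
    also have "\<dots> = int CARD('f)"
      using aff_dim_nonempty_interior[OF S_props(3)[OF F]] by simp
    finally show ?thesis
      using E(4) EF F P_props(5) card unfolding facet_of_def F'_def by auto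
  qed
  \<comment> \<open>A left inverse of the linear part of the chart of \<open>F'\<close>, used to
    express \<tau> in chart coordinates.\<close>
  obtain G where G: "linear G" "\<And>s. G (B F' *v s) = s"
    using linear_injective_left_inverse[OF matrix_vector_mul_linear chart_affine(2)[OF F'f]]
    by (metis comp_apply id_apply)
  define A where "A = matrix (\<lambda>s. G (L (B F *v s)))"
  define c where "c = G (?\<tau> (?\<gamma> 0) - chart M F' 0)"
  have Av: "A *v s = G (L (B F *v s))" for s
  proof -
    have "linear (\<lambda>s. G (L (B F *v s)))"
      using linear_compose[OF linear_compose[OF matrix_vector_mul_linear E(3)] G(1)] by (simp add: o_def)
    then show ?thesis unfolding A_def by simp
  qed
  have \<sigma>: "c + A *v s = G (?\<tau> (?\<gamma> s) - chart M F' 0)" for s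
  proof -
    have "?\<tau> (?\<gamma> s) - chart M F' 0 = (?\<tau> (?\<gamma> 0) - chart M F' 0) + L (B F *v s)"
      using chart_affine(1)[OF F, of s] by (simp add: linear_add[OF E(3)])
    then show ?thesis by (simp only: c_def Av linear_add[OF G(1)])
  qed
  have \<sigma>1: "c + A *v s = t" if "chart M F' t = ?\<tau> (?\<gamma> s)" for s t
    unfolding \<sigma> that[symmetric] using chart_affine(1)[OF F'f, of t] by (simp add: G(2))
  have \<sigma>2: "c + A *v s \<in> S F'" "chart M F' (c + A *v s) = ?\<tau> (?\<gamma> s)" if "s \<in> S F" for s
  proof -
    have "?\<tau> (?\<gamma> s) \<in> F'" using chart_in_F[OF that] by (simp add: F'_def)
    then obtain t where "t \<in> S F'" "chart M F' t = ?\<tau> (?\<gamma> s)" using chart_image[OF F'f] by (metis imageE)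
    then show "c + A *v s \<in> S F'" "chart M F' (c + A *v s) = ?\<tau> (?\<gamma> s)" using \<sigma>1 by auto
  qed
  have img: "(\<lambda>s. c + A *v s) ` S F = S F'"
  proof (intro equalityI subsetI)
    fix t assume "t \<in> S F'"
    then have "chart M F' t \<in> ?\<tau> ` ?\<gamma> ` S F"
      using chart_in_F[of t F'] chart_image[OF F] by (simp add: F'_def)
    then obtain s where "s \<in> S F" "chart M F' t = ?\<tau> (?\<gamma> s)" by blast
    then show "t \<in> (\<lambda>s. c + A *v s) ` S F" using \<sigma>1 by (metis imageI)
  qed (use \<sigma>2 in auto)
  have XX: "X K F s = X K' F' (c + A *v s)" if "s \<in> S F" for s
    using \<sigma>2(2)[OF that] Xeq[OF that] by (simp add: X_def)
  have "inj_on (\<lambda>s. c + A *v s) (S F)"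
  proof (rule inj_onI)
    fix s t assume st: "s \<in> S F" "t \<in> S F" "c + A *v s = c + A *v t"
    then have "X K F s = X K F t" using XX by simp
    then show "s = t" using X_inj[OF K(1) F] st(1,2) by (simp add: inj_on_eq_iff)
  qed
  then have injA: "inj ((*v) A)"
    by (rule affine_inj_on_interior[OF matrix_vector_mul_linear S_props(3)[OF F]])
  then have "det A \<noteq> 0"
    using det_nz_iff_inj[OF matrix_vector_mul_linear, of A] by (simp add: matrix_of_matrix_vector_mul)
  moreover have "c + A *v s \<in> interior (S F')" if "s \<in> interior (S F)" for s
  proof -
    have "interior (S F') = interior ((+) c ` (*v) A ` S F)"
      by (simp add: img[symmetric] image_image)
    also have "\<dots> = (+) c ` (*v) A ` interior (S F)"
      by (simp only: interior_translation interior_injective_linear_image[OF matrix_vector_mul_linear injA])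
    finally show ?thesis using that by auto
  qed
  ultimately have tr: "transition K F K' F' c A"
    using img XX unfolding transition_def by blast
  have "facet M K F = facet M K' F'"
    using E(6) EF unfolding facet_def F'_def image_image by (intro image_cong) auto
  moreover have "K \<inter> K' = facet M K F" using E(5) EF by (simp add: facet_def)
  ultimately show ?thesis using F'f tr by blast
qed

lemma facet_eq_same_cell:
  assumes "K \<in> cells M" "F facet_of P" "F' facet_of P" "facet M K F = facet M K F'"
  shows "F = F'"
  using assms inj_on_image_eq_iff[OF geo_inj[OF assms(1)]] facet_of_imp_subset by (metis facet_def)

text \<open>Relative interiors of distinct mesh facets are disjoint. This is what lets a function
  supported on one facet count as zero on the others.\<close>

lemma facet_interior_unique:
  assumes K: "K \<in> cells M" "K1 \<in> cells M" and F: "F facet_of P" "F1 facet_of P"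
    and s: "s \<in> interior (S F)" "X K F s \<in> facet M K1 F1"
  shows "facet M K1 F1 = facet M K F"
proof (cases "K1 = K")
  case True
  have sS: "s \<in> S F" using s(1) interior_subset by blast
  then have "chart M F s \<in> F1"
    using s(2) geo_eq_iff[OF K(1)] True facet_of_imp_subset[OF F(2)] chart_in_P[OF F(1)] by (auto simp: X_def facet_def)
  then have "F1 = F"
    using rel_interior_facet_unique[OF F(1,2)] S_props(6)[OF F(1)] s(1) by blast
  then show ?thesis using True by simp
next
  case False
  have "X K F s \<in> K1" using s(2) geo_image[OF K(2)] facet_of_imp_subset[OF F(2)] by (auto simp: facet_def)
  then obtain F' c A where F': "F' facet_of P" "transition K F K1 F' c A" "facet M K F = facet M K1 F'"
    using adjacent[OF K(1,2) False[symmetric] F(1) s(1) \<open>X K F s \<in> K1\<close>] by blast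
  let ?t = "c + A *v s"
  have t: "?t \<in> interior (S F')" "X K F s = X K1 F' ?t"
    using F'(2) s(1) interior_subset unfolding transition_def by blast+
  obtain y where y: "y \<in> F1" "X K F s = geo M K1 y" using s(2) by (auto simp: facet_def)
  have "geo M K1 (chart M F' ?t) = geo M K1 y" using t(2) y(2) by (simp add: X_def)
  moreover have "chart M F' ?t \<in> P" using chart_in_P[OF F'(1)] t(1) interior_subset by blast
  moreover have "y \<in> P" using y(1) facet_of_imp_subset[OF F(2)] by blast
  ultimately have "chart M F' ?t \<in> F1" using geo_eq_iff[OF K(2)] y(1) by blast
  then have "F1 = F'"
    using rel_interior_facet_unique[OF F'(1) F(2)] S_props(6)[OF F'(1)] t(1) by blast
  then show ?thesis using F'(3) by simp
qed

lemma transition_exists: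
  assumes K: "K \<in> cells M" "K' \<in> cells M" and F: "F facet_of P" "F' facet_of P"
    and eq: "facet M K F = facet M K' F'"
  shows "\<exists>c A. transition K F K' F' c A" and "K \<noteq> K' \<Longrightarrow> K \<inter> K' = facet M K F"
proof -
  obtain s where s: "s \<in> interior (S F)" using S_props(3)[OF F(1)] by blast
  have *: "(\<exists>c A. transition K F K' F' c A) \<and> K \<inter> K' = facet M K F" if "K \<noteq> K'"
  proof -
    have "X K F s \<in> facet M K' F'" using s X_image[OF F(1)] eq interior_subset by blast
    then have "X K F s \<in> K'" using geo_image[OF K(2)] facet_of_imp_subset[OF F(2)] by (auto simp: facet_def)
    then obtain F1 c A where F1: "F1 facet_of P" "transition K F K' F1 c A" "K \<inter> K' = facet M K F"
      "facet M K F = facet M K' F1"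
      using adjacent[OF K \<open>K \<noteq> K'\<close> F(1) s] by blast
    have "F1 = F'" by (rule facet_eq_same_cell[OF K(2) F1(1) F(2) trans[OF F1(4)[symmetric] eq]])
    then show ?thesis using F1 by blast
  qed
  then show "K \<noteq> K' \<Longrightarrow> K \<inter> K' = facet M K F" by blast
  show "\<exists>c A. transition K F K' F' c A"
  proof (cases "K = K'")
    case True
    then have "F' = F" using facet_eq_same_cell[OF K(1) F] eq by simp
    then have "transition K F K' F' 0 (mat 1)"
      using True by (simp add: transition_def)
    then show ?thesis by blast
  qed (use * in blast)
qed

end

section \<open>Normals of curved facets\<close>

lemma inner_matrix_transpose:
  fixes A :: "real^'n^'m" shows "x \<bullet> (A *v h) = (transpose A *v x) \<bullet> h"
  by (simp add: dot_lmul_matrix[symmetric])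

lemma matrix_inv_inverse:
  fixes A :: "real^'n^'n"
  assumes "det A \<noteq> 0"
  shows "A ** matrix_inv A = mat 1" "matrix_inv A ** A = mat 1"
proof -
  have "\<exists>A'. A ** A' = mat 1 \<and> A' ** A = mat 1"
    using assms invertible_det_nz unfolding invertible_def by blast
  from someI_ex[OF this] show "A ** matrix_inv A = mat 1" "matrix_inv A ** A = mat 1"
    unfolding matrix_inv_def by blast+
qed

lemma continuous_on_det:
  fixes A :: "'a::topological_space \<Rightarrow> real^'n^'n"
  assumes "\<And>i j. continuous_on X (\<lambda>x. A x $ i $ j)"
  shows "continuous_on X (\<lambda>x. det (A x))"
  unfolding det_def by (intro continuous_intros assms)

text \<open>The inverse function theorem in terms of Jacobian matrices; it applies at boundary
  points of the reference cell too, because geometric maps are C1 on the whole space.\<close>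

lemma C1_local_inverse:
  fixes f :: "real^'d \<Rightarrow> real^'d"
  assumes f: "C1_fun f" and det: "det (jacobian f (at y)) \<noteq> 0"
  obtains U g g' where "open U" "f y \<in> U" "\<And>z. z \<in> U \<Longrightarrow> f (g z) = z" "g (f y) = y"
    "(g has_derivative g') (at (f y))" "\<And>h. jacobian f (at y) *v g' h = h"
proof -
  let ?f' = "\<lambda>x. Blinfun ((*v) (jacobian f (at x)))"
  let ?J = "jacobian f (at y)"
  have app: "blinfun_apply (Blinfun ((*v) A)) = (*v) A" for A :: "real^'d^'d"
    by (rule bounded_linear_Blinfun_apply) (rule matrix_vector_mul_bounded_linear)
  have cf: "continuous_on UNIV ?f'"
    by (rule continuous_on_blinfun_componentwise)
      (simp add: app C1_fun_jacobian(2)[OF f, symmetric] C1_fun_derivative(2)[OF f])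
  have inv: "Blinfun ((*v) (matrix_inv ?J)) o\<^sub>L ?f' y = id_blinfun"
    using det by (intro blinfun_eqI) (simp add: app matrix_vector_mul_assoc matrix_inv_inverse)
  have der: "(f has_derivative blinfun_apply (?f' x)) (at x)" for x
    using C1_fun_jacobian(1)[OF f] app by simp
  show thesis
  proof (rule inverse_function_theorem[OF open_UNIV der cf UNIV_I inv])
    fix U' V g g'
    assume U': "y \<in> U'" and V: "open V" "f y \<in> V" and h: "homeomorphism U' V f g"
      and g: "\<And>z. z \<in> V \<Longrightarrow> (g has_derivative (g' z)) (at z)"
      "\<And>z. z \<in> V \<Longrightarrow> g' z = inv (blinfun_apply (?f' (g z)))"
      "\<And>z. z \<in> V \<Longrightarrow> bij (blinfun_apply (?f' (g z)))"
    have gy: "g (f y) = y" using h U' by (simp add: homeomorphism_def)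
    have "?J *v g' (f y) h = h" for h
      using g(2,3)[OF V(2)] gy by (simp add: app bij_is_surj surj_f_inv_f)
    then show thesis
      using V h gy g(1)[OF V(2)] by (intro that[of V g "g' (f y)"]) (auto simp: homeomorphism_def)
  qed
qed

context mesh_ctx
begin

lemma facet_off: "F facet_of P \<Longrightarrow> y \<in> F \<Longrightarrow> nrm F \<bullet> y = off F"
  using nrm_props(3) by blast

text \<open>The solution of \<open>transpose (J K y) *v m = nrm F\<close> by Cramer's rule, an
  outward normal of the curved cell before normalisation. The explicit quotient of determinants
  makes its continuity evident.\<close>

definition conormal :: "(real^'d) set \<Rightarrow> (real^'d) set \<Rightarrow> real^'d \<Rightarrow> real^'d" where
  "conormal K F y = (\<chi> k. det (\<chi> i j. if j = k then nrm F $ i else transpose (J K y) $ i $ j) / det (J K y))"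

lemma conormal_iff:
  assumes "K \<in> cells M" "y \<in> P"
  shows "transpose (J K y) *v m = r *\<^sub>R nrm F \<longleftrightarrow> m = r *\<^sub>R conormal K F y"
proof -
  have inv: "invertible (transpose (J K y))"
    using det_J[OF assms] by (simp add: invertible_det_nz)
  have c: "transpose (J K y) *v conormal K F y = nrm F"
    using cramer[of "transpose (J K y)" "conormal K F y" "nrm F"] det_J[OF assms] by (simp add: conormal_def)
  then have "transpose (J K y) *v (r *\<^sub>R conormal K F y) = r *\<^sub>R nrm F"
    by (simp add: matrix_vector_mult_scaleR)
  then show ?thesis
    using inj_matrix_vector_mult[OF inv] by (metis injD)
qed

lemma continuous_J:
  assumes "K \<in> cells M"
  shows "continuous_on Y (\<lambda>y. J K y $ i $ j)" "continuous_on Y (\<lambda>y. det (J K y))"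
proof -
  show "continuous_on Y (\<lambda>y. J K y $ i $ j)" for i j
    using C1_fun_jacobian(3)[OF geo_C1[OF assms], of Y] by (intro continuous_intros)
  then show "continuous_on Y (\<lambda>y. det (J K y))" by (rule continuous_on_det)
qed

lemma continuous_conormal:
  assumes K: "K \<in> cells M" shows "continuous_on P (conormal K F)"
proof -
  have c': "continuous_on P (\<lambda>y. if j = k then a else transpose (J K y) $ i $ j)" for i j k :: 'd and a
    using continuous_J(1)[OF K] by (cases "j = k") (auto simp: Finite_Cartesian_Product.transpose_def)
  have "continuous_on P (\<lambda>y. det (\<chi> i j. if j = k then nrm F $ i else transpose (J K y) $ i $ j))" for k
    by (rule continuous_on_det) (simp add: c')
  then show ?thesis
    unfolding conormal_def using det_J[OF K] continuous_J(2)[OF K] by (intro continuous_on_vec_lambda continuous_on_divide) auto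
qed

text \<open>Moving the Jacobian to the other side of the inner product turns the conditions on a
  normal of the curved facet into those on a normal of the flat one, where
  \<open>normal_unique\<close> applies.\<close>

lemma normal_eq:
  assumes K: "K \<in> cells M" and F: "F facet_of P" and y: "y \<in> F"
  shows "normal M K F (geo M K y) = (1 / norm (conormal K F y)) *\<^sub>R conormal K F y"
    and "norm (conormal K F y) > 0"
    and "transpose (J K y) *v normal M K F (geo M K y) = (1 / norm (conormal K F y)) *\<^sub>R nrm F"
    and "norm (normal M K F (geo M K y)) = 1"
proof -
  let ?m = "conormal K F y" and ?J = "J K y"
  let ?n = "(1 / norm ?m) *\<^sub>R ?m"
  have yP: "y \<in> P" using y facet_of_imp_subset[OF F] by blast
  have Jm: "transpose ?J *v ?m = nrm F" using conormal_iff[OF K yP, of ?m 1 F] by simp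
  have m0: "?m \<noteq> 0"
    using Jm nrm_props(1)[OF F] by auto
  then show mp: "norm ?m > 0" by simp
  have Jn: "transpose ?J *v ?n = (1 / norm ?m) *\<^sub>R nrm F"
    using conormal_iff[OF K yP] by blast
  have n1: "norm ?n = 1" using m0 by simp
  have iv: "inv_into F (geo M K) (geo M K y) = y"
    using geo_inj[OF K] facet_of_imp_subset[OF F] y by (intro inv_into_f_f) (auto intro: inj_on_subset)
  have nF: "nrm F \<bullet> (z - y) = 0" if "z \<in> F" for z
    using facet_off[OF F] that y by (simp add: inner_diff_right)
  have nP: "nrm F \<bullet> (z - y) \<le> 0" if "z \<in> P" for z
    using nrm_props(2)[OF F] facet_off[OF F y] that by (auto simp: inner_diff_right)
  have "normal M K F (geo M K y) = ?n"
    unfolding normal_def iv Let_def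
  proof (rule the_equality)
    show "norm ?n = 1 \<and> (\<forall>z\<in>F. ?n \<bullet> (?J *v (z - y)) = 0) \<and> (\<forall>z\<in>P. ?n \<bullet> (?J *v (z - y)) \<le> 0)"
      using n1 nF nP mp unfolding inner_matrix_transpose Jn by (auto simp: divide_le_0_iff)
    fix n assume n: "norm n = 1 \<and> (\<forall>z\<in>F. n \<bullet> (?J *v (z - y)) = 0) \<and> (\<forall>z\<in>P. n \<bullet> (?J *v (z - y)) \<le> 0)"
    define r where "r = norm (transpose ?J *v n)"
    have "transpose ?J *v n = r *\<^sub>R nrm F"
      unfolding r_def
      by (rule normal_unique[OF F y nrm_props(1)[OF F] nF nP]) (use n in \<open>auto simp: inner_matrix_transpose\<close>)
    then have nr: "n = r *\<^sub>R ?m" using conormal_iff[OF K yP] by blast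
    have "r \<ge> 0" by (simp add: r_def)
    then have "r * norm ?m = 1" using n nr by simp
    then have "r = 1 / norm ?m" using mp by (simp add: field_simps)
    then show "n = ?n" using nr by simp
  qed
  then show "normal M K F (geo M K y) = ?n" "transpose ?J *v normal M K F (geo M K y) = (1 / norm ?m) *\<^sub>R nrm F"
    "norm (normal M K F (geo M K y)) = 1"
    using Jn n1 by simp_all
qed

definition surf :: "(real^'d) set \<Rightarrow> (real^'d) set \<Rightarrow> real^'f \<Rightarrow> real" where
  "surf K F s = sqrt (det (transpose (jacobian (X K F) (at s)) ** jacobian (X K F) (at s)))"

text \<open>Nanson's formula for surface elements. It results from computing the volume over the
  curved tangent plane bordered by the unit normal in two ways.\<close>

lemma surf_eq:
  assumes K: "K \<in> cells M" and F: "F facet_of P" and s: "s \<in> S F"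
  shows "surf K F s = \<bar>det (J K (chart M F s))\<bar> * norm (conormal K F (chart M F s)) * gram F"
    and "surf K F s > 0"
proof -
  let ?y = "chart M F s"
  let ?J = "J K ?y" and ?m = "conormal K F ?y"
  define n where "n = normal M K F (geo M K ?y)"
  note ne = normal_eq[OF K F chart_in_F[OF s], folded n_def]
  obtain p :: "'f option \<Rightarrow> 'd" where p: "bij p" using coordinate_bij by blast
  have d: "det ?J \<noteq> 0" by (rule det_J[OF K chart_in_P[OF F s]])
  have nB: "transpose (?J ** B F) *v n = 0"
  proof -
    have "(transpose (?J ** B F) *v n) \<bullet> h = 0" for h
    proof -
      have "(transpose (?J ** B F) *v n) \<bullet> h = n \<bullet> (?J *v (B F *v h))"
        unfolding inner_matrix_transpose[symmetric] by (simp add: matrix_vector_mul_assoc)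
      also have "\<dots> = 0" unfolding inner_matrix_transpose[of n ?J] ne(3) by (simp add: nrm_props(4)[OF F])
      finally show ?thesis .
    qed
    then show ?thesis by (metis inner_eq_zero_iff)
  qed
  \<comment> \<open>The unit normal pulled back to the reference cell. Its tangential part does not
    affect the determinant, and its normal part turns out to be \<open>norm ?m\<close>.\<close>
  define u where "u = matrix_inv ?J *v n"
  have u: "?J *v u = n"
    using d by (simp add: u_def matrix_vector_mul_assoc matrix_inv_inverse)
  have "nrm F \<bullet> (u - (nrm F \<bullet> u) *\<^sub>R nrm F) = 0"
    using nrm_props(1)[OF F] by (simp add: inner_diff_right norm_eq_1)
  then obtain t where "B F *v t = u - (nrm F \<bullet> u) *\<^sub>R nrm F"
    using nrm_props(5)[OF F] by force
  then have "u = B F *v t + (nrm F \<bullet> u) *\<^sub>R nrm F" by simp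
  then have "n = ?J *v (B F *v t + (nrm F \<bullet> u) *\<^sub>R nrm F)" using u by simp
  then have n: "n = (?J ** B F) *v t + (nrm F \<bullet> u) *\<^sub>R (?J *v nrm F)"
    by (simp add: matrix_vector_right_distrib matrix_vector_mul_assoc matrix_vector_mult_scaleR)
  have "n \<bullet> n = 1" using ne(4) by (simp add: norm_eq_1)
  also have "n \<bullet> n = n \<bullet> (?J *v u)" using u by simp
  also have "\<dots> = (nrm F \<bullet> u) / norm ?m"
    unfolding inner_matrix_transpose[of n ?J] ne(3) by simp
  finally have nu: "nrm F \<bullet> u = norm ?m" using ne(2) by (simp add: field_simps)
  have "surf K F s = \<bar>det (bordered p (?J ** B F) n)\<bar>"
    using abs_det_bordered_unit[OF p nB ne(4)] by (simp add: surf_def jacobian_X[OF K F])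
  also have "det (bordered p (?J ** B F) n) = norm ?m * det (?J ** bordered p (B F) (nrm F))"
    by (subst n) (simp only: det_bordered_add[OF p] nu matrix_mul_bordered)
  finally show eq: "surf K F s = \<bar>det ?J\<bar> * norm ?m * gram F"
    using abs_det_bordered_facet[OF p F, of "nrm F"] nrm_props(1)[OF F] by (simp add: det_mul abs_mult norm_eq_1)
  show "surf K F s > 0"
    unfolding eq using d ne(2) gram_pos[OF F] by simp
qed

text \<open>In the product, the length of the conormal cancels against the normalisation of the
  normal, and \<open>\<bar>det J\<bar>\<close> against the Piola factor \<open>1 / det J\<close> up
  to sign.\<close>

lemma normal_flux:
  assumes K: "K \<in> cells M" and F: "F facet_of P" and s: "s \<in> S F"
    and w: "w = (1 / det (J K (chart M F s))) *\<^sub>R (J K (chart M F s) *v u)"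
  shows "surf K F s * (w \<bullet> normal M K F (X K F s)) = sgn (det (J K (chart M F s))) * gram F * (u \<bullet> nrm F)"
proof -
  let ?y = "chart M F s"
  let ?J = "J K ?y" and ?m = "conormal K F ?y"
  define n where "n = normal M K F (geo M K ?y)"
  note ne = normal_eq[OF K F chart_in_F[OF s], folded n_def]
  have d: "det ?J \<noteq> 0" by (rule det_J[OF K chart_in_P[OF F s]])
  have "w \<bullet> n = (1 / det ?J) * (n \<bullet> (?J *v u))" by (simp add: w inner_commute)
  also have "\<dots> = (1 / det ?J) * ((u \<bullet> nrm F) / norm ?m)"
    unfolding inner_matrix_transpose[of n ?J] ne(3) by (simp add: inner_commute)
  finally show ?thesis
    using d ne(2) unfolding X_def n_def[symmetric] surf_eq(1)[OF K F s]
    by (simp add: sgn_if abs_if field_simps)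
qed

text \<open>The two parametrisations are known to agree only on \<open>S F\<close>; at interior
  points that is a neighbourhood, so derivatives can be compared.\<close>

lemma jacobian_transition:
  assumes K: "K \<in> cells M" "K' \<in> cells M" and F: "F facet_of P" "F' facet_of P"
    and tr: "transition K F K' F' c A" and s: "s \<in> interior (S F)"
  shows "jacobian (X K F) (at s) = jacobian (X K' F') (at (c + A *v s)) ** A"
    and "surf K F s = \<bar>det A\<bar> * surf K' F' (c + A *v s)"
proof -
  have "((\<lambda>s. c + A *v s) has_derivative (*v) A) (at s)"
    by (auto intro!: derivative_eq_intros bounded_linear_imp_has_derivative)
  from diff_chain_at[OF this C1_fun_jacobian(1)[OF X_C1[OF K(2) F(2)]]]
  have "((\<lambda>s. X K' F' (c + A *v s)) has_derivative (\<lambda>h. (jacobian (X K' F') (at (c + A *v s)) ** A) *v h)) (at s)"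
    by (simp add: o_def matrix_vector_mul_assoc)
  then have "(X K F has_derivative (\<lambda>h. (jacobian (X K' F') (at (c + A *v s)) ** A) *v h)) (at s)"
  proof (rule has_derivative_transform_within_open[OF _ open_interior s])
    fix x assume "x \<in> interior (S F)"
    then have "x \<in> S F" using interior_subset by blast
    then have "X K F x = X K' F' (c + A *v x)" using tr by (simp add: transition_def)
    then show "X K' F' (c + A *v x) = X K F x" by simp
  qed
  from frechet_derivative_at[OF this, symmetric]
  show J: "jacobian (X K F) (at s) = jacobian (X K' F') (at (c + A *v s)) ** A"
    by (simp add: jacobian_def matrix_of_matrix_vector_mul)
  show "surf K F s = \<bar>det A\<bar> * surf K' F' (c + A *v s)"
  proof -
    let ?C = "jacobian (X K' F') (at (c + A *v s))"
    have "transpose (?C ** A) ** (?C ** A) = transpose A ** (transpose ?C ** ?C) ** A"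
      by (simp add: matrix_transpose_mul matrix_mul_assoc)
    then have "det (transpose (?C ** A) ** (?C ** A)) = (det A)\<^sup>2 * det (transpose ?C ** ?C)"
      by (simp add: det_mul power2_eq_square)
    then show ?thesis by (simp add: surf_def J real_sqrt_mult)
  qed
qed

text \<open>If the two unit normals agreed, a point slightly inside \<open>K\<close> along the normal would also be
  slightly inside \<open>K'\<close>, although the cells meet only in the common facet.\<close>

lemma opposite_normals:
  assumes K: "K \<in> cells M" "K' \<in> cells M" "K \<noteq> K'" and F: "F facet_of P" "F' facet_of P"
    and eq: "facet M K F = facet M K' F'" and s: "s \<in> interior (S F)"
  shows "normal M K' F' (X K F s) = - normal M K F (X K F s)"
proof -
  obtain c A where tr: "transition K F K' F' c A"
    using transition_exists(1)[OF K(1,2) F eq] by blast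
  let ?t = "c + A *v s"
  let ?y = "chart M F s" and ?y' = "chart M F' ?t"
  let ?J = "J K ?y" and ?J' = "J K' ?y'"
  have sS: "s \<in> S F" and ti: "?t \<in> interior (S F')" and tS: "?t \<in> S F'"
    using s tr interior_subset unfolding transition_def by blast+
  have XX: "geo M K ?y = geo M K' ?y'" "X K F s = geo M K ?y" "X K F s = geo M K' ?y'"
    using tr sS by (auto simp: transition_def X_def)
  have yF: "?y \<in> F" "?y' \<in> F'" using chart_in_F sS tS by blast+
  have yP: "?y \<in> P" "?y' \<in> P" using chart_in_P F sS tS by blast+
  have yr: "?y \<in> rel_interior F" "?y' \<in> rel_interior F'"
    using S_props(6) F s ti by blast+
  define n n' where "n = normal M K F (geo M K ?y)" "n' = normal M K' F' (geo M K' ?y')"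
  note ne = normal_eq[OF K(1) F(1) yF(1), folded n_n'_def]
  note ne' = normal_eq[OF K(2) F(2) yF(2), folded n_n'_def]
  define \<mu> \<mu>' where "\<mu> = 1 / norm (conormal K F ?y)" "\<mu>' = 1 / norm (conormal K' F' ?y')"
  have \<mu>: "\<mu> > 0" "\<mu>' > 0" using ne(2) ne'(2) by (simp_all add: \<mu>_\<mu>'_def)
  have DX: "?J ** B F = (?J' ** B F') ** A"
    using jacobian_transition(1)[OF K(1,2) F tr s] jacobian_X K F by simp
  \<comment> \<open>Both parametrisations have the same tangent space, so \<open>n'\<close> is
    orthogonal to the facet seen from \<open>K\<close> as well and hence a multiple of
    \<open>n\<close>.\<close>
  have "(transpose ?J *v n') \<bullet> (B F *v h) = 0" for h
  proof -
    have "(transpose ?J *v n') \<bullet> (B F *v h) = n' \<bullet> ((?J ** B F) *v h)"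
      unfolding inner_matrix_transpose[symmetric] by (simp add: matrix_vector_mul_assoc)
    also have "\<dots> = n' \<bullet> (?J' *v (B F' *v (A *v h)))"
      by (simp add: DX matrix_vector_mul_assoc matrix_mul_assoc)
    also have "\<dots> = 0"
      unfolding inner_matrix_transpose[of n' ?J'] ne'(3) by (simp add: nrm_props(4)[OF F(2)])
    finally show ?thesis .
  qed
  then have "transpose ?J *v n' = ((transpose ?J *v n') \<bullet> nrm F) *\<^sub>R nrm F"
    by (intro parallel_normal[OF F(1)] nrm_props(1,4) F(1))
  then have "n' = ((transpose ?J *v n') \<bullet> nrm F) *\<^sub>R conormal K F ?y"
    using conormal_iff[OF K(1) yP(1)] by blast
  moreover have "conormal K F ?y = norm (conormal K F ?y) *\<^sub>R n"
    using ne(1,2) by simp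
  ultimately have "n' = (((transpose ?J *v n') \<bullet> nrm F) * norm (conormal K F ?y)) *\<^sub>R n"
    by (metis scaleR_scaleR)
  then obtain r where r: "n' = r *\<^sub>R n" by blast
  then have "\<bar>r\<bar> = 1" using ne(4) ne'(4) by simp
  moreover have "r \<noteq> 1"
  proof
    assume "r = 1"
    then have nn: "n' = n" using r by simp
    \<comment> \<open>\<open>g\<close> gives the reference coordinates with respect to
      \<open>K'\<close> of all points near the facet point, also of those outside
      \<open>K'\<close>.\<close>
    obtain U g g' where g: "open U" "geo M K' ?y' \<in> U" "\<And>z. z \<in> U \<Longrightarrow> geo M K' (g z) = z"
      "g (geo M K' ?y') = ?y'" "(g has_derivative g') (at (geo M K' ?y'))" "\<And>h. ?J' *v g' h = h"
      by (rule C1_local_inverse[OF geo_C1[OF K(2)] det_J[OF K(2) yP(2)]]) blast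
    \<comment> \<open>\<open>?l\<close> enters the reference cell of \<open>K\<close> along the
      inner normal; \<open>?q\<close> follows the same physical point in the reference coordinates
      of \<open>K'\<close>.\<close>
    let ?l = "\<lambda>e::real. ?y - e *\<^sub>R nrm F"
    let ?f = "\<lambda>e. geo M K (?l e)"
    let ?q = "\<lambda>e. g (?f e)"
    have q0: "?q 0 = ?y'" using g(4) XX by simp
    have lf: "((\<lambda>e. ?l e) has_derivative (\<lambda>h. - h *\<^sub>R nrm F)) (at 0)"
      by (auto intro!: derivative_eq_intros)
    have df: "(?f has_derivative (\<lambda>h. ?J *v (- h *\<^sub>R nrm F))) (at 0)"
      using has_derivative_compose[OF lf] C1_fun_jacobian(1)[OF geo_C1[OF K(1)], of "?l 0"] by simp
    have dq: "(?q has_derivative (\<lambda>h. g' (?J *v (- h *\<^sub>R nrm F)))) (at 0)"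
      by (rule has_derivative_compose[OF df]) (use g(5) XX(1) in simp)
    define D where "D = g' (?J *v (- nrm F))"
    \<comment> \<open>The value is negative: with equal normals, \<open>?q\<close> moves to the
      inner side of \<open>F'\<close>.\<close>
    have D: "nrm F' \<bullet> D = - \<mu> / \<mu>'"
    proof -
      have "\<mu>' * (nrm F' \<bullet> D) = (transpose ?J' *v n') \<bullet> D" unfolding ne'(3) by (simp add: \<mu>_\<mu>'_def)
      also have "\<dots> = n' \<bullet> (?J' *v D)" by (rule inner_matrix_transpose[symmetric])
      also have "\<dots> = n \<bullet> (?J *v (- nrm F))" by (simp add: D_def g(6) nn)
      also have "\<dots> = \<mu> * (nrm F \<bullet> (- nrm F))"
        unfolding inner_matrix_transpose[of n ?J] ne(3) by (simp add: \<mu>_\<mu>'_def)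
      also have "\<dots> = - \<mu>" using nrm_props(1)[OF F(1)] by (simp add: norm_eq_1)
      finally show ?thesis using \<mu> by (simp add: field_simps)
    qed
    have "linear g'" using g(5) has_derivative_linear by blast
    have lin: "g' (?J *v (- h *\<^sub>R nrm F)) = h *\<^sub>R D" for h
    proof -
      have "- h *\<^sub>R nrm F = h *\<^sub>R (- nrm F)" by simp
      then show ?thesis
        by (simp only: D_def matrix_vector_mult_scaleR linear_scale[OF \<open>linear g'\<close>])
    qed
    have "((\<lambda>e. nrm F' \<bullet> ?q e) has_real_derivative (- \<mu> / \<mu>')) (at 0)"
    proof -
      have "((\<lambda>e. nrm F' \<bullet> ?q e) has_derivative (\<lambda>h. h * (nrm F' \<bullet> D))) (at 0)"
        using has_derivative_inner_right[OF dq, of "nrm F'"] unfolding lin inner_scaleR_right .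
      then show ?thesis unfolding D has_field_derivative_def mult_commute_abs .
    qed
    then obtain d where d: "d > 0" "\<And>h. h > 0 \<Longrightarrow> h < d \<Longrightarrow> nrm F' \<bullet> ?q (0 + h) < nrm F' \<bullet> ?q 0"
      using DERIV_neg_dec_right[of "\<lambda>e. nrm F' \<bullet> ?q e" "- \<mu> / \<mu>'" 0] \<mu> by (auto simp: divide_neg_pos)
    have off': "nrm F' \<bullet> ?y' = off F'" "nrm F \<bullet> ?y = off F"
      using nrm_props(6) F by blast+
    have pos: "eventually (\<lambda>e. e > 0 \<and> e < d) (at_right (0::real))"
      using d(1) by (auto simp: eventually_at_right)
    have "eventually (\<lambda>e. ?q e \<in> P) (at_right 0)"
    proof (rule eventually_in_P[OF yP(2)])
      have "isCont ?q 0" using dq has_derivative_continuous by blast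
      then show "(?q \<longlongrightarrow> ?y') (at_right 0)"
        unfolding isCont_def q0 by (simp add: filterlim_at_split)
      fix F'' assume "F'' facet_of P" "?y' \<in> F''"
      then have F'': "F'' = F'" using rel_interior_facet_unique[OF F(2) _ yr(2)] by blast
      show "eventually (\<lambda>e. nrm F'' \<bullet> ?q e \<le> off F'') (at_right 0)"
        using pos
      proof eventually_elim
        case (elim e)
        then show ?case using d(2)[of e] q0 off'(1) F'' by simp
      qed
    qed
    moreover have "eventually (\<lambda>e. ?l e \<in> P) (at_right 0)"
    proof (rule eventually_in_P[OF yP(1)])
      have "(?l \<longlongrightarrow> ?y - 0 *\<^sub>R nrm F) (at_right 0)" by (intro tendsto_intros)
      then show "(?l \<longlongrightarrow> ?y) (at_right 0)" by simp
      fix F'' assume "F'' facet_of P" "?y \<in> F''"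
      then have F'': "F'' = F" using rel_interior_facet_unique[OF F(1) _ yr(1)] by blast
      have "nrm F \<bullet> ?l e \<le> off F" if "e > 0" for e
        using that off'(2) nrm_props(1)[OF F(1)] by (simp add: inner_diff_right norm_eq_1)
      then show "eventually (\<lambda>e. nrm F'' \<bullet> ?l e \<le> off F'') (at_right 0)"
        using pos unfolding F'' by (auto elim!: eventually_mono)
    qed
    moreover have "eventually (\<lambda>e. ?f e \<in> U) (at_right 0)"
    proof -
      have "isCont ?f 0" using df has_derivative_continuous by blast
      then have "(?f \<longlongrightarrow> geo M K ?y) (at_right 0)" 
        by (simp add: isCont_def filterlim_at_split)
      then show ?thesis using g(1,2) XX(1) by (simp add: topological_tendstoD)
    qed
    ultimately have "eventually (\<lambda>e. ?q e \<in> P \<and> ?l e \<in> P \<and> ?f e \<in> U \<and> e > 0) (at_right 0)"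
      using pos by eventually_elim auto
    then obtain e where e: "?q e \<in> P" "?l e \<in> P" "?f e \<in> U" "e > 0"
      using eventually_happens'[OF trivial_limit_at_right_real] by blast
    have "?f e \<in> K" using e(2) geo_image[OF K(1)] by blast
    moreover have "?f e \<in> K'" using e(1) g(3)[OF e(3)] geo_image[OF K(2)] by (metis imageI)
    ultimately have "?f e \<in> facet M K F" using transition_exists(2)[OF K(1,2) F eq K(3)] by blast
    then have "?l e \<in> F"
      using geo_eq_iff[OF K(1) e(2)] facet_of_imp_subset[OF F(1)] by (auto simp: facet_def)
    then have "nrm F \<bullet> ?l e = off F" using nrm_props(3)[OF F(1)] by blast
    then show False
      using off'(2) nrm_props(1)[OF F(1)] e(4) by (simp add: inner_diff_right norm_eq_1)
  qed
  ultimately have "n' = - n" using r by (auto simp: abs_if split: if_splits)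
  then show ?thesis unfolding n_n'_def XX(2)[symmetric] XX(3)[symmetric] .
qed

end

section \<open>Facet integrals and traces\<close>

text \<open>A continuous injection on a compact set has a continuous inverse, so continuity may be
  tested after pulling back to the reference cell.\<close>

lemma continuous_on_image_compact:
  fixes g :: "'a::t2_space \<Rightarrow> 'b::t2_space"
  assumes "compact C" "continuous_on C g" "inj_on g C" "continuous_on C (\<lambda>x. f (g x))"
  shows "continuous_on (g ` C) f"
proof -
  have "continuous_on (g ` C) (inv_into C g)"
    by (rule continuous_on_inv[OF assms(2,1)]) (simp add: assms(3))
  then have "continuous_on (g ` C) (\<lambda>y. f (g (inv_into C g y)))"
    by (intro continuous_on_compose2[OF assms(4)]) (auto simp: inv_into_into)
  then show ?thesis
    by (rule continuous_on_eq) (simp add: f_inv_into_f)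
qed

text \<open>A nonzero difference would persist on a nonempty open set, which is not null; density of
  the interior extends equality to the boundary. Hence the boundary values of a continuous
  representative are determined.\<close>

lemma continuous_AE_eq_imp_eq:
  fixes f g :: "'a::euclidean_space \<Rightarrow> 'b::real_normed_vector"
  assumes K: "K \<in> sets lebesgue" "K \<subseteq> closure (interior K)"
    and fg: "continuous_on K f" "continuous_on K g" "AE x in lebesgue_on K. f x = g x" and x: "x \<in> K"
  shows "f x = g x"
proof -
  let ?h = "\<lambda>x. f x - g x"
  have ch: "continuous_on K ?h" by (intro continuous_intros fg)
  have "?h y = 0" if "y \<in> interior K" for y
  proof (rule ccontr)
    assume y: "?h y \<noteq> 0"
    let ?U = "{x \<in> interior K. ?h x \<noteq> 0}"
    have "open ?U"
    proof -
      have "open (?h -` (- {0}) \<inter> interior K)"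
        using continuous_on_subset[OF ch interior_subset] by (simp add: continuous_on_open_vimage open_Compl)
      moreover have "?h -` (- {0}) \<inter> interior K = ?U" by auto
      ultimately show ?thesis by simp
    qed
    moreover have "?U \<noteq> {}" using that y by blast
    moreover have "negligible ?U"
    proof -
      have "AE x in lebesgue. x \<in> K \<longrightarrow> f x = g x"
        using fg(3) K(1) by (simp add: AE_restrict_space_iff)
      then obtain N where N: "{x \<in> space lebesgue. \<not> (x \<in> K \<longrightarrow> f x = g x)} \<subseteq> N"
        "emeasure lebesgue N = 0" "N \<in> sets lebesgue"
        by (rule AE_E)
      then have "negligible N" by (auto simp: negligible_iff_null_sets)
      moreover have "?U \<subseteq> N" using N(1) interior_subset by auto
      ultimately show ?thesis by (rule negligible_subset)
    qed
    ultimately show False using open_not_negligible by blast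
  qed
  moreover have "continuous_on (closure (interior K) \<inter> K) ?h" using ch continuous_on_subset by blast
  ultimately have "?h x = 0"
  proof -
    have "x \<in> closure (interior K)" using K(2) x by blast
    then obtain X where X: "\<And>n. X n \<in> interior K" "X \<longlonglongrightarrow> x"
      using closure_sequential by blast
    then have "(\<lambda>n. ?h (X n)) \<longlonglongrightarrow> ?h x"
      using ch x interior_subset by (intro continuous_on_tendsto_compose[OF ch X(2) x]) (auto intro!: always_eventually)
    moreover have "(\<lambda>n. ?h (X n)) = (\<lambda>n. 0)"
      using X(1) \<open>\<And>y. y \<in> interior K \<Longrightarrow> ?h y = 0\<close> by auto
    ultimately show ?thesis using LIMSEQ_unique tendsto_const by metis
  qed
  then show ?thesis by simp
qed

context mesh_ctx
begin

section \<open>Surface integrals over curved facets\<close>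

lemma X_continuous: "K \<in> cells M \<Longrightarrow> F facet_of P \<Longrightarrow> continuous_on Y (X K F)"
  by (rule C1_fun_continuous[OF X_C1])

lemma compact_facet: "K \<in> cells M \<Longrightarrow> F facet_of P \<Longrightarrow> compact (facet M K F)"
  using compact_continuous_image[OF X_continuous S_props(1)] X_image by metis

lemma continuous_surf: "K \<in> cells M \<Longrightarrow> F facet_of P \<Longrightarrow> continuous_on Y (surf K F)"
proof -
  assume *: "K \<in> cells M" "F facet_of P"
  have "continuous_on Y (\<lambda>s. jacobian (X K F) (at s))" by (rule C1_fun_jacobian(3)[OF X_C1[OF *]])
  then have c: "continuous_on Y (\<lambda>s. jacobian (X K F) (at s) $ i $ j)" for i j by (intro continuous_intros)
  show ?thesis
    unfolding surf_def
    by (intro continuous_on_real_sqrt continuous_on_det)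
      (auto simp: matrix_matrix_mult_def Finite_Cartesian_Product.transpose_def intro!: continuous_intros c)
qed

lemma facet_measure_eq:
  assumes F: "F facet_of P"
  shows "facet_measure M K F = distr (density (restrict_space lborel (S F)) (\<lambda>s. ennreal (surf K F s)))
    (restrict_space borel (facet M K F)) (X K F)"
proof -
  have "geo M K \<circ> chart M F = X K F" by (simp add: fun_eq_iff X_def)
  then show ?thesis
    using X_image[OF F] by (simp add: facet_measure_def surface_measure_def surf_def S_def[symmetric])
qed

lemma S_borel: "F facet_of P \<Longrightarrow> S F \<in> sets borel"
  by (intro borel_closed compact_imp_closed S_props(1))

lemma surface_measurable:
  assumes K: "K \<in> cells M" and F: "F facet_of P"
  shows "X K F \<in> measurable (density (restrict_space lborel (S F)) (\<lambda>s. ennreal (surf K F s))) (restrict_space borel (facet M K F))"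
    and "surf K F \<in> borel_measurable (restrict_space lborel (S F))"
proof -
  have "X K F \<in> borel_measurable (restrict_space lborel (S F))"
    using borel_measurable_continuous_onI[OF X_continuous[OF K F]] by (intro measurable_restrict_space1) simp
  then show "X K F \<in> measurable (density (restrict_space lborel (S F)) (\<lambda>s. ennreal (surf K F s))) (restrict_space borel (facet M K F))"
    using X_image[OF F] by (intro measurable_restrict_space2) (auto simp: space_restrict_space)
  show "surf K F \<in> borel_measurable (restrict_space lborel (S F))"
    using borel_measurable_continuous_onI[OF continuous_surf[OF K F]] by (intro measurable_restrict_space1) simp
qed

lemma AE_surf_nonneg: "K \<in> cells M \<Longrightarrow> F facet_of P \<Longrightarrow> AE s in restrict_space lborel (S F). 0 \<le> surf K F s"
  using surf_eq(2) by (intro AE_I2) (force simp: space_restrict_space)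

lemma facet_integral:
  fixes f :: "real^'d \<Rightarrow> real"
  assumes K: "K \<in> cells M" and F: "F facet_of P" and f: "f \<in> borel_measurable (restrict_space borel (facet M K F))"
  shows "(LINT x|facet_measure M K F. f x) = (LINT s:S F|lborel. surf K F s * f (X K F s))"
    and "integrable (facet_measure M K F) f \<longleftrightarrow> set_integrable lborel (S F) (\<lambda>s. surf K F s * f (X K F s))"
proof -
  note m = surface_measurable[OF K F]
  have fX: "(\<lambda>s. f (X K F s)) \<in> borel_measurable (restrict_space lborel (S F))"
    using measurable_compose[OF m(1) f] by simp
  have "(LINT x|facet_measure M K F. f x) 
      = (LINT s|density (restrict_space lborel (S F)) (\<lambda>s. ennreal (surf K F s)). f (X K F s))"
    unfolding facet_measure_eq[OF F] by (rule integral_distr[OF m(1) f])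
  also have "\<dots> = (LINT s|restrict_space lborel (S F). surf K F s *\<^sub>R f (X K F s))"
    by (rule integral_density[OF fX m(2) AE_surf_nonneg[OF K F]])
  also have "\<dots> = (LINT s:S F|lborel. surf K F s * f (X K F s))"
    using S_borel[OF F] by (simp add: integral_restrict_space set_lebesgue_integral_def)
  finally show "(LINT x|facet_measure M K F. f x) = (LINT s:S F|lborel. surf K F s * f (X K F s))" .
  have "integrable (facet_measure M K F) f 
      \<longleftrightarrow> integrable (density (restrict_space lborel (S F)) (\<lambda>s. ennreal (surf K F s))) (\<lambda>s. f (X K F s))"
    unfolding facet_measure_eq[OF F] by (rule integrable_distr_eq[OF m(1) f])
  also have "\<dots> \<longleftrightarrow> integrable (restrict_space lborel (S F)) (\<lambda>s. surf K F s *\<^sub>R f (X K F s))"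
    by (rule integrable_density[OF fX m(2) AE_surf_nonneg[OF K F]])
  also have "\<dots> \<longleftrightarrow> set_integrable lborel (S F) (\<lambda>s. surf K F s * f (X K F s))"
    using S_borel[OF F] by (simp add: integrable_restrict_space set_integrable_def)
  finally show "integrable (facet_measure M K F) f \<longleftrightarrow> set_integrable lborel (S F) (\<lambda>s. surf K F s * f (X K F s))" .
qed

lemma sets_facet_measure: "F facet_of P \<Longrightarrow> sets (facet_measure M K F) = sets (restrict_space borel (facet M K F))"
  and space_facet_measure: "F facet_of P \<Longrightarrow> space (facet_measure M K F) = facet M K F"
  by (simp_all add: facet_measure_eq space_restrict_space)

text \<open>The boundary of the convex parameter set is null, and its image is compact, so the
  exceptional set is measurable.\<close>

lemma AE_facet_interior:
  assumes K: "K \<in> cells M" and F: "F facet_of P"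
  shows "AE x in facet_measure M K F. \<exists>s\<in>interior (S F). x = X K F s"
proof -
  let ?I = "X K F ` interior (S F)" and ?e = "facet M K F" and ?N = "X K F ` frontier (S F)"
  have clS: "closed (S F)" using S_props(1)[OF F] compact_imp_closed by blast
  have fr: "frontier (S F) \<subseteq> S F" "S F = interior (S F) \<union> frontier (S F)"
    using clS interior_subset[of "S F"] by (auto simp: frontier_def)
  have "?I = ?e - ?N"
  proof -
    have "X K F ` (S F - frontier (S F)) = X K F ` S F - X K F ` frontier (S F)"
      using X_inj[OF K F] fr(1) by (intro inj_on_image_set_diff[OF _ Diff_subset]) auto
    moreover have "S F - frontier (S F) = interior (S F)"
      using clS interior_subset[of "S F"] by (auto simp: frontier_def)
    ultimately show ?thesis using X_image[OF F] by simp
  qed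
  moreover have "compact ?N"
    using S_props(1)[OF F] by (intro compact_continuous_image X_continuous K F compact_frontier)
  moreover have "compact ?e" by (rule compact_facet[OF K F])
  ultimately have I: "?I \<in> sets (restrict_space borel ?e)"
    by (auto simp: sets_restrict_space compact_imp_closed borel_closed intro!: image_eqI[of _ _ "?e - ?N"] sets.Diff)
  have "AE s in lborel. s \<notin> frontier (S F)"
    using S_props(5)[OF F] by (intro AE_not_in) (auto simp: negligible_iff_null_sets null_sets_def)
  then have "AE s in lborel. s \<in> S F \<longrightarrow> X K F s \<in> ?I"
    using fr(2) by (auto elim!: eventually_mono)
  then have "AE s in restrict_space lborel (S F). X K F s \<in> ?I"
    using S_borel[OF F] by (simp add: AE_restrict_space_iff)
  then have "AE s in density (restrict_space lborel (S F)) (\<lambda>s. ennreal (surf K F s)). X K F s \<in> ?I"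
    using surface_measurable(2)[OF K F] by (subst AE_density) (auto elim!: eventually_mono)
  moreover have "{x \<in> space (restrict_space borel ?e). x \<in> ?I} = ?I"
    using image_mono[OF interior_subset, of "X K F" "S F"] X_image[OF F, of K] by (auto simp: space_restrict_space)
  ultimately have "AE x in facet_measure M K F. x \<in> ?I"
    unfolding facet_measure_eq[OF F] using I
    by (subst AE_distr_iff[OF surface_measurable(1)[OF K F]]) auto
  then show ?thesis by (auto elim!: eventually_mono)
qed

lemma facet_square_integrable:
  fixes q :: "real^'d \<Rightarrow> real"
  assumes K: "K \<in> cells M" and F: "F facet_of P" and q: "q \<in> borel_measurable borel" "\<And>x. \<bar>q x\<bar> \<le> C"
  shows "square_integrable (facet_measure M K F) q"
proof -
  have qm: "q \<in> borel_measurable (restrict_space borel (facet M K F))"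
    by (rule measurable_restrict_space1[OF q(1)])
  then have m: "q \<in> borel_measurable (facet_measure M K F)"
    using sets_facet_measure[OF F] by (simp cong: measurable_cong_sets)
  have "integrable (facet_measure M K F) (\<lambda>x. C\<^sup>2)"
    using facet_integral(2)[OF K F, of "\<lambda>x. C\<^sup>2"]
      integral_compact_lborel(1)[OF S_props(1)[OF F], of "\<lambda>s. surf K F s * C\<^sup>2"]
    by (simp add: continuous_surf[OF K F] continuous_on_mult_right)
  then have "integrable (facet_measure M K F) (\<lambda>x. (norm (q x))\<^sup>2)"
  proof (rule Bochner_Integration.integrable_bound)
    show "(\<lambda>x. (norm (q x))\<^sup>2) \<in> borel_measurable (facet_measure M K F)" using m by measurable
    have "(q x)\<^sup>2 \<le> C\<^sup>2" for x using q(2)[of x] by (simp add: abs_le_square_iff[symmetric])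
    then show "AE x in facet_measure M K F. norm ((norm (q x))\<^sup>2) \<le> norm (C\<^sup>2)" by simp
  qed
  then show ?thesis using m by (simp add: square_integrable_def)
qed

definition sgn_det :: "(real^'d) set \<Rightarrow> real" where
  "sgn_det K = sgn (det (J K (SOME y. y \<in> P)))"

lemma P_nonempty: "P \<noteq> {}" using interior_nonempty by auto

text \<open>The determinant is continuous and nonzero on the connected reference cell, so by the
  intermediate value property its sign there is constant and the chosen point immaterial.\<close>

lemma sgn_det:
  assumes K: "K \<in> cells M" and y: "y \<in> P"
  shows "sgn (det (J K y)) = sgn_det K" "\<bar>det (J K y)\<bar> = sgn_det K * det (J K y)" "sgn_det K \<noteq> 0"
proof -
  let ?y0 = "SOME y. y \<in> P"
  let ?d = "\<lambda>y. det (J K y)"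
  have y0: "?y0 \<in> P" using P_nonempty some_in_eq by blast
  have "connected (?d ` P)"
    by (rule connected_continuous_image[OF continuous_J(2)[OF K] convex_connected[OF P_props(2)]])
  moreover have "0 \<notin> ?d ` P" using det_J[OF K] by auto
  ultimately have "\<not> (?d a < 0 \<and> ?d b > 0)" if "a \<in> P" "b \<in> P" for a b
    using that connected_contains_Ioo[of "?d ` P" "?d a" "?d b"] by (auto simp: subset_iff)
  then show s: "sgn (?d y) = sgn_det K"
    using y y0 det_J[OF K y] det_J[OF K y0] unfolding sgn_det_def by (metis linorder_neqE_linordered_idom sgn_neg sgn_pos)
  show "\<bar>?d y\<bar> = sgn_det K * ?d y" unfolding s[symmetric] by (simp add: abs_sgn mult.commute)
  show "sgn_det K \<noteq> 0" unfolding s[symmetric] using det_J[OF K y] by (simp add: sgn_zero_iff)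
qed

section \<open>Boundary values of fields given by the Piola transform\<close>

lemma cell_subset_closure_interior: "K \<in> cells M \<Longrightarrow> K \<subseteq> closure (interior K)"
proof -
  assume K: "K \<in> cells M"
  have "closure (interior P) = P"
    using convex_closure_interior[OF P_props(2) interior_nonempty] P_props(3) by simp
  then have "geo M K ` P \<subseteq> closure (geo M K ` interior P)"
    using image_closure_subset[OF C1_fun_continuous[OF geo_C1[OF K]] closed_closure closure_subset] by metis
  also have "\<dots> \<subseteq> closure (interior K)" using geo_interior(2)[OF K] by (rule closure_mono)
  finally show ?thesis using geo_image[OF K] by simp
qed

lemma cell_lebesgue: "K \<in> cells M \<Longrightarrow> K \<in> sets lebesgue"
  using compact_cell compact_imp_closed by (simp add: lmeasurable_compact fmeasurableD)

definition piola_trace :: "(real^'d \<Rightarrow> real^'d) \<Rightarrow> (real^'d) set \<Rightarrow> (real^'d \<Rightarrow> real^'d) \<Rightarrow> bool" where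
  "piola_trace v K u \<longleftrightarrow> C1_fun u \<and> continuous_on K (cell_rep K v) \<and> (AE x in lebesgue_on K. v x = cell_rep K v x) \<and>
    (\<forall>y\<in>P. cell_rep K v (geo M K y) = (1 / det (J K y)) *\<^sub>R (J K y *v u y))"

text \<open>The local representative is continuous on the closed cell by inverting the Piola
  formula, so the choice in \<open>cell_rep\<close> succeeds; uniqueness up to the boundary
  identifies it with that representative.\<close>

lemma cell_trace:
  assumes K: "K \<in> cells M" and v: "v \<in> V_glob M Vhat" and Vhat: "\<And>u. u \<in> Vhat \<Longrightarrow> C1_fun u"
  shows "\<exists>u\<in>Vhat. piola_trace v K u"
proof -
  obtain w where w: "w \<in> V_loc M Vhat K" "AE x in lebesgue_on K. v x = w x"
    using v K unfolding V_glob_def by blast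
  then obtain u where u: "u \<in> Vhat" "\<And>y. y \<in> P \<Longrightarrow> piola (geo M K) w y = u y"
    unfolding V_loc_def by blast
  have weq: "w (geo M K y) = (1 / det (J K y)) *\<^sub>R (J K y *v u y)" if y: "y \<in> P" for y
  proof -
    have d: "det (J K y) \<noteq> 0" by (rule det_J[OF K y])
    have "J K y *v u y = det (J K y) *\<^sub>R (J K y *v (matrix_inv (J K y) *v w (geo M K y)))"
      using u(2)[OF y] by (simp add: piola_def matrix_vector_mult_scaleR flip: u(2)[OF y])
    also have "\<dots> = det (J K y) *\<^sub>R w (geo M K y)"
      using d by (simp add: matrix_vector_mul_assoc matrix_inv_inverse)
    finally show ?thesis using d by simp
  qed
  have cu: "continuous_on P (\<lambda>y. (1 / det (J K y)) *\<^sub>R (J K y *v u y))"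
  proof (intro continuous_on_scaleR continuous_on_divide continuous_on_const)
    show "continuous_on P (\<lambda>y. det (J K y))" by (rule continuous_J(2)[OF K])
    show "\<forall>y\<in>P. det (J K y) \<noteq> 0" using det_J[OF K] by blast
    show "continuous_on P (\<lambda>y. J K y *v u y)"
      unfolding matrix_vector_mult_def
      by (intro continuous_on_vec_lambda continuous_on_sum continuous_on_mult continuous_J(1)[OF K] continuous_on_component
        C1_fun_continuous[OF Vhat[OF u(1)]])
  qed
  have "continuous_on (geo M K ` P) w"
    by (rule continuous_on_image_compact[OF P_props(1) C1_fun_continuous[OF geo_C1[OF K]] geo_inj[OF K]])
      (use cu weq in \<open>simp cong: continuous_on_cong\<close>)
  then have cw: "continuous_on K w" by (simp add: geo_image[OF K])
  have cr: "continuous_on K (cell_rep K v)" "AE x in lebesgue_on K. v x = cell_rep K v x"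
  proof -
    have "continuous_on K (cell_rep K v) \<and> (AE x in lebesgue_on K. v x = cell_rep K v x)"
      unfolding cell_rep_def by (rule someI[of _ w]) (use cw w(2) in blast)
    then show "continuous_on K (cell_rep K v)" "AE x in lebesgue_on K. v x = cell_rep K v x" by blast+
  qed
  have "cell_rep K v x = w x" if "x \<in> K" for x
  proof (rule continuous_AE_eq_imp_eq[OF cell_lebesgue[OF K] cell_subset_closure_interior[OF K] cr(1) cw _ that])
    show "AE x in lebesgue_on K. cell_rep K v x = w x"
      using cr(2) w(2) by eventually_elim simp
  qed
  then have "cell_rep K v (geo M K y) = (1 / det (J K y)) *\<^sub>R (J K y *v u y)" if "y \<in> P" for y
    using weq[OF that] geo_image[OF K] that by (metis imageI)
  then show ?thesis using u(1) Vhat cr unfolding piola_trace_def by blast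
qed

lemma continuous_normal:
  assumes K: "K \<in> cells M" and F: "F facet_of P"
  shows "continuous_on (facet M K F) (normal M K F)"
  unfolding facet_def
proof (rule continuous_on_image_compact[OF _ C1_fun_continuous[OF geo_C1[OF K]]])
  show "compact F" using compact_continuous_image[OF chart_continuous[OF F] S_props(1)[OF F]] chart_image[OF F] by metis
  have FP: "F \<subseteq> P" by (rule facet_of_imp_subset[OF F])
  then show "inj_on (geo M K) F" using geo_inj[OF K] inj_on_subset by blast
  have "continuous_on F (\<lambda>y. (1 / norm (conormal K F y)) *\<^sub>R conormal K F y)"
    using continuous_on_subset[OF continuous_conormal[OF K] FP] normal_eq(2)[OF K F]
    by (intro continuous_intros) force+
  then show "continuous_on F (\<lambda>y. normal M K F (geo M K y))"
    by (rule continuous_on_eq) (simp add: normal_eq(1)[OF K F])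
qed

lemma transition_integral:
  fixes f :: "real^'f \<Rightarrow> real"
  assumes F: "F facet_of P" "F' facet_of P" and tr: "transition K F K' F' c A"
    and f: "continuous_on (S F') f"
  shows "integral (S F') f = integral (S F) (\<lambda>s. \<bar>det A\<bar> * f (c + A *v s))"
proof -
  have img: "(\<lambda>s. c + A *v s) ` S F = S F'" using tr by (simp add: transition_def)
  have "invertible A" using tr invertible_det_nz unfolding transition_def by blast
  then have inj: "inj ((*v) A)" by (rule inj_matrix_vector_mult)
  have "integral ((\<lambda>s. c + A *v s) ` S F) f = integral (S F) (\<lambda>s. \<bar>det (matrix ((*v) A))\<bar> * f (c + A *v s))"
  proof (rule integral_change_of_variables_compact[OF card3(2) S_props(1)[OF F(1)]])
    show "((\<lambda>s. c + A *v s) has_derivative (*v) A) (at s within S F)" for s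
      by (auto intro!: derivative_eq_intros bounded_linear_imp_has_derivative)
    show "inj_on (\<lambda>s. c + A *v s) (S F)" using inj by (auto simp: inj_on_def)
    show "continuous_on (S F) (\<lambda>s. det (matrix ((*v) A)))" by (intro continuous_intros)
    show "continuous_on ((\<lambda>s. c + A *v s) ` S F) f" unfolding img by (rule f)
  qed
  then show ?thesis by (simp add: img matrix_of_matrix_vector_mul)
qed

end

section \<open>Facet test functions\<close>

lemma fin_dim_space_sum:
  fixes f :: "'j \<Rightarrow> 'a \<Rightarrow> real"
  assumes W: "fin_dim_space W" and "\<And>j. j \<in> J \<Longrightarrow> f j \<in> W"
  shows "(\<lambda>x. \<Sum>j\<in>J. c j * f j x) \<in> W"
proof -
  obtain D where D: "finite D" "W = {w. \<exists>c :: ('a \<Rightarrow> real) \<Rightarrow> real. w = (\<lambda>x. \<Sum>b\<in>D. c b *\<^sub>R b x)}"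
    using W unfolding fin_dim_space_def by blast
  have "\<exists>d. \<forall>j\<in>J. f j = (\<lambda>x. \<Sum>b\<in>D. d j b *\<^sub>R b x)"
    by (rule bchoice) (use assms(2) D(2) in blast)
  then obtain d where d: "\<And>j. j \<in> J \<Longrightarrow> f j = (\<lambda>x. \<Sum>b\<in>D. d j b *\<^sub>R b x)"
    by blast
  have "(\<lambda>x. \<Sum>j\<in>J. c j * f j x) = (\<lambda>x. \<Sum>b\<in>D. (\<Sum>j\<in>J. c j * d j b) *\<^sub>R b x)"
  proof
    fix x
    have "(\<Sum>j\<in>J. c j * f j x) = (\<Sum>j\<in>J. \<Sum>b\<in>D. c j * d j b * b x)"
    proof (rule sum.cong[OF refl])
      fix j assume "j \<in> J"
      then have "f j x = (\<Sum>b\<in>D. d j b *\<^sub>R b x)" by (rule fun_cong[OF d])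
      then show "c j * f j x = (\<Sum>b\<in>D. c j * d j b * b x)" by (simp add: sum_distrib_left mult.assoc)
    qed
    also have "\<dots> = (\<Sum>b\<in>D. \<Sum>j\<in>J. c j * d j b * b x)" by (rule sum.swap)
    finally show "(\<Sum>j\<in>J. c j * f j x) = (\<Sum>b\<in>D. (\<Sum>j\<in>J. c j * d j b) *\<^sub>R b x)"
      by (simp add: sum_distrib_right)
  qed
  then show ?thesis unfolding D(2) mem_Collect_eq by (rule exI[of _ "\<lambda>b. \<Sum>j\<in>J. c j * d j b"])
qed

lemma fin_dim_space_zero:
  assumes "fin_dim_space W" shows "(\<lambda>x. 0) \<in> W"
proof -
  obtain D where D: "W = {w. \<exists>c :: ('a \<Rightarrow> 'b) \<Rightarrow> real. w = (\<lambda>x. \<Sum>b\<in>D. c b *\<^sub>R b x)}"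
    using assms unfolding fin_dim_space_def by blast
  have "(\<lambda>x. 0) = (\<lambda>x. \<Sum>b\<in>D. (0::real) *\<^sub>R b x)" by simp
  then show ?thesis unfolding D mem_Collect_eq by (rule exI[of _ "\<lambda>b. 0"])
qed

locale hdg_field = mesh_ctx M
  for M :: "('d::finite, 'f::finite) mesh" +
  fixes Vhat :: "(real^'d \<Rightarrow> real^'d) set" and Qbhat :: "(real^'d) set \<Rightarrow> (real^'d \<Rightarrow> real) set"
    and Qloc :: "(real^'d) set \<Rightarrow> (real^'d \<Rightarrow> real) set"
    and v :: "real^'d \<Rightarrow> real^'d" and u :: "(real^'d) set \<Rightarrow> real^'d \<Rightarrow> real^'d"
  assumes Qbhat: "\<And>F. F facet_of ref_cell M \<Longrightarrow> fin_dim_space (Qbhat F)"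
    and normal_traces: "\<And>F w. F facet_of ref_cell M \<Longrightarrow> w \<in> Vhat \<Longrightarrow> \<exists>q\<in>Qbhat F. \<forall>y\<in>F. q y = w y \<bullet> ref_normal M F"
    and Qbar_well_defined: "\<And>K K' F F'. K \<in> cells M \<Longrightarrow> K' \<in> cells M \<Longrightarrow> F facet_of ref_cell M \<Longrightarrow>
      F' facet_of ref_cell M \<Longrightarrow> facet M K F = facet M K' F' \<Longrightarrow> Qbar_loc M Qbhat K F = Qbar_loc M Qbhat K' F'"
    and Qloc: "\<And>K. K \<in> cells M \<Longrightarrow> fin_dim_space (Qloc K)"
    and v: "v \<in> X_glob M Vhat Qloc Qbhat"
    and u_Vhat: "\<And>K. K \<in> cells M \<Longrightarrow> u K \<in> Vhat"
    and u: "\<And>K. K \<in> cells M \<Longrightarrow> piola_trace v K (u K)"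
begin

lemma u_C1: "K \<in> cells M \<Longrightarrow> C1_fun (u K)"
  and rep_continuous: "K \<in> cells M \<Longrightarrow> continuous_on K (cell_rep K v)"
  and rep_AE: "K \<in> cells M \<Longrightarrow> AE x in lebesgue_on K. v x = cell_rep K v x"
  and rep_eq: "K \<in> cells M \<Longrightarrow> y \<in> P \<Longrightarrow>
    cell_rep K v (geo M K y) = (1 / det (J K y)) *\<^sub>R (J K y *v u K y)"
  using u[of K] unfolding piola_trace_def by blast+

definition facets :: "((real^'d) set \<times> (real^'d) set) set" where
  "facets = cells M \<times> {F. F facet_of P}"

text \<open>Outward flux density with respect to Lebesgue measure on the parameter set. The surface
  element is already included, and no trace of the curved geometry is left but a sign.\<close>

definition ref_flux :: "(real^'d) set \<Rightarrow> (real^'d) set \<Rightarrow> real^'f \<Rightarrow> real" where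
  "ref_flux K F s = sgn_det K * gram F * (u K (chart M F s) \<bullet> nrm F)"

text \<open>All descriptions of one mesh facet by a cell and a reference facet. Their number is left
  open here, so a mesh facet shared by several cells is handled uniformly.\<close>

definition copies :: "(real^'d) set \<Rightarrow> (real^'d) set \<Rightarrow> ((real^'d) set \<times> (real^'d) set) set" where
  "copies K F = {j \<in> facets. facet M (fst j) (snd j) = facet M K F}"

definition trans_pair :: "(real^'d) set \<Rightarrow> (real^'d) set \<Rightarrow> (real^'d) set \<times> (real^'d) set \<Rightarrow> (real^'f) \<times> (real^'f^'f)" where
  "trans_pair K F j = (SOME t. transition K F (fst j) (snd j) (fst t) (snd t))"

definition \<sigma> :: "(real^'d) set \<Rightarrow> (real^'d) set \<Rightarrow> (real^'d) set \<times> (real^'d) set \<Rightarrow> real^'f \<Rightarrow> real^'f" where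
  "\<sigma> K F j s = fst (trans_pair K F j) + snd (trans_pair K F j) *v s"

text \<open>A sum, since each flux refers to the outward normal of its own cell. The determinants
  convert the flux densities to the parameters of \<open>K\<close> and \<open>F\<close>.\<close>

definition jump :: "(real^'d) set \<Rightarrow> (real^'d) set \<Rightarrow> real^'f \<Rightarrow> real" where
  "jump K F s = (\<Sum>j\<in>copies K F. \<bar>det (snd (trans_pair K F j))\<bar> * ref_flux (fst j) (snd j) (\<sigma> K F j s))"

lemma finite_mesh_facets: "finite facets" "finite (copies K F)"
  using conforming_meshD(4)[OF conf] finite_facets by (auto simp: facets_def copies_def)

lemma trans_pair:
  assumes "K \<in> cells M" "F facet_of P" "j \<in> copies K F"
  shows "transition K F (fst j) (snd j) (fst (trans_pair K F j)) (snd (trans_pair K F j))"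
proof -
  have "\<exists>t. transition K F (fst j) (snd j) (fst t) (snd t)"
    using transition_exists(1)[OF assms(1) _ assms(2), of "fst j" "snd j"] assms(3)
    by (auto simp: copies_def facets_def)
  then show ?thesis unfolding trans_pair_def by (rule someI_ex)
qed

lemma \<sigma>_props:
  assumes "K \<in> cells M" "F facet_of P" "j \<in> copies K F"
  shows "s \<in> S F \<Longrightarrow> \<sigma> K F j s \<in> S (snd j)" "s \<in> interior (S F) \<Longrightarrow> \<sigma> K F j s \<in> interior (S (snd j))"
    "s \<in> S F \<Longrightarrow> X K F s = X (fst j) (snd j) (\<sigma> K F j s)"
  using trans_pair[OF assms] unfolding transition_def \<sigma>_def by blast+

lemma continuous_ref_flux: "K \<in> cells M \<Longrightarrow> F facet_of P \<Longrightarrow> continuous_on Y (ref_flux K F)"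
  unfolding ref_flux_def
  by (intro continuous_intros continuous_on_compose2[OF C1_fun_continuous[OF u_C1, of _ UNIV] chart_continuous]) auto

lemma continuous_jump:
  assumes "K \<in> cells M" "F facet_of P" shows "continuous_on Y (jump K F)"
proof -
  have "continuous_on Y (\<sigma> K F j)" for j
    unfolding \<sigma>_def by (intro continuous_intros)
  then show ?thesis
    unfolding jump_def
    by (intro continuous_on_sum continuous_on_mult continuous_on_const
      continuous_on_compose2[OF continuous_ref_flux[of _ _ UNIV]])
      (auto simp: copies_def facets_def)
qed

lemma flux_pointwise:
  assumes K: "K \<in> cells M" and F: "F facet_of P" and s: "s \<in> S F"
  shows "surf K F s * (cell_rep K v (X K F s) \<bullet> normal M K F (X K F s)) = ref_flux K F s"
  using normal_flux[OF K F s rep_eq[OF K chart_in_P[OF F s]]] sgn_det(1)[OF K chart_in_P[OF F s]]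
  by (simp add: ref_flux_def X_def)

lemma flux_integral:
  assumes K: "K \<in> cells M" and F: "F facet_of P" and q: "q \<in> borel_measurable borel"
  shows "(LINT x|facet_measure M K F. (cell_rep K v x \<bullet> normal M K F x) * q x)
    = (LINT s:S F|lborel. ref_flux K F s * q (X K F s))"
proof -
  have "facet M K F \<subseteq> K" using facet_of_imp_subset[OF F] geo_image[OF K] by (auto simp: facet_def)
  then have "continuous_on (facet M K F) (\<lambda>x. cell_rep K v x \<bullet> normal M K F x)"
    by (intro continuous_intros continuous_on_subset[OF rep_continuous[OF K]] continuous_normal[OF K F])
  then have "(\<lambda>x. cell_rep K v x \<bullet> normal M K F x) \<in> borel_measurable (restrict_space borel (facet M K F))"
    by (rule borel_measurable_continuous_on_restrict)
  then have "(\<lambda>x. (cell_rep K v x \<bullet> normal M K F x) * q x) \<in> borel_measurable (restrict_space borel (facet M K F))"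
    using measurable_restrict_space1[OF q] by (rule borel_measurable_times)
  from facet_integral(1)[OF K F this]
  have "(LINT x|facet_measure M K F. (cell_rep K v x \<bullet> normal M K F x) * q x)
    = (LINT s:S F|lborel. surf K F s * ((cell_rep K v (X K F s) \<bullet> normal M K F (X K F s)) * q (X K F s)))" .
  also have "\<dots> = (LINT s:S F|lborel. ref_flux K F s * q (X K F s))"
    using S_borel[OF F] flux_pointwise[OF K F]
    by (intro set_lebesgue_integral_cong) (auto simp: mult.assoc[symmetric])
  finally show ?thesis .
qed

text \<open>Change of parameters for each copy; \<open>q\<close> lives on the physical facet and
  takes the same values from every side.\<close>

lemma sum_copies_integral:
  assumes K: "K \<in> cells M" and F: "F facet_of P" and q: "continuous_on (facet M K F) q"
  shows "(\<Sum>j\<in>copies K F. integral (S (snd j)) (\<lambda>s. ref_flux (fst j) (snd j) s * q (X (fst j) (snd j) s)))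
    = integral (S F) (\<lambda>s. jump K F s * q (X K F s))"
proof -
  have qX: "continuous_on (S F) (\<lambda>s. q (X K F s))"
    using q X_image[OF F] by (intro continuous_on_compose2[OF q X_continuous[OF K F]]) auto
  have j: "integral (S (snd j)) (\<lambda>s. ref_flux (fst j) (snd j) s * q (X (fst j) (snd j) s))
      = integral (S F) (\<lambda>s. \<bar>det (snd (trans_pair K F j))\<bar> * ref_flux (fst j) (snd j) (\<sigma> K F j s) * q (X K F s))"
    if j: "j \<in> copies K F" for j
  proof -
    have J: "fst j \<in> cells M" "snd j facet_of P" "facet M (fst j) (snd j) = facet M K F"
      using j by (auto simp: copies_def facets_def)
    have "continuous_on (S (snd j)) (\<lambda>s. q (X (fst j) (snd j) s))"
      using q X_image[OF J(2)] J(3) by (intro continuous_on_compose2[OF q X_continuous[OF J(1,2)]]) auto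
    then have "continuous_on (S (snd j)) (\<lambda>s. ref_flux (fst j) (snd j) s * q (X (fst j) (snd j) s))"
      by (intro continuous_on_mult continuous_ref_flux J)
    from transition_integral[OF F J(2) trans_pair[OF K F j] this]
    show ?thesis
      using \<sigma>_props(3)[OF K F j]
      by (simp add: \<sigma>_def[symmetric] mult.assoc cong: Henstock_Kurzweil_Integration.integral_cong)
  qed
  have int: "(\<lambda>s. \<bar>det (snd (trans_pair K F j))\<bar> * ref_flux (fst j) (snd j) (\<sigma> K F j s) * q (X K F s)) integrable_on S F"
    if j: "j \<in> copies K F" for j
  proof -
    have J: "fst j \<in> cells M" "snd j facet_of P"
      using j by (auto simp: copies_def facets_def)
    have "continuous_on (S F) (\<lambda>s. \<bar>det (snd (trans_pair K F j))\<bar> * ref_flux (fst j) (snd j) (\<sigma> K F j s) * q (X K F s))"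
      unfolding \<sigma>_def
      by (intro continuous_on_mult qX continuous_on_const continuous_on_compose2[OF continuous_ref_flux[OF J, of UNIV]])
        (auto intro!: continuous_intros)
    from integral_compact_lborel(4)[OF S_props(1)[OF F] this]
    show ?thesis .
  qed
  show ?thesis
    unfolding jump_def sum_distrib_right
    by (subst Henstock_Kurzweil_Integration.integral_sum[OF finite_mesh_facets(2) int]) (auto intro!: sum.cong j)
qed

lemma Qbar_loc_sum:
  assumes F: "F facet_of P" and "\<And>j. j \<in> A \<Longrightarrow> f j \<in> Qbar_loc M Qbhat K F"
  shows "(\<lambda>x. \<Sum>j\<in>A. c j * f j x) \<in> Qbar_loc M Qbhat K F"
proof -
  have "\<forall>j\<in>A. \<exists>qhat. qhat \<in> Qbhat F \<and> (\<forall>y\<in>F. f j (geo M K y) = qhat y)"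
    using assms(2) unfolding Qbar_loc_def by blast
  then obtain qhat where qhat: "\<And>j. j \<in> A \<Longrightarrow> qhat j \<in> Qbhat F" 
    "\<And>j y. j \<in> A \<Longrightarrow> y \<in> F \<Longrightarrow> f j (geo M K y) = qhat j y"
    by (metis (no_types) bchoice)
  have "(\<lambda>x. \<Sum>j\<in>A. c j * qhat j x) \<in> Qbhat F"
    by (rule fin_dim_space_sum[OF Qbhat[OF F] qhat(1)])
  moreover have "\<forall>y\<in>F. (\<Sum>j\<in>A. c j * f j (geo M K y)) = (\<Sum>j\<in>A. c j * qhat j y)"
    using qhat(2) by simp
  moreover have "\<forall>x. x \<notin> facet M K F \<longrightarrow> (\<Sum>j\<in>A. c j * f j x) = 0"
    using assms(2) by (simp add: Qbar_loc_def)
  ultimately show ?thesis unfolding Qbar_loc_def mem_Collect_eq by (intro conjI bexI[of _ "\<lambda>x. \<Sum>j\<in>A. c j * qhat j x"])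
qed

text \<open>The jump of the normal traces, transported to the reference facet, is an admissible facet
  test function; extending it by zero to the other facets isolates a single facet in \<open>b_form\<close>.\<close>

definition jump_test :: "(real^'d) set \<Rightarrow> (real^'d) set \<Rightarrow> real^'d \<Rightarrow> real" where
  "jump_test K F x = (if x \<in> facet M K F then jump K F (inv_into (S F) (X K F) x) else 0)"

lemma jump_test_X:
  assumes "K \<in> cells M" "F facet_of P" "s \<in> S F" shows "jump_test K F (X K F s) = jump K F s"
  using assms X_inj[of K F] X_image[of F K] by (auto simp: jump_test_def)

lemma jump_test_continuous:
  assumes K: "K \<in> cells M" and F: "F facet_of P"
  shows "continuous_on (facet M K F) (jump_test K F)"
proof -
  have "continuous_on (X K F ` S F) (jump_test K F)"
    by (rule continuous_on_image_compact[OF S_props(1)[OF F] X_continuous[OF K F] X_inj[OF K F]])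
      (use continuous_jump[OF K F] jump_test_X[OF K F] in \<open>simp cong: continuous_on_cong\<close>)
  then show ?thesis by (simp add: X_image[OF F])
qed

lemma jump_test_measurable:
  assumes K: "K \<in> cells M" and F: "F facet_of P"
  shows "jump_test K F \<in> borel_measurable borel" "\<exists>C. \<forall>x. \<bar>jump_test K F x\<bar> \<le> C"
proof -
  have "(\<lambda>x. indicator (facet M K F) x *\<^sub>R jump_test K F x) \<in> borel_measurable borel"
    by (intro borel_measurable_continuous_on_indicator jump_test_continuous K F borel_closed compact_imp_closed compact_facet)
  moreover have "(\<lambda>x. indicator (facet M K F) x *\<^sub>R jump_test K F x) = jump_test K F"
    by (auto simp: fun_eq_iff indicator_def jump_test_def)
  ultimately show "jump_test K F \<in> borel_measurable borel" by simp
  have "bounded (jump_test K F ` facet M K F)"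
    by (intro compact_imp_bounded compact_continuous_image jump_test_continuous compact_facet K F)
  then obtain C where C: "\<And>x. x \<in> facet M K F \<Longrightarrow> \<bar>jump_test K F x\<bar> \<le> C"
    unfolding bounded_iff by auto
  have "\<bar>jump_test K F x\<bar> \<le> max C 0" for x
    using C[of x] by (cases "x \<in> facet M K F") (auto simp: jump_test_def)
  then show "\<exists>C. \<forall>x. \<bar>jump_test K F x\<bar> \<le> C" by blast
qed

text \<open>Each summand is a constant times a normal trace composed with the inverse geometric map
  of its own cell, so it is admissible from that side. Independence of the generating cell transfers
  it to \<open>K\<close> and \<open>F\<close>, where the summands can be added, and the sum back to
  any copy.\<close>

lemma jump_test_Qbar_loc:
  assumes K: "K \<in> cells M" and F: "F facet_of P" and j: "j \<in> copies K F"
  shows "jump_test K F \<in> Qbar_loc M Qbhat (fst j) (snd j)"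
proof -
  \<comment> \<open>The contribution of one copy without its constant factor, as a function on the
    physical facet.\<close>
  define r where "r i x = (if x \<in> facet M K F
      then u (fst i) (inv_into P (geo M (fst i)) x) \<bullet> nrm (snd i) else 0)" for i x
  have r: "r i \<in> Qbar_loc M Qbhat K F" if i: "i \<in> copies K F" for i
  proof -
    have I: "fst i \<in> cells M" "snd i facet_of P" "facet M (fst i) (snd i) = facet M K F"
      using i by (auto simp: copies_def facets_def)
    obtain qhat where qhat: "qhat \<in> Qbhat (snd i)" "\<And>y. y \<in> snd i \<Longrightarrow> qhat y = u (fst i) y \<bullet> ref_normal M (snd i)"
      using normal_traces[OF I(2) u_Vhat[OF I(1)]] by blast
    have "r i (geo M (fst i) y) = qhat y" if "y \<in> snd i" for y
    proof -
      have "y \<in> P" using that facet_of_imp_subset[OF I(2)] by blast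
      then show ?thesis
        using that qhat(2) geo_inj[OF I(1)] I(3)
        by (auto simp: r_def nrm_def ref_normal_def facet_def)
    qed
    then have "r i \<in> Qbar_loc M Qbhat (fst i) (snd i)"
      using qhat(1) I(3) unfolding Qbar_loc_def by (auto simp: r_def)
    then show ?thesis using Qbar_well_defined[OF I(1) K I(2) F I(3)] by simp
  qed
  have "jump_test K F = (\<lambda>x. \<Sum>i\<in>copies K F. (\<bar>det (snd (trans_pair K F i))\<bar> * sgn_det (fst i) * gram (snd i)) * r i x)"
  proof
    fix x
    show "jump_test K F x = (\<Sum>i\<in>copies K F. (\<bar>det (snd (trans_pair K F i))\<bar> * sgn_det (fst i) * gram (snd i)) * r i x)"
    proof (cases "x \<in> facet M K F")
      case True
      then obtain s where s: "s \<in> S F" "x = X K F s" using X_image[OF F] by (metis imageE)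
      have "r i x = u (fst i) (chart M (snd i) (\<sigma> K F i s)) \<bullet> nrm (snd i)" if i: "i \<in> copies K F" for i
      proof -
        have I: "fst i \<in> cells M" "snd i facet_of P" using i by (auto simp: copies_def facets_def)
        have "inv_into P (geo M (fst i)) x = chart M (snd i) (\<sigma> K F i s)"
          using s(2) \<sigma>_props(3)[OF K F i s(1)] inv_into_f_f[OF geo_inj[OF I(1)] chart_in_P[OF I(2) \<sigma>_props(1)[OF K F i s(1)]]]
          by (simp add: X_def)
        then show ?thesis using True by (simp add: r_def)
      qed
      then show ?thesis
        by (simp add: s(2) jump_test_X[OF K F s(1)] jump_def ref_flux_def mult.assoc)
    next
      case False
      then show ?thesis by (simp add: jump_test_def r_def)
    qed
  qed
  then have "jump_test K F \<in> Qbar_loc M Qbhat K F"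
    using Qbar_loc_sum[OF F r] by simp
  then show ?thesis
    using Qbar_well_defined[OF K _ F, of "fst j" "snd j"] j by (auto simp: copies_def facets_def)
qed

lemma jump_test_zero_outside:
  assumes K: "K \<in> cells M" and F: "F facet_of P" and j: "j \<in> facets - copies K F" and s: "s \<in> interior (S (snd j))"
  shows "jump_test K F (X (fst j) (snd j) s) = 0"
  using facet_interior_unique[OF _ K _ F s] j by (auto simp: facets_def copies_def jump_test_def)

lemma jump_test_Qbar_glob:
  assumes K: "K \<in> cells M" and F: "F facet_of P"
  shows "jump_test K F \<in> Qbar_glob M Qbhat"
  unfolding Qbar_glob_def
proof (intro CollectI ballI allI impI conjI)
  fix K' F' assume K': "K' \<in> cells M" and F': "F' facet_of ref_cell M"
  show "square_integrable (facet_measure M K' F') (jump_test K F)"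
    using jump_test_measurable[OF K F] facet_square_integrable[OF K' F'] by blast
  show "\<exists>p\<in>Qbar_loc M Qbhat K' F'. AE x in facet_measure M K' F'. jump_test K F x = p x"
  proof (cases "(K', F') \<in> copies K F")
    case True
    then show ?thesis using jump_test_Qbar_loc[OF K F True] by auto
  next
    case False
    have "(\<lambda>x. 0) \<in> Qbar_loc M Qbhat K' F'"
      using Qbar_loc_sum[OF F', of "{}"] by simp
    \<comment> \<open>Only almost everywhere: the closed facets may share lower-dimensional faces,
      where the extended jump can be nonzero.\<close>
    moreover have "AE x in facet_measure M K' F'. jump_test K F x = 0"
      using AE_facet_interior[OF K' F'] jump_test_zero_outside[OF K F, of "(K', F')"] False K' F'
      by (auto simp: facets_def elim!: eventually_mono)
    ultimately show ?thesis by (intro bexI[of _ "\<lambda>x. 0"])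
  qed
qed

lemma jump_zero:
  assumes K: "K \<in> cells M" and F: "F facet_of P" and s: "s \<in> S F"
  shows "jump K F s = 0"
proof -
  let ?q = "jump_test K F"
  let ?\<Phi> = "\<lambda>j. LINT s:S (snd j)|lborel. ref_flux (fst j) (snd j) s * ?q (X (fst j) (snd j) s)"
  \<comment> \<open>With zero as the cell component, the volume term drops out of
    \<open>b_form\<close>.\<close>
  have "(\<lambda>x. 0) \<in> Q_glob M Qloc"
    unfolding Q_glob_def square_integrable_def
    by (auto intro!: bexI[of _ "\<lambda>x. 0"] fin_dim_space_zero Qloc)
  then have "b_form M v (\<lambda>x. 0, ?q) = 0"
    using v jump_test_Qbar_glob[OF K F] unfolding X_glob_def by blast
  then have "0 = (\<Sum>K\<in>cells M. \<Sum>F' | F' facet_of P. ?\<Phi> (K, F'))"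
  proof -
    have "(LINT x|facet_measure M K' F'. (cell_rep K' v x \<bullet> normal M K' F' x) * ?q x) = ?\<Phi> (K', F')"
      if "K' \<in> cells M" "F' facet_of P" for K' F'
      using flux_integral[OF that jump_test_measurable(1)[OF K F]] by simp
    then have "(\<Sum>K\<in>cells M. \<Sum>F' | F' facet_of P. LINT x|facet_measure M K F'. (cell_rep K v x \<bullet> normal M K F' x) * ?q x)
        = (\<Sum>K\<in>cells M. \<Sum>F' | F' facet_of P. ?\<Phi> (K, F'))"
      by (intro sum.cong[OF refl]) auto
    then show ?thesis
      using \<open>b_form M v (\<lambda>x. 0, ?q) = 0\<close> by (simp add: b_form_def)
  qed
  also have "\<dots> = (\<Sum>j\<in>facets. ?\<Phi> j)"
    by (simp add: facets_def sum.cartesian_product case_prod_beta)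
  also have "\<dots> = (\<Sum>j\<in>copies K F. ?\<Phi> j)"
  proof (rule sum.mono_neutral_right[OF finite_mesh_facets(1)])
    show "copies K F \<subseteq> facets" by (auto simp: copies_def)
    show "\<forall>j\<in>facets - copies K F. ?\<Phi> j = 0"
    proof
      fix j assume j: "j \<in> facets - copies K F"
      then have J: "snd j facet_of P" by (auto simp: facets_def)
      have "AE s in lborel. s \<notin> frontier (S (snd j))"
        using S_props(5)[OF J] by (intro AE_not_in) (auto simp: negligible_iff_null_sets null_sets_def)
      then have "AE s in lborel. indicator (S (snd j)) s *\<^sub>R (ref_flux (fst j) (snd j) s * ?q (X (fst j) (snd j) s)) = 0"
      proof eventually_elim
        case (elim s)
        then show ?case
          using jump_test_zero_outside[OF K F j, of s] closure_subset[of "S (snd j)"]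
          by (auto simp: frontier_def indicator_def)
      qed
      then show "?\<Phi> j = 0"
        unfolding set_lebesgue_integral_def by (rule integral_eq_zero_AE)
    qed
  qed
  also have "\<dots> = (\<Sum>j\<in>copies K F. integral (S (snd j)) (\<lambda>s. ref_flux (fst j) (snd j) s * ?q (X (fst j) (snd j) s)))"
  proof (rule sum.cong[OF refl])
    fix j assume j: "j \<in> copies K F"
    then have J: "fst j \<in> cells M" "snd j facet_of P" "facet M (fst j) (snd j) = facet M K F"
      by (auto simp: copies_def facets_def)
    have "continuous_on (S (snd j)) (\<lambda>s. ?q (X (fst j) (snd j) s))"
      using X_image[OF J(2)] J(3) by (intro continuous_on_compose2[OF jump_test_continuous[OF K F] X_continuous[OF J(1,2)]]) auto
    then show "?\<Phi> j = integral (S (snd j)) (\<lambda>s. ref_flux (fst j) (snd j) s * ?q (X (fst j) (snd j) s))"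
      by (intro integral_compact_lborel(2)[symmetric] S_props(1) J continuous_on_mult continuous_ref_flux)
  qed
  also have "\<dots> = integral (S F) (\<lambda>s. jump K F s * ?q (X K F s))"
    by (rule sum_copies_integral[OF K F jump_test_continuous[OF K F]])
  also have "\<dots> = integral (S F) (\<lambda>s. (jump K F s)\<^sup>2)"
    by (rule Henstock_Kurzweil_Integration.integral_cong) (simp add: jump_test_X[OF K F] power2_eq_square)
  finally have 0: "integral (S F) (\<lambda>s. (jump K F s)\<^sup>2) = 0" by simp
  have c: "continuous_on (S F) (\<lambda>s. (jump K F s)\<^sup>2)"
    by (intro continuous_intros continuous_jump[OF K F])
  have "((\<lambda>s. (jump K F s)\<^sup>2) has_integral 0) (S F)"
    using 0 integral_compact_lborel(4)[OF S_props(1)[OF F] c]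
    by (metis integrable_integral)
  \<comment> \<open>The parameter set is the closure of its interior, so a continuous nonnegative
    function with integral zero vanishes on all of it, boundary included.\<close>
  then have hi: "((\<lambda>s. (jump K F s)\<^sup>2) has_integral 0) (closure (interior (S F)))"
    by (simp add: S_props(4)[OF F])
  have "(jump K F s)\<^sup>2 = 0"
  proof (rule has_integral_0_closure_imp_0[OF _ _ _ _ _ _ hi])
    show "0 < emeasure lborel (interior (S F))"
    proof (rule ccontr)
      assume "\<not> ?thesis"
      then have "interior (S F) \<in> null_sets lborel" by (auto simp: null_sets_def)
      then have "negligible (interior (S F))" by (simp add: negligible_iff_null_sets null_sets_completionI)
      then show False using open_not_negligible[OF open_interior S_props(3)[OF F]] by blast
    qed
    show "emeasure lborel (interior (S F)) < \<infinity>"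
      using S_props(1)[OF F] bounded_subset[OF compact_imp_bounded interior_subset] by (intro emeasure_bounded_finite)
    have "S F = interior (S F) \<union> frontier (S F)"
      using S_props(1)[OF F] compact_imp_closed interior_subset[of "S F"] by (auto simp: frontier_def)
    moreover have "frontier (S F) \<in> null_sets lborel"
      using S_props(5)[OF F] by (auto simp: negligible_iff_null_sets null_sets_def)
    ultimately show "emeasure lborel (closure (interior (S F))) = emeasure lborel (interior (S F))"
      unfolding S_props(4)[OF F] using emeasure_Un_null_set[of "interior (S F)" lborel "frontier (S F)"] by simp
  qed (use c s in \<open>auto simp: S_props(4)[OF F]\<close>)
  then show ?thesis by simp
qed

end

section \<open>Normal continuity and the distributional divergence\<close>

context hdg_field
begin

text \<open>Pairs are grouped by the mesh facet they describe, and each group integrates the jump. A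
  group with a single pair is covered too: there the jump is the flux of one cell.\<close>

lemma facet_sum_zero:
  assumes \<phi>: "continuous_on UNIV \<phi>"
  shows "(\<Sum>j\<in>facets. integral (S (snd j)) (\<lambda>s. ref_flux (fst j) (snd j) s * \<phi> (X (fst j) (snd j) s))) = 0"
    (is "sum ?I facets = 0")
proof -
  let ?e = "\<lambda>j. facet M (fst j) (snd j)"
  have "sum ?I {j \<in> facets. ?e j = e} = 0" if "e \<in> ?e ` facets" for e
  proof -
    obtain i where i: "i \<in> facets" "e = ?e i" using \<open>e \<in> ?e ` facets\<close> by blast
    then have I: "fst i \<in> cells M" "snd i facet_of P" by (auto simp: facets_def)
    have "{j \<in> facets. ?e j = e} = copies (fst i) (snd i)" by (simp add: copies_def i(2))
    then have "sum ?I {j \<in> facets. ?e j = e} 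
        = integral (S (snd i)) (\<lambda>s. jump (fst i) (snd i) s * \<phi> (X (fst i) (snd i) s))"
      using sum_copies_integral[OF I continuous_on_subset[OF \<phi> subset_UNIV]] by simp
    also have "\<dots> = integral (S (snd i)) (\<lambda>s. 0)"
      by (rule Henstock_Kurzweil_Integration.integral_cong) (simp add: jump_zero[OF I])
    finally show ?thesis by simp
  qed
  then show ?thesis
    by (subst sum.image_gen[OF finite_mesh_facets(1), of _ ?e]) simp
qed

lemma normal_trace_continuous_interior:
  assumes K: "K \<in> cells M" "K' \<in> cells M" "K \<noteq> K'" and F: "F facet_of P" "F' facet_of P"
    and eq: "facet M K F = facet M K' F'" and s: "s \<in> interior (S F)"
  shows "cell_rep K v (X K F s) \<bullet> normal M K F (X K F s) = cell_rep K' v (X K F s) \<bullet> normal M K F (X K F s)"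
proof -
  let ?x = "X K F s"
  let ?t = "\<lambda>j. cell_rep (fst j) v ?x \<bullet> normal M (fst j) (snd j) ?x"
  have sS: "s \<in> S F" using s interior_subset by blast
  have J: "fst j \<in> cells M" "snd j facet_of P" "facet M (fst j) (snd j) = facet M K F" if "j \<in> copies K F" for j
    using that by (auto simp: copies_def facets_def)
  have opp: "normal M K2 F2 ?x = - normal M K1 F1 ?x"
    if "(K1, F1) \<in> copies K F" "(K2, F2) \<in> copies K F" "K1 \<noteq> K2" for K1 F1 K2 F2
  proof -
    have 1: "K1 \<in> cells M" "F1 facet_of P" "facet M K1 F1 = facet M K F" using J[OF that(1)] by auto
    have 2: "K2 \<in> cells M" "F2 facet_of P" "facet M K2 F2 = facet M K F" using J[OF that(2)] by auto
    have "?x = X K1 F1 (\<sigma> K F (K1, F1) s)" "\<sigma> K F (K1, F1) s \<in> interior (S F1)"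
      using \<sigma>_props(2,3)[OF K(1) F(1) that(1)] s sS by auto
    then show ?thesis
      using opposite_normals[OF 1(1) 2(1) that(3) 1(2) 2(2), of "\<sigma> K F (K1, F1) s"] 1(3) 2(3) by simp
  qed
  have in_copies: "(K, F) \<in> copies K F" "(K', F') \<in> copies K F"
    using K F eq by (auto simp: copies_def facets_def)
  have "copies K F = {(K, F), (K', F')}"
  proof (intro equalityI subsetI)
    fix j assume j: "j \<in> copies K F"
    obtain K2 F2 where j2: "j = (K2, F2)" by (cases j)
    have unique: "F2 = F1" if "K2 = K1" "(K1, F1) \<in> copies K F" for K1 F1
      by (rule facet_eq_same_cell[of K1]) (use J[OF j] J[OF that(2)] that(1) j2 in auto)
    \<comment> \<open>Three cells would have pairwise opposite unit normals, making a unit vector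
      equal to its negative.\<close>
    have "K2 = K \<or> K2 = K'"
    proof (rule ccontr)
      assume "\<not> ?thesis"
      then have "normal M K2 F2 ?x = - normal M K F ?x" "normal M K2 F2 ?x = - normal M K' F' ?x"
        "normal M K' F' ?x = - normal M K F ?x"
        using opp in_copies j j2 K(3) by blast+
      then have "normal M K F ?x = - normal M K F ?x" by simp
      then have "normal M K F ?x = 0" by (metis equal_neg_zero vec_eq_iff vector_uminus_component zero_index)
      moreover have "norm (normal M K F ?x) = 1"
        using normal_eq(4)[OF K(1) F(1) chart_in_F[OF sS]] by (simp add: X_def)
      ultimately show False by simp
    qed
    then show "j \<in> {(K, F), (K', F')}" using unique in_copies j2 by blast
  qed (use in_copies in auto)
  \<comment> \<open>Surface elements transform by the same determinants that occur in the jump, so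
    all summands share the positive factor \<open>surf K F s\<close>, which is then
    cancelled.\<close>
  moreover have "surf K F s * ?t j = \<bar>det (snd (trans_pair K F j))\<bar> * ref_flux (fst j) (snd j) (\<sigma> K F j s)"
    if j: "j \<in> copies K F" for j
  proof -
    have "surf K F s = \<bar>det (snd (trans_pair K F j))\<bar> * surf (fst j) (snd j) (\<sigma> K F j s)"
      using jacobian_transition(2)[OF K(1) J(1)[OF j] F(1) J(2)[OF j] trans_pair[OF K(1) F(1) j] s] by (simp add: \<sigma>_def)
    then show ?thesis
      using flux_pointwise[OF J(1,2)[OF j] \<sigma>_props(1)[OF K(1) F(1) j sS]] \<sigma>_props(3)[OF K(1) F(1) j sS]
      by (simp add: mult.assoc)
  qed
  then have "(\<Sum>j\<in>copies K F. surf K F s * ?t j) = jump K F s"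
    unfolding jump_def by (rule sum.cong[OF refl])
  ultimately have "surf K F s * (?t (K, F) + ?t (K', F')) = 0"
    using jump_zero[OF K(1) F(1) sS] K(3) by (simp add: distrib_left)
  then have "?t (K, F) + ?t (K', F') = 0"
    using surf_eq(2)[OF K(1) F(1) sS] by simp
  moreover have "normal M K' F' ?x = - normal M K F ?x"
    using opp in_copies K(3) by blast
  ultimately show ?thesis by simp
qed

lemma normal_trace_continuous: "normal_continuous M v"
  unfolding normal_continuous_def
proof (intro ballI allI impI)
  fix K K' F F' x
  assume K: "K \<in> cells M" "K' \<in> cells M" "K \<noteq> K'" and F: "F facet_of ref_cell M" "F' facet_of ref_cell M"
    and eq: "facet M K F = facet M K' F'" and x: "x \<in> facet M K F"
  let ?h = "\<lambda>x. cell_rep K v x \<bullet> normal M K F x - cell_rep K' v x \<bullet> normal M K F x"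
  have sub: "facet M K F \<subseteq> K" "facet M K F \<subseteq> K'"
    using F facet_of_imp_subset geo_image K(1,2) eq unfolding facet_def by blast+
  have "continuous_on (facet M K F) ?h"
    by (intro continuous_intros continuous_on_subset[OF rep_continuous[OF K(1)] sub(1)]
        continuous_on_subset[OF rep_continuous[OF K(2)] sub(2)] continuous_normal[OF K(1) F(1)])
  then have c: "continuous_on (closure (interior (S F))) (\<lambda>s. ?h (X K F s))"
    unfolding S_props(4)[OF F(1)]
    by (rule continuous_on_compose2[OF _ X_continuous[OF K(1) F(1)]]) (simp add: X_image[OF F(1)])
  obtain s where s: "s \<in> S F" "x = X K F s" using x X_image[OF F(1)] by (metis imageE)
  have "?h (X K F s) = 0"
    by (rule continuous_constant_on_closure[OF c])
      (use normal_trace_continuous_interior[OF K F eq] s(1) S_props(4)[OF F(1)] in auto)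
  then show "cell_rep K v x \<bullet> normal M K F x = cell_rep K' v x \<bullet> normal M K F x"
    by (simp add: s(2))
qed

section \<open>Volume integrals over the cells\<close>

lemma AE_cells:
  "AE x in lebesgue. \<forall>K\<in>cells M. x \<notin> frontier K"
  "AE x in lebesgue. \<forall>K\<in>cells M. \<forall>K'\<in>cells M. K \<noteq> K' \<longrightarrow> x \<notin> K \<inter> K'"
proof -
  have fin: "finite (cells M)" by (rule conforming_meshD(4)[OF conf])
  show "AE x in lebesgue. \<forall>K\<in>cells M. x \<notin> frontier K"
    using negligible_frontier_cell
    by (intro AE_finite_allI[OF fin] AE_not_in) (simp add: negligible_iff_null_sets)
  have "AE x in lebesgue. K \<noteq> K' \<longrightarrow> x \<notin> K \<inter> K'" if "K \<in> cells M" "K' \<in> cells M" for K K'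
  proof (cases "K = K'")
    case False
    then show ?thesis
      using AE_not_in[of "K \<inter> K'" lebesgue] negligible_cell_Int[OF that] by (simp add: negligible_iff_null_sets)
  qed simp
  then show "AE x in lebesgue. \<forall>K\<in>cells M. \<forall>K'\<in>cells M. K \<noteq> K' \<longrightarrow> x \<notin> K \<inter> K'"
    by (intro AE_finite_allI[OF fin]) auto
qed

lemma domain_lebesgue: "domain M \<in> sets lebesgue" "domain M \<in> sets borel"
  using conforming_meshD(3)[OF conf] by auto

text \<open>The interior of a cell lies in the domain and its boundary is null, so restriction to
  the open domain loses nothing.\<close>

lemma cell_integral_domain:
  fixes f :: "real^'d \<Rightarrow> real"
  assumes K: "K \<in> cells M" and f: "continuous_on K f"
  shows "integrable (lebesgue_on (domain M)) (\<lambda>x. indicator K x * f x)"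
    and "(LINT x|lebesgue_on (domain M). indicator K x * f x) = integral K f"
proof -
  let ?h = "\<lambda>x. indicator K x * f x"
  have h: "integrable lborel ?h"
    using integral_compact_lborel(1)[OF compact_cell[OF K] f] by (simp add: set_integrable_def)
  then have hl: "integrable lebesgue ?h"
    by (simp add: integrable_completion borel_measurable_integrable)
  have hd: "integrable lebesgue (\<lambda>x. indicator (domain M) x *\<^sub>R ?h x)"
    by (rule integrable_mult_indicator[OF domain_lebesgue(1) hl])
  then show "integrable (lebesgue_on (domain M)) ?h"
    using domain_lebesgue(1) by (simp add: integrable_restrict_space)
  have "(LINT x|lebesgue_on (domain M). ?h x) = (LINT x|lebesgue. indicator (domain M) x *\<^sub>R ?h x)"
    using domain_lebesgue(1) by (simp add: integral_restrict_space)
  also have "\<dots> = (LINT x|lebesgue. ?h x)"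
  proof (rule integral_cong_AE)
    show "AE x in lebesgue. indicator (domain M) x *\<^sub>R ?h x = ?h x"
      using AE_cells(1)
    proof eventually_elim
      case (elim x)
      then have "x \<in> interior K" if "x \<in> K"
        using that K closure_subset[of K] by (auto simp: frontier_def)
      then show ?case
        using conforming_meshD(6)[OF conf K] by (auto simp: indicator_def)
    qed
  qed (use hl hd borel_measurable_integrable in blast)+
  also have "\<dots> = (LINT x|lborel. ?h x)"
    by (rule integral_completion[OF borel_measurable_integrable[OF h]])
  also have "\<dots> = integral K f"
    using integral_compact_lborel(2)[OF compact_cell[OF K] f] by (simp add: set_lebesgue_integral_def)
  finally show "(LINT x|lebesgue_on (domain M). ?h x) = integral K f" .
qed

lemma integral_pullback:
  fixes f :: "real^'d \<Rightarrow> real"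
  assumes K: "K \<in> cells M" and f: "continuous_on K f"
  shows "integral K f = sgn_det K * integral P (\<lambda>y. det (J K y) * f (geo M K y))"
proof -
  have m: "matrix (\<lambda>h. J K y *v h) = J K y" for y by (rule matrix_of_matrix_vector_mul)
  have "integral (geo M K ` P) f = integral P (\<lambda>y. \<bar>det (matrix (\<lambda>h. J K y *v h))\<bar> * f (geo M K y))"
  proof (rule integral_change_of_variables_compact[OF card3(1) P_props(1) _ geo_inj[OF K]])
    show "(geo M K has_derivative (\<lambda>h. J K y *v h)) (at y within P)" for y
      by (rule has_derivative_at_withinI[OF C1_fun_jacobian(1)[OF geo_C1[OF K]]])
    show "continuous_on P (\<lambda>y. det (matrix (\<lambda>h. J K y *v h)))"
      unfolding m by (rule continuous_J(2)[OF K])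
    show "continuous_on (geo M K ` P) f" using f geo_image[OF K] by simp
  qed
  also have "\<dots> = integral P (\<lambda>y. sgn_det K * (det (J K y) * f (geo M K y)))"
    by (rule Henstock_Kurzweil_Integration.integral_cong) (simp add: m sgn_det(2)[OF K] mult.assoc)
  finally show ?thesis by (simp add: geo_image[OF K])
qed

lemma grad_compose:
  assumes K: "K \<in> cells M" and \<phi>: "C1_fun \<phi>"
  shows "w \<bullet> grad (\<lambda>y. \<phi> (geo M K y)) y = (J K y *v w) \<bullet> grad \<phi> (geo M K y)"
proof -
  have "((\<lambda>y. \<phi> (geo M K y)) has_derivative (\<lambda>h. frechet_derivative \<phi> (at (geo M K y)) (J K y *v h))) (at y)"
    by (rule has_derivative_compose[OF C1_fun_jacobian(1)[OF geo_C1[OF K]] C1_fun_derivative(1)[OF \<phi>]])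
  from fun_cong[OF frechet_derivative_at[OF this], of w]
  show ?thesis
    by (simp add: frechet_derivative_grad(1)[OF \<phi>] frechet_derivative_grad(1)[OF C1_fun_compose[OF geo_C1[OF K] \<phi>]] inner_commute)
qed

text \<open>The Piola expression for the divergence of the field on \<open>K\<close>. It is
  recognised as the weak divergence through integration by parts on the reference cell, without
  differentiating the Jacobian of the geometric map.\<close>

definition cell_div :: "(real^'d) set \<Rightarrow> real^'d \<Rightarrow> real" where
  "cell_div K x = (let y = inv_into P (geo M K) x in divergence (u K) y / det (J K y))"

lemma cell_div_geo:
  "K \<in> cells M \<Longrightarrow> y \<in> P \<Longrightarrow> cell_div K (geo M K y) = divergence (u K) y / det (J K y)"
  by (simp add: cell_div_def geo_inj)

lemma continuous_cell_div:
  assumes K: "K \<in> cells M" shows "continuous_on K (cell_div K)"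
proof -
  have "continuous_on P (divergence (u K))"
    unfolding divergence_def trace_def using C1_fun_jacobian(3)[OF u_C1[OF K]] by (intro continuous_intros)
  then have "continuous_on P (\<lambda>y. divergence (u K) y / det (J K y))"
    using det_J[OF K] by (intro continuous_on_divide continuous_J(2)[OF K]) auto
  then have "continuous_on P (\<lambda>y. cell_div K (geo M K y))"
    by (rule continuous_on_eq) (simp add: cell_div_geo[OF K])
  from continuous_on_image_compact[OF P_props(1) C1_fun_continuous[OF geo_C1[OF K]] geo_inj[OF K] this]
  show ?thesis by (simp add: geo_image[OF K])
qed

text \<open>In both volume integrals the determinant from the change of variables cancels the Piola
  factor, and the Jacobian of the field is absorbed by the gradient of the pulled-back \<phi>. What
  is left is the divergence theorem on the flat reference cell.\<close>

lemma cell_integration_by_parts: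
  assumes K: "K \<in> cells M" and \<phi>: "C1_fun \<phi>"
  shows "integral K (\<lambda>x. cell_rep K v x \<bullet> grad \<phi> x) + integral K (\<lambda>x. cell_div K x * \<phi> x)
    = (\<Sum>F | F facet_of P. integral (S F) (\<lambda>s. ref_flux K F s * \<phi> (X K F s)))"
proof -
  let ?\<psi> = "\<lambda>y. \<phi> (geo M K y)"
  have \<psi>: "C1_fun ?\<psi>" by (rule C1_fun_compose[OF geo_C1[OF K] \<phi>])
  have 1: "integral K (\<lambda>x. cell_rep K v x \<bullet> grad \<phi> x) = sgn_det K * integral P (\<lambda>y. u K y \<bullet> grad ?\<psi> y)"
  proof -
    have "integral K (\<lambda>x. cell_rep K v x \<bullet> grad \<phi> x)
        = sgn_det K * integral P (\<lambda>y. det (J K y) * (cell_rep K v (geo M K y) \<bullet> grad \<phi> (geo M K y)))"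
      by (rule integral_pullback[OF K]) (intro continuous_intros rep_continuous[OF K] frechet_derivative_grad(2)[OF \<phi>])
    also have "integral P (\<lambda>y. det (J K y) * (cell_rep K v (geo M K y) \<bullet> grad \<phi> (geo M K y)))
        = integral P (\<lambda>y. u K y \<bullet> grad ?\<psi> y)"
      by (rule Henstock_Kurzweil_Integration.integral_cong)
        (simp add: rep_eq[OF K] grad_compose[OF K \<phi>] det_J[OF K])
    finally show ?thesis .
  qed
  have 2: "integral K (\<lambda>x. cell_div K x * \<phi> x) = sgn_det K * integral P (\<lambda>y. divergence (u K) y * ?\<psi> y)"
  proof -
    have "integral K (\<lambda>x. cell_div K x * \<phi> x)
        = sgn_det K * integral P (\<lambda>y. det (J K y) * (cell_div K (geo M K y) * \<phi> (geo M K y)))"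
      by (rule integral_pullback[OF K]) (intro continuous_intros continuous_cell_div[OF K] C1_fun_continuous[OF \<phi>])
    also have "integral P (\<lambda>y. det (J K y) * (cell_div K (geo M K y) * \<phi> (geo M K y)))
        = integral P (\<lambda>y. divergence (u K) y * ?\<psi> y)"
      by (rule Henstock_Kurzweil_Integration.integral_cong) (simp add: cell_div_geo[OF K] det_J[OF K])
    finally show ?thesis .
  qed
  have "(\<Sum>F | F facet_of P. sgn_det K * (gram F * integral (S F) (\<lambda>s. (u K (chart M F s) \<bullet> nrm F) * ?\<psi> (chart M F s))))
      = (\<Sum>F | F facet_of P. integral (S F) (\<lambda>s. ref_flux K F s * \<phi> (X K F s)))"
  proof (rule sum.cong[OF refl])
    fix F
    have "integral (S F) (\<lambda>s. ref_flux K F s * \<phi> (X K F s))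
        = integral (S F) (\<lambda>s. (sgn_det K * gram F) * ((u K (chart M F s) \<bullet> nrm F) * ?\<psi> (chart M F s)))"
      by (simp add: ref_flux_def X_def mult.assoc)
    also have "\<dots> = (sgn_det K * gram F) * integral (S F) (\<lambda>s. (u K (chart M F s) \<bullet> nrm F) * ?\<psi> (chart M F s))"
      by (rule integral_mult_right)
    finally show "sgn_det K * (gram F * integral (S F) (\<lambda>s. (u K (chart M F s) \<bullet> nrm F) * ?\<psi> (chart M F s)))
      = integral (S F) (\<lambda>s. ref_flux K F s * \<phi> (X K F s))" by (simp add: mult.assoc)
  qed
  then show ?thesis
    unfolding 1 2 divergence_theorem[OF card3(1) u_C1[OF K] \<psi>]
    by (simp add: right_diff_distrib sum_distrib_left)
qed

lemma v_Hdiv: "v \<in> Hdiv (domain M)"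
proof -
  have fin: "finite (cells M)" by (rule conforming_meshD(4)[OF conf])
  have vV: "v \<in> V_glob M Vhat" using v by (simp add: X_glob_def)
  then have vs: "square_integrable (lebesgue_on (domain M)) v" by (simp add: V_glob_def)
  \<comment> \<open>Values add up where cells overlap, which happens only on a null set.\<close>
  define g where "g x = (\<Sum>K\<in>cells M. indicator K x * cell_div K x)" for x
  have gb: "g \<in> borel_measurable borel"
  proof -
    have "(\<lambda>x. indicator K x *\<^sub>R cell_div K x) \<in> borel_measurable borel" if "K \<in> cells M" for K
      by (intro borel_measurable_continuous_on_indicator continuous_cell_div that borel_closed compact_imp_closed compact_cell)
    then show ?thesis unfolding g_def by simp
  qed
  have gm: "g \<in> borel_measurable (lebesgue_on (domain M))"
    using gb by (intro measurable_restrict_space1 measurable_completion) simp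
  have "\<exists>C. \<forall>x\<in>K. \<bar>cell_div K x\<bar> \<le> C" if "K \<in> cells M" for K
    using compact_imp_bounded[OF compact_continuous_image[OF continuous_cell_div[OF that] compact_cell[OF that]]]
    by (auto simp: bounded_iff)
  then obtain C where C: "\<And>K x. K \<in> cells M \<Longrightarrow> x \<in> K \<Longrightarrow> \<bar>cell_div K x\<bar> \<le> C K"
    by metis
  have gC: "\<bar>g x\<bar> \<le> (\<Sum>K\<in>cells M. max 0 (C K))" for x
    unfolding g_def
  proof (rule order_trans[OF sum_abs sum_mono])
    fix K assume "K \<in> cells M"
    then show "\<bar>indicator K x * cell_div K x\<bar> \<le> max 0 (C K)"
      using C[of K x] by (cases "x \<in> K") auto
  qed
  \<comment> \<open>The domain has finite measure, so the bounded function \<open>g\<close> is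
    square integrable.\<close>
  have "bounded (\<Union>(cells M))"
    using fin compact_cell compact_imp_bounded by (intro bounded_Union) auto
  then have "bounded (domain M)"
    unfolding conforming_meshD(5)[OF conf] using closure_subset bounded_subset by blast
  then have "domain M \<in> lmeasurable"
    using conforming_meshD(3)[OF conf] by (rule lmeasurable_open)
  then interpret fm: finite_measure "lebesgue_on (domain M)"
    by (rule finite_measure_lebesgue_on)
  have "integrable (lebesgue_on (domain M)) (\<lambda>x. (norm (g x))\<^sup>2)"
  proof (rule fm.integrable_const_bound)
    have "(g x)\<^sup>2 \<le> (\<Sum>K\<in>cells M. max 0 (C K))\<^sup>2" for x
      using power_mono[OF gC[of x], of 2] by simp
    then show "AE x in lebesgue_on (domain M). norm ((norm (g x))\<^sup>2) \<le> (\<Sum>K\<in>cells M. max 0 (C K))\<^sup>2"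
      by simp
    show "(\<lambda>x. (norm (g x))\<^sup>2) \<in> borel_measurable (lebesgue_on (domain M))" using gm by measurable
  qed
  then have gs: "square_integrable (lebesgue_on (domain M)) g"
    using gm by (simp add: square_integrable_def)
  have "(LINT x|lebesgue_on (domain M). v x \<bullet> grad \<phi> x) = - (LINT x|lebesgue_on (domain M). g x * \<phi> x)"
    if "test_function (domain M) \<phi>" for \<phi>
  proof -
    have \<phi>: "C1_fun \<phi>" using that smooth_C1_fun by (auto simp: test_function_def)
    have c\<phi>: "continuous_on A \<phi>" "continuous_on A (grad \<phi>)" for A
      by (rule C1_fun_continuous[OF \<phi>], rule frechet_derivative_grad(2)[OF \<phi>])
    let ?r = "\<lambda>K x. cell_rep K v x \<bullet> grad \<phi> x"
    let ?d = "\<lambda>K x. cell_div K x * \<phi> x"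
    have cr: "continuous_on K (?r K)" "continuous_on K (?d K)" if "K \<in> cells M" for K
      by (intro continuous_intros rep_continuous continuous_cell_div that c\<phi>)+
    note int = cell_integral_domain(1)[OF _ cr(1)] cell_integral_domain(1)[OF _ cr(2)]
    have "(LINT x|lebesgue_on (domain M). v x \<bullet> grad \<phi> x)
        = (LINT x|lebesgue_on (domain M). (\<Sum>K\<in>cells M. indicator K x * ?r K x))"
    proof (rule integral_cong_AE)
      have "grad \<phi> \<in> borel_measurable (lebesgue_on (domain M))"
        using borel_measurable_continuous_onI[OF c\<phi>(2)]
        by (intro measurable_restrict_space1 measurable_completion) simp
      then show "(\<lambda>x. v x \<bullet> grad \<phi> x) \<in> borel_measurable (lebesgue_on (domain M))"
        using vs by (intro borel_measurable_inner) (auto simp: square_integrable_def)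
      show "(\<lambda>x. \<Sum>K\<in>cells M. indicator K x * ?r K x) \<in> borel_measurable (lebesgue_on (domain M))"
        using int(1) by (intro borel_measurable_sum borel_measurable_integrable) auto
      have "AE x in lebesgue. \<forall>K\<in>cells M. x \<in> K \<longrightarrow> v x = cell_rep K v x"
        using rep_AE cell_lebesgue by (intro AE_finite_allI[OF fin]) (simp add: AE_restrict_space_iff)
      with AE_cells(2) have "AE x in lebesgue. x \<in> domain M \<longrightarrow> v x \<bullet> grad \<phi> x = (\<Sum>K\<in>cells M. indicator K x * ?r K x)"
      proof eventually_elim
        case (elim x)
        show ?case
        proof
          assume "x \<in> domain M"
          then obtain K where K: "K \<in> cells M" "x \<in> K"
            using conforming_meshD(5)[OF conf] closure_subset by blast
          \<comment> \<open>Outside the pairwise intersections \<open>x\<close> belongs to one cell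
            only, and a single summand survives.\<close>
          have "(\<Sum>K'\<in>cells M. indicator K' x * ?r K' x) = (\<Sum>K'\<in>{K}. indicator K' x * ?r K' x)"
            using K elim(1) by (intro sum.mono_neutral_right[OF fin]) (auto simp: indicator_def)
          then show "v x \<bullet> grad \<phi> x = (\<Sum>K\<in>cells M. indicator K x * ?r K x)"
            using elim(2) K by simp
        qed
      qed
      then show "AE x in lebesgue_on (domain M). v x \<bullet> grad \<phi> x = (\<Sum>K\<in>cells M. indicator K x * ?r K x)"
        using domain_lebesgue(1) by (simp add: AE_restrict_space_iff)
    qed
    also have "\<dots> = (\<Sum>K\<in>cells M. integral K (?r K))"
      using int(1) cell_integral_domain(2)[OF _ cr(1)] by (subst Bochner_Integration.integral_sum) auto
    finally have 1: "(LINT x|lebesgue_on (domain M). v x \<bullet> grad \<phi> x) = (\<Sum>K\<in>cells M. integral K (?r K))" .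
    have "(LINT x|lebesgue_on (domain M). g x * \<phi> x)
        = (LINT x|lebesgue_on (domain M). (\<Sum>K\<in>cells M. indicator K x * ?d K x))"
      by (simp add: g_def sum_distrib_right mult.assoc)
    also have "\<dots> = (\<Sum>K\<in>cells M. integral K (?d K))"
      using int(2) cell_integral_domain(2)[OF _ cr(2)] by (subst Bochner_Integration.integral_sum) auto
    finally have 2: "(LINT x|lebesgue_on (domain M). g x * \<phi> x) = (\<Sum>K\<in>cells M. integral K (?d K))" .
    have "(\<Sum>K\<in>cells M. integral K (?r K)) + (\<Sum>K\<in>cells M. integral K (?d K))
        = (\<Sum>K\<in>cells M. \<Sum>F | F facet_of P. integral (S F) (\<lambda>s. ref_flux K F s * \<phi> (X K F s)))"
      by (simp add: sum.distrib[symmetric] cell_integration_by_parts[OF _ \<phi>])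
    also have "\<dots> = 0"
      using facet_sum_zero[OF c\<phi>(1)] by (simp add: facets_def sum.cartesian_product case_prod_beta)
    finally show ?thesis unfolding 1 2 by simp
  qed
  then show ?thesis using vs gs unfolding Hdiv_def by blast
qed

end

theorem lemma1:
  fixes M :: "('d::finite, 'f::finite) mesh"
    and Vhat :: "(real^'d \<Rightarrow> real^'d) set"
    and Qbhat :: "(real^'d) set \<Rightarrow> (real^'d \<Rightarrow> real) set"
    and Qloc :: "(real^'d) set \<Rightarrow> (real^'d \<Rightarrow> real) set"
  assumes dim: "CARD('d) = 2 \<or> CARD('d) = 3"
    and mesh: "conforming_mesh M"
    and Vhat: "fin_dim_space Vhat" "\<forall>v\<in>Vhat. polynomial_function v"
      "Vhat \<subseteq> Hdiv (interior (ref_cell M))"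
    and Qbhat: "\<forall>F. F facet_of ref_cell M \<longrightarrow>
      fin_dim_space (Qbhat F) \<and> (\<forall>q\<in>Qbhat F. polynomial_function q)"
    and normal_traces: "\<forall>F. F facet_of ref_cell M \<longrightarrow>
      (\<forall>v\<in>Vhat. \<exists>q\<in>Qbhat F. \<forall>y\<in>F. q y = v y \<bullet> ref_normal M F)"
    and Qbar_well_defined: "\<forall>K\<in>cells M. \<forall>K'\<in>cells M. \<forall>F F'.
      F facet_of ref_cell M \<longrightarrow> F' facet_of ref_cell M \<longrightarrow> facet M K F = facet M K' F' \<longrightarrow>
      Qbar_loc M Qbhat K F = Qbar_loc M Qbhat K' F'"
    and Qloc: "\<forall>K\<in>cells M. fin_dim_space (Qloc K)"
  shows "(\<forall>v \<in> X_glob M Vhat Qloc Qbhat. normal_continuous M v) \<and>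
    X_glob M Vhat Qloc Qbhat \<subseteq> Hdiv (domain M)"
proof -
  interpret mesh_ctx M using mesh dim by unfold_locales
  have "normal_continuous M v \<and> v \<in> Hdiv (domain M)" if v: "v \<in> X_glob M Vhat Qloc Qbhat" for v
  proof -
    have vV: "v \<in> V_glob M Vhat" using v by (simp add: X_glob_def)
    have C1: "C1_fun w" if "w \<in> Vhat" for w using Vhat(2) that C1_fun_polynomial by blast
    \<comment> \<open>Choosing one reference field for each cell provides the remaining parameter of
      \<open>hdg_field\<close>.\<close>
    have "\<forall>K\<in>cells M. \<exists>u. u \<in> Vhat \<and> piola_trace v K u"
      using cell_trace[OF _ vV C1] by blast
    from bchoice[OF this] obtain u where u: "\<forall>K\<in>cells M. u K \<in> Vhat \<and> piola_trace v K (u K)" ..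
    interpret hdg_field M Vhat Qbhat Qloc v u
    proof unfold_locales
      fix F assume F: "F facet_of ref_cell M"
      then show "fin_dim_space (Qbhat F)" using Qbhat by blast
      show "\<exists>q\<in>Qbhat F. \<forall>y\<in>F. q y = w y \<bullet> ref_normal M F" if "w \<in> Vhat" for w
        using normal_traces F that by blast
    next
      fix K K' F F' assume "K \<in> cells M" "K' \<in> cells M" "F facet_of ref_cell M" "F' facet_of ref_cell M"
        "facet M K F = facet M K' F'"
      then show "Qbar_loc M Qbhat K F = Qbar_loc M Qbhat K' F'"
        by (rule Qbar_well_defined[rule_format])
    qed (use Qloc v u in blast)+
    show ?thesis using normal_trace_continuous v_Hdiv by blast
  qed
  then show ?thesis by blast
qed

end
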